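(* Let $F$ be a permissible function and let $\mathds{A}=(\mathfrak{A},L_{\mathfrak{A}},G_1,\delta_1,\alpha)$, $\mathds{B}=(\mathfrak{B},L_{\mathfrak{B}},G_2,\delta_2,\beta)$ and $\mathds{E}=(\mathfrak{E},L_{\mathfrak{E}},G_3,\delta_3,\gamma)$ be three Lipschitz dynamical $F$-systems. Let $\varepsilon_1,\varepsilon_2\in(0,\frac{\sqrt2}{2})$. Let $\tau_1=(\mathfrak{D}_1,L_{\mathfrak{D}_1},\pi_1,\rho_1,\varsigma_1,\varkappa_1)$ be an $\varepsilon_1$-covariant $F$-tunnel from $\mathds{A}$ to $\mathds{B}$, and let $\tau_2=(\mathfrak{D}_2,L_{\mathfrak{D}_2},\pi_2,\rho_2,\varsigma_2,\varkappa_2)$ be an $\varepsilon_2$-covariant $F$-tunnel from $\mathds{B}$ to $\mathds{E}$. Let $\varepsilon>0$. Set $\mathfrak{D}=\mathfrak{D}_1\oplus\mathfrak{D}_2$ and, for $(d_1,d_2)\in\mathfrak{sa}(\mathfrak{D})=\mathfrak{sa}(\mathfrak{D}_1)\oplus\mathfrak{sa}(\mathfrak{D}_2)$, $$L(d_1,d_2)=\max\Big\{L_{\mathfrak{D}_1}(d_1),L_{\mathfrak{D}_2}(d_2),\tfrac1\varepsilon\|\rho_1(d_1)-\pi_2(d_2)\|_{\mathfrak{B}}\Big\}.$$ Set $\varsigma=\varsigma_2\circ\varsigma_1$, $\varkappa=\varkappa_1\circ\varkappa_2$, $\eta_1:(d_1,d_2)\in\mathfrak{D}\mapsto\pi_1(d_1)$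 and $\eta_2:(d_1,d_2)\in\mathfrak{D}\mapsto\rho_2(d_2)$. If $$\tau_1\circ_\varepsilon\tau_2=(\mathfrak{D}_1\oplus\mathfrak{D}_2,L,\eta_1,\eta_2,\varsigma,\varkappa),$$ then $\tau_1\circ_\varepsilon\tau_2$ is an $(\varepsilon_1+\varepsilon_2)$-covariant $F$-tunnel from $\mathds{A}$ to $\mathds{E}$ such that $$\mu(\tau_1\circ_\varepsilon\tau_2|\varepsilon_1+\varepsilon_2)\le\mu(\tau_1|\varepsilon_1)+\mu(\tau_2|\varepsilon_2)+\varepsilon.$$
   Context: **Quantum compact metric spaces.** For a unital C*-algebra $\mathfrak{A}$, write $\|\cdot\|_{\mathfrak{A}}$ for its norm, $\mathfrak{sa}(\mathfrak{A})$ for its self-adjoint elements, $1_{\mathfrak{A}}$ for its unit, $\mathscr{S}(\mathfrak{A})$ for its state space. If a seminorm $L$ is defined on a dense subspace $\mathrm{dom}(L)$ of $\mathfrak{sa}(\mathfrak{A})$, set $L(a)=\infty$ for $a\in\mathfrak{sa}(\mathfrak{A})\setminus\mathrm{dom}(L)$. A function $F:[0,\infty)^4\to[0,\infty)$ is *permissible* if it is increasing for the product order and $F(x,y,l_x,l_y)\ge x l_y+y l_x$ for all $x,y,l_x,l_y\ge0$. An *$F$-quasi-Leibniz quantum compact metric space* ($F$-qcms) $(\mathfrak{A},L)$ is a unital C*-algebra $\mathfrak{A}$ with a seminorm $L$ on a dense subspace $\mathrm{dom}(L)$ of $\mathfrak{sa}(\mathfrak{A})$ closed under $(a,b)\mapsto\frac{ab+ba}{2}$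 and $(a,b)\mapsto\frac{ab-ba}{2i}$, such that: (i) $L(a)=0$ iff $a\in\mathbb{R}1_{\mathfrak{A}}$; (ii) the Monge–Kantorovich metric $\mathsf{mk}_L(\varphi,\psi)=\sup\{|\varphi(a)-\psi(a)|:a\in\mathrm{dom}(L),L(a)\le1\}$ metrizes the weak* topology on $\mathscr{S}(\mathfrak{A})$; (iii) $\max\{L(\frac{ab+ba}{2}),L(\frac{ab-ba}{2i})\}\le F(\|a\|_{\mathfrak{A}},\|b\|_{\mathfrak{A}},L(a),L(b))$ for all $a,b\in\mathrm{dom}(L)$; (iv) $L$ is lower semicontinuous for $\|\cdot\|_{\mathfrak{A}}$. A *quantum isometry* $\pi:(\mathfrak{A},L_{\mathfrak{A}})\to(\mathfrak{B},L_{\mathfrak{B}})$ is a surjective unital *-morphism with $L_{\mathfrak{B}}(b)=\inf\{L_{\mathfrak{A}}(a):a\in\mathfrak{sa}(\mathfrak{A}),\pi(a)=b\}$ for all $b\in\mathfrak{sa}(\mathfrak{B})$. **Proper monoids.** A *proper monoid* $(G,\delta)$ is a monoid with a left-invariant metric $\delta$ ($\delta(gh,gh')=\delta(h,h')$) for which multiplication is continuous and all closed balls are compact. With $e$ the identity, $G[r]$ is the closed ball of center $e$ and radius $r$. For $\varepsilon,r\ge0$, $\mathsf{UIso}_\varepsilon((G_1,\delta_1)\to(G_2,\delta_2)|r)$ is the set of pairs of maps $\varsigma_1:G_1[r]\to G_2$, $\varsigma_2:G_2[r]\to G_1$ mapping identity to identity and such that for $\{j,k\}=\{1,2\}$, all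 $g,g'\in G_j[r]$, $h\in G_k[r]$: $|\delta_k(\varsigma_j(g)\varsigma_j(g'),h)-\delta_j(gg',\varsigma_k(h))|\le\varepsilon$. Maps with larger domains are said to form a pair in this set when their restrictions to the balls $G_j[r]$ do; composites such as $\varsigma_2\circ\varsigma_1$ are taken on their natural domain. **Lipschitz dynamical $F$-systems.** For a unital positive linear map $\pi:\mathfrak{A}\to\mathfrak{B}$ between such spaces, $\mathrm{dil}(\pi)=\inf\{k>0:\forall a\in\mathfrak{sa}(\mathfrak{A})\ L_{\mathfrak{B}}(\pi(a))\le kL_{\mathfrak{A}}(a)\}$ ($=\infty$ if no such $k$). A *Lipschitz dynamical $F$-system* $(\mathfrak{A},L,G,\delta,\alpha)$ is an $F$-qcms $(\mathfrak{A},L)$, a proper monoid $(G,\delta)$ and a monoid morphism $\alpha$ from $G$ to the positive unital linear maps of $\mathfrak{A}$, such that $\lim_{h\to g}\|\alpha^h(a)-\alpha^g(a)\|_{\mathfrak{A}}=0$ for all $a\in\mathfrak{A},g\in G$, and every $g\in G$ has a neighborhood on which $h\mapsto\mathrm{dil}(\alpha^h)$ is bounded by some finite $D$. **Covariant tunnels.** An *$\varepsilon$-covariant $F$-tunnel* ($\varepsilon>0$) $\tau=(\mathfrak{D},L_{\mathfrak{D}},\pi_1,\pi_2,\varsigma_1,\varsigma_2)$ from $(\mathfrak{A}_1,L_1,G_1,\delta_1,\alpha_1)$ to $(\mathfrak{A}_2,L_2,G_2,\delta_2,\alpha_2)$ consists of $(\varsigma_1,\varsigma_2)\in\mathsf{UIso}_\varepsilon((G_1,\delta_1)\to(G_2,\delta_2)|\frac1\varepsilon)$,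 an $F$-qcms $(\mathfrak{D},L_{\mathfrak{D}})$ and two quantum isometries $\pi_j:(\mathfrak{D},L_{\mathfrak{D}})\to(\mathfrak{A}_j,L_j)$. Its *extent* is $\chi(\tau)=\max_{j}\mathsf{Haus}_{\mathsf{mk}_{L_{\mathfrak{D}}}}(\mathscr{S}(\mathfrak{D}),\{\varphi\circ\pi_j:\varphi\in\mathscr{S}(\mathfrak{A}_j)\})$ (Hausdorff distance); its *$\varepsilon$-reach* is $$\rho(\tau|\varepsilon)=\max_{\{j,k\}=\{1,2\}}\sup_{\varphi\in\mathscr{S}(\mathfrak{A}_j)}\inf_{\psi\in\mathscr{S}(\mathfrak{A}_k)}\sup_{g\in G_j[1/\varepsilon]}\mathsf{mk}_{L_{\mathfrak{D}}}(\varphi\circ\alpha_j^g\circ\pi_j,\psi\circ\alpha_k^{\varsigma_j(g)}\circ\pi_k);$$ its *$\varepsilon$-magnitude* is $\mu(\tau|\varepsilon)=\max\{\rho(\tau|\varepsilon),\chi(\tau)\}$. *)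

theory Defs
  imports "HOL-Analysis.Analysis"
begin

section \<open>Unital C*-algebras\<close>

text \<open>
  The superclass contributes \<^term>\<open>(0::'a::real_normed_algebra_1) \<noteq> 1\<close>: the zero algebra,
  whose state space is empty, is not a unital C*-algebra here.
\<close>

class unital_cstar_algebra = real_normed_algebra_1 + banach +
  fixes scaleC :: "complex \<Rightarrow> 'a \<Rightarrow> 'a"  (infixr \<open>*\<^sub>C\<close> 75)
    and adj :: "'a \<Rightarrow> 'a"
  assumes scaleC_add_right: "c *\<^sub>C (x + y) = c *\<^sub>C x + c *\<^sub>C y"
    and scaleC_add_left: "(b + c) *\<^sub>C x = b *\<^sub>C x + c *\<^sub>C x"
    and scaleC_scaleC: "b *\<^sub>C c *\<^sub>C x = (b * c) *\<^sub>C x"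
    and scaleR_scaleC: "r *\<^sub>R x = complex_of_real r *\<^sub>C x"
    and mult_scaleC_left: "(c *\<^sub>C x) * y = c *\<^sub>C (x * y)"
    and mult_scaleC_right: "x * (c *\<^sub>C y) = c *\<^sub>C (x * y)"
    and norm_scaleC: "norm (c *\<^sub>C x) = cmod c * norm x"
    and adj_adj: "adj (adj x) = x"
    and adj_add: "adj (x + y) = adj x + adj y"
    and adj_scaleC: "adj (c *\<^sub>C x) = cnj c *\<^sub>C adj x"
    and adj_mult: "adj (x * y) = adj y * adj x"
    and norm_adj_mult: "norm (adj x * x) = (norm x)\<^sup>2"

instantiation complex :: unital_cstar_algebra
begin

definition scaleC_complex :: "complex \<Rightarrow> complex \<Rightarrow> complex" where
  "scaleC_complex c z = c * z"

definition adj_complex :: "complex \<Rightarrow> complex" where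
  "adj_complex = cnj"

instance
  by standard
    (auto simp: scaleC_complex_def adj_complex_def algebra_simps scaleR_conv_of_real
      norm_mult power2_eq_square)

end

lemma vector_space_scaleC: "vector_space (scaleC :: complex \<Rightarrow> 'a::unital_cstar_algebra \<Rightarrow> 'a)"
  by unfold_locales
    (auto simp: scaleC_add_right scaleC_add_left scaleC_scaleC
      scaleR_scaleC[of 1, simplified, symmetric])

abbreviation clinear :: "('a::unital_cstar_algebra \<Rightarrow> 'b::unital_cstar_algebra) \<Rightarrow> bool" where
  "clinear \<equiv> Vector_Spaces.linear scaleC scaleC"

definition sa :: "'a::unital_cstar_algebra set" where
  "sa = {a. adj a = a}"

definition positive_elements :: "'a::unital_cstar_algebra set" where
  "positive_elements = range (\<lambda>a. adj a * a)"

definition positive_unital_linear ::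
    "('a::unital_cstar_algebra \<Rightarrow> 'b::unital_cstar_algebra) \<Rightarrow> bool" where
  "positive_unital_linear f \<longleftrightarrow>
     clinear f \<and> f 1 = 1 \<and> f ` positive_elements \<subseteq> positive_elements"

definition unital_star_morphism ::
    "('a::unital_cstar_algebra \<Rightarrow> 'b::unital_cstar_algebra) \<Rightarrow> bool" where
  "unital_star_morphism f \<longleftrightarrow>
     clinear f \<and> f 1 = 1 \<and> (\<forall>x y. f (x * y) = f x * f y) \<and> (\<forall>x. f (adj x) = adj (f x))"

definition states :: "('a::unital_cstar_algebra \<Rightarrow> complex) set" where
  "states = {\<phi>. clinear \<phi> \<and> \<phi> 1 = 1 \<and> (\<forall>a\<in>positive_elements. \<phi> a \<in> nonneg_Reals)}"

definition weak_star_topology :: "('a::unital_cstar_algebra \<Rightarrow> complex) topology" where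
  "weak_star_topology = subtopology (product_topology (\<lambda>_. euclidean) UNIV) states"


section \<open>The direct sum of two C*-algebras\<close>

text \<open>
  The product type of the library carries the Euclidean norm, under which it is not a
  C*-algebra; the direct sum has the maximum norm and is therefore a separate type.
\<close>

datatype ('a, 'b) dsum = DSum (dfst: 'a) (dsnd: 'b)

instantiation dsum :: (real_normed_vector, real_normed_vector) real_normed_vector
begin

definition "0 = DSum 0 0"
definition "x + y = DSum (dfst x + dfst y) (dsnd x + dsnd y)"
definition "x - y = DSum (dfst x - dfst y) (dsnd x - dsnd y)"
definition "- x = DSum (- dfst x) (- dsnd x)" for x :: "('a, 'b) dsum"
definition "r *\<^sub>R x = DSum (r *\<^sub>R dfst x) (r *\<^sub>R dsnd x)" for x :: "('a, 'b) dsum"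
definition "norm x = max (norm (dfst x)) (norm (dsnd x))" for x :: "('a, 'b) dsum"
definition "dist x y = norm (x - y)" for x y :: "('a, 'b) dsum"
definition "sgn x = inverse (norm x) *\<^sub>R x" for x :: "('a, 'b) dsum"
definition [code del]:
  "(uniformity :: (('a, 'b) dsum \<times> ('a, 'b) dsum) filter) =
     (INF e\<in>{0<..}. principal {(x, y). dist x y < e})"
definition [code del]:
  "open U \<longleftrightarrow> (\<forall>x\<in>U. \<forall>\<^sub>F (x', y) in uniformity. x' = x \<longrightarrow> y \<in> U)"
  for U :: "('a, 'b) dsum set"

lemmas dsum_vector_defs = zero_dsum_def plus_dsum_def minus_dsum_def uminus_dsum_def
  scaleR_dsum_def norm_dsum_def

instance
proof
  fix x y z :: "('a, 'b) dsum" and r s :: real and U :: "('a, 'b) dsum set"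
  show "x + y + z = x + (y + z)" "x + y = y + x" "0 + x = x" "- x + x = 0" "x - y = x + - y"
    by (auto simp: dsum_vector_defs algebra_simps)
  show "r *\<^sub>R (x + y) = r *\<^sub>R x + r *\<^sub>R y" "(r + s) *\<^sub>R x = r *\<^sub>R x + s *\<^sub>R x"
    "r *\<^sub>R s *\<^sub>R x = (r * s) *\<^sub>R x" "1 *\<^sub>R x = x"
    by (auto simp: dsum_vector_defs algebra_simps)
  show "dist x y = norm (x - y)" "sgn x = inverse (norm x) *\<^sub>R x"
    by (auto simp: dist_dsum_def sgn_dsum_def)
  show "(uniformity :: (('a, 'b) dsum \<times> ('a, 'b) dsum) filter) =
      (INF e\<in>{0<..}. principal {(x, y). dist x y < e})"
    "open U \<longleftrightarrow> (\<forall>x\<in>U. \<forall>\<^sub>F (x', y) in uniformity. x' = x \<longrightarrow> y \<in> U)"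
    by (simp_all add: uniformity_dsum_def open_dsum_def)
  show "norm x = 0 \<longleftrightarrow> x = 0"
    by (cases x) (auto simp: dsum_vector_defs max_def split: if_splits; metis norm_le_zero_iff)
  show "norm (x + y) \<le> norm x + norm y"
    using norm_triangle_ineq[of "dfst x" "dfst y"] norm_triangle_ineq[of "dsnd x" "dsnd y"]
    by (auto simp: dsum_vector_defs)
  show "norm (r *\<^sub>R x) = \<bar>r\<bar> * norm x"
    by (auto simp: dsum_vector_defs max_mult_distrib_left)
qed

end

instance dsum :: (banach, banach) banach
proof
  fix X :: "nat \<Rightarrow> ('a, 'b) dsum"
  assume X: "Cauchy X"
  have "dist (dfst x) (dfst y) \<le> dist x y" "dist (dsnd x) (dsnd y) \<le> dist x y"
    for x y :: "('a, 'b) dsum"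
    by (auto simp: dist_norm dsum_vector_defs)
  then have "Cauchy (\<lambda>n. dfst (X n))" "Cauchy (\<lambda>n. dsnd (X n))"
    using X unfolding Cauchy_def by (meson le_less_trans)+
  then obtain a b where a: "(\<lambda>n. dfst (X n)) \<longlonglongrightarrow> a" and b: "(\<lambda>n. dsnd (X n)) \<longlonglongrightarrow> b"
    by (metis Cauchy_convergent_iff convergent_def)
  have "X \<longlonglongrightarrow> DSum a b"
    unfolding lim_sequentially
  proof (intro allI impI)
    fix e :: real assume "e > 0"
    obtain N where N: "\<forall>n\<ge>N. dist (dfst (X n)) a < e"
      using a \<open>e > 0\<close> unfolding lim_sequentially by blast
    obtain N' where N': "\<forall>n\<ge>N'. dist (dsnd (X n)) b < e"
      using b \<open>e > 0\<close> unfolding lim_sequentially by blast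
    show "\<exists>N. \<forall>n\<ge>N. dist (X n) (DSum a b) < e"
      using N N' by (intro exI[of _ "max N N'"]) (auto simp: dist_norm dsum_vector_defs)
  qed
  then show "convergent X" by (auto simp: convergent_def)
qed

instantiation dsum :: (unital_cstar_algebra, unital_cstar_algebra) unital_cstar_algebra
begin

definition "1 = DSum 1 1"
definition "x * y = DSum (dfst x * dfst y) (dsnd x * dsnd y)"
definition "c *\<^sub>C x = DSum (c *\<^sub>C dfst x) (c *\<^sub>C dsnd x)" for x :: "('a, 'b) dsum"
definition "adj x = DSum (adj (dfst x)) (adj (dsnd x))" for x :: "('a, 'b) dsum"

lemmas dsum_defs = dsum_vector_defs one_dsum_def times_dsum_def scaleC_dsum_def adj_dsum_def

instance
proof
  fix x y z :: "('a, 'b) dsum" and r :: real and b c :: complex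
  show "x * y * z = x * (y * z)" "(x + y) * z = x * z + y * z" "x * (y + z) = x * y + x * z"
    "r *\<^sub>R x * y = r *\<^sub>R (x * y)" "x * r *\<^sub>R y = r *\<^sub>R (x * y)"
    "1 * x = x" "x * 1 = x" "(0 :: ('a, 'b) dsum) \<noteq> 1"
    by (auto simp: dsum_defs algebra_simps)
  show "norm (x * y) \<le> norm x * norm y"
    unfolding dsum_defs dsum.sel
    by (intro max.boundedI order_trans[OF norm_mult_ineq] mult_mono)
      (auto simp: le_max_iff_disj)
  show "norm (1 :: ('a, 'b) dsum) = 1"
    by (auto simp: dsum_defs)
  show "c *\<^sub>C (x + y) = c *\<^sub>C x + c *\<^sub>C y" "(b + c) *\<^sub>C x = b *\<^sub>C x + c *\<^sub>C x"
    "b *\<^sub>C c *\<^sub>C x = (b * c) *\<^sub>C x" "r *\<^sub>R x = complex_of_real r *\<^sub>C x"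
    "c *\<^sub>C x * y = c *\<^sub>C (x * y)" "x * c *\<^sub>C y = c *\<^sub>C (x * y)"
    by (auto simp: dsum_defs scaleC_add_right scaleC_add_left scaleC_scaleC scaleR_scaleC
        mult_scaleC_left mult_scaleC_right)
  show "norm (c *\<^sub>C x) = cmod c * norm x"
    by (auto simp: dsum_defs norm_scaleC max_mult_distrib_left)
  show "adj (adj x) = x" "adj (x + y) = adj x + adj y" "adj (c *\<^sub>C x) = cnj c *\<^sub>C adj x"
    "adj (x * y) = adj y * adj x"
    by (auto simp: dsum_defs adj_adj adj_add adj_scaleC adj_mult)
  show "norm (adj x * x) = (norm x)\<^sup>2"
    by (auto simp: dsum_defs norm_adj_mult max_def power_mono intro!: antisym)
qed

end


section \<open>Quantum compact metric spaces\<close>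

text \<open>
  A seminorm on a dense subspace of \<^term>\<open>sa\<close> is encoded by its extension by \<^term>\<open>top\<close>
  to \<^term>\<open>sa\<close>. Its values at elements that are not self-adjoint are arbitrary and never used.
\<close>

definition permissible :: "(real \<Rightarrow> real \<Rightarrow> real \<Rightarrow> real \<Rightarrow> real) \<Rightarrow> bool" where
  "permissible F \<longleftrightarrow>
     (\<forall>x y l m. 0 \<le> x \<longrightarrow> 0 \<le> y \<longrightarrow> 0 \<le> l \<longrightarrow> 0 \<le> m \<longrightarrow> 0 \<le> F x y l m) \<and>
     (\<forall>x y l m x' y' l' m'. 0 \<le> x \<longrightarrow> 0 \<le> y \<longrightarrow> 0 \<le> l \<longrightarrow> 0 \<le> m \<longrightarrow>
        x \<le> x' \<longrightarrow> y \<le> y' \<longrightarrow> l \<le> l' \<longrightarrow> m \<le> m' \<longrightarrow> F x y l m \<le> F x' y' l' m') \<and>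
     (\<forall>x y l m. 0 \<le> x \<longrightarrow> 0 \<le> y \<longrightarrow> 0 \<le> l \<longrightarrow> 0 \<le> m \<longrightarrow> x * m + y * l \<le> F x y l m)"

definition Ldom :: "('a::unital_cstar_algebra \<Rightarrow> ennreal) \<Rightarrow> 'a set" where
  "Ldom L = {a \<in> sa. L a < top}"

definition mk :: "('a::unital_cstar_algebra \<Rightarrow> ennreal) \<Rightarrow>
    ('a \<Rightarrow> complex) \<Rightarrow> ('a \<Rightarrow> complex) \<Rightarrow> ennreal" where
  "mk L \<phi> \<psi> = (SUP a\<in>{a \<in> Ldom L. L a \<le> 1}. ennreal (cmod (\<phi> a - \<psi> a)))"

definition metrizes_weak_star :: "('a::unital_cstar_algebra \<Rightarrow> ennreal) \<Rightarrow> bool" where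
  "metrizes_weak_star L \<longleftrightarrow>
     (\<forall>\<phi>\<in>states. \<forall>\<psi>\<in>states. mk L \<phi> \<psi> < top) \<and>
     Metric_space states (\<lambda>\<phi> \<psi>. enn2real (mk L \<phi> \<psi>)) \<and>
     Metric_space.mtopology states (\<lambda>\<phi> \<psi>. enn2real (mk L \<phi> \<psi>)) = weak_star_topology"

definition jordan :: "'a::unital_cstar_algebra \<Rightarrow> 'a \<Rightarrow> 'a" where
  "jordan a b = (1 / 2) *\<^sub>C (a * b + b * a)"

definition lie :: "'a::unital_cstar_algebra \<Rightarrow> 'a \<Rightarrow> 'a" where
  "lie a b = (1 / (2 * \<i>)) *\<^sub>C (a * b - b * a)"

definition qcms :: "(real \<Rightarrow> real \<Rightarrow> real \<Rightarrow> real \<Rightarrow> real) \<Rightarrow>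
    ('a::unital_cstar_algebra \<Rightarrow> ennreal) \<Rightarrow> bool" where
  "qcms F L \<longleftrightarrow>
     subspace (Ldom L) \<and>
     sa \<subseteq> closure (Ldom L) \<and>
     (\<forall>a\<in>Ldom L. \<forall>b\<in>Ldom L. L (a + b) \<le> L a + L b) \<and>
     (\<forall>a\<in>Ldom L. \<forall>r. L (r *\<^sub>R a) = ennreal \<bar>r\<bar> * L a) \<and>
     (\<forall>a\<in>Ldom L. \<forall>b\<in>Ldom L. jordan a b \<in> Ldom L \<and> lie a b \<in> Ldom L) \<and>
     (\<forall>a\<in>sa. L a = 0 \<longleftrightarrow> (\<exists>r. a = r *\<^sub>R 1)) \<and>
     metrizes_weak_star L \<and>
     (\<forall>a\<in>Ldom L. \<forall>b\<in>Ldom L. max (L (jordan a b)) (L (lie a b))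
        \<le> ennreal (F (norm a) (norm b) (enn2real (L a)) (enn2real (L b)))) \<and>
     (\<forall>a\<in>sa. \<forall>c<L a. \<forall>\<^sub>F x in at a within sa. c < L x)"

definition quantum_isometry :: "('a::unital_cstar_algebra \<Rightarrow> ennreal) \<Rightarrow>
    ('b::unital_cstar_algebra \<Rightarrow> ennreal) \<Rightarrow> ('a \<Rightarrow> 'b) \<Rightarrow> bool" where
  "quantum_isometry LA LB \<pi> \<longleftrightarrow>
     unital_star_morphism \<pi> \<and> surj \<pi> \<and> (\<forall>b\<in>sa. LB b = (INF a\<in>{a \<in> sa. \<pi> a = b}. LA a))"

definition dil :: "('a::unital_cstar_algebra \<Rightarrow> ennreal) \<Rightarrow>
    ('b::unital_cstar_algebra \<Rightarrow> ennreal) \<Rightarrow> ('a \<Rightarrow> 'b) \<Rightarrow> ennreal" where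
  "dil LA LB \<pi> = Inf {ennreal k |k. k > 0 \<and> (\<forall>a\<in>sa. LB (\<pi> a) \<le> ennreal k * LA a)}"


section \<open>Proper monoids and Lipschitz dynamical systems\<close>

text \<open>
  The second axiom is joint continuity of the multiplication and the third is compactness of
  \<^term>\<open>cball g r\<close>; the type class instance for products and \<^term>\<open>cball\<close> cannot be used
  inside the class specification.
\<close>

class proper_monoid = monoid_mult + metric_space +
  assumes dist_mult_left: "dist (g * h) (g * h') = dist h h'"
    and continuous_mult: "((\<lambda>(g', h'). g' * h') \<longlongrightarrow> g * h) (nhds g \<times>\<^sub>F nhds h)"
    and compact_closed_ball: "compact {h. dist g h \<le> r}"

text \<open>
  Maps between parts of monoids are partial functions, so that \<^term>\<open>(\<circ>\<^sub>m)\<close> is composition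
  on the natural domain. Membership only concerns the restrictions to the balls of radius
  \<open>r\<close>, which the domains have to contain.
\<close>

definition UIso :: "real \<Rightarrow> real \<Rightarrow>
    (('g::proper_monoid \<rightharpoonup> 'h::proper_monoid) \<times> ('h \<rightharpoonup> 'g)) set" where
  "UIso \<epsilon> r = {(s1, s2).
     cball 1 r \<subseteq> dom s1 \<and> cball 1 r \<subseteq> dom s2 \<and> s1 1 = Some 1 \<and> s2 1 = Some 1 \<and>
     (\<forall>g\<in>cball 1 r. \<forall>g'\<in>cball 1 r. \<forall>h\<in>cball 1 r.
        \<bar>dist (the (s1 g) * the (s1 g')) h - dist (g * g') (the (s2 h))\<bar> \<le> \<epsilon>) \<and>
     (\<forall>g\<in>cball 1 r. \<forall>g'\<in>cball 1 r. \<forall>h\<in>cball 1 r.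
        \<bar>dist (the (s2 g) * the (s2 g')) h - dist (g * g') (the (s1 h))\<bar> \<le> \<epsilon>)}"

record ('a, 'g) system =
  sysL :: "'a \<Rightarrow> ennreal"
  act :: "'g \<Rightarrow> 'a \<Rightarrow> 'a"

definition lipschitz_dynamical_system :: "(real \<Rightarrow> real \<Rightarrow> real \<Rightarrow> real \<Rightarrow> real) \<Rightarrow>
    ('a::unital_cstar_algebra, 'g::proper_monoid) system \<Rightarrow> bool" where
  "lipschitz_dynamical_system F A \<longleftrightarrow>
     qcms F (sysL A) \<and>
     (\<forall>g. positive_unital_linear (act A g)) \<and>
     act A 1 = id \<and> (\<forall>g h. act A (g * h) = act A g \<circ> act A h) \<and>
     (\<forall>a g. ((\<lambda>h. norm (act A h a - act A g a)) \<longlongrightarrow> 0) (at g)) \<and>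
     (\<forall>g. \<exists>D::real. \<forall>\<^sub>F h in nhds g. dil (sysL A) (sysL A) (act A h) \<le> ennreal D)"


section \<open>Covariant tunnels\<close>

record ('d, 'a, 'b, 'g, 'h) tunnel =
  tunL :: "'d \<Rightarrow> ennreal"
  pi1 :: "'d \<Rightarrow> 'a"
  pi2 :: "'d \<Rightarrow> 'b"
  sig1 :: "'g \<rightharpoonup> 'h"
  sig2 :: "'h \<rightharpoonup> 'g"

definition covariant_tunnel :: "(real \<Rightarrow> real \<Rightarrow> real \<Rightarrow> real \<Rightarrow> real) \<Rightarrow> real \<Rightarrow>
    ('a::unital_cstar_algebra, 'g::proper_monoid) system \<Rightarrow>
    ('b::unital_cstar_algebra, 'h::proper_monoid) system \<Rightarrow>
    ('d::unital_cstar_algebra, 'a, 'b, 'g, 'h) tunnel \<Rightarrow> bool" where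
  "covariant_tunnel F \<epsilon> A B \<tau> \<longleftrightarrow>
     \<epsilon> > 0 \<and>
     (sig1 \<tau>, sig2 \<tau>) \<in> UIso \<epsilon> (1 / \<epsilon>) \<and>
     qcms F (tunL \<tau>) \<and>
     quantum_isometry (tunL \<tau>) (sysL A) (pi1 \<tau>) \<and>
     quantum_isometry (tunL \<tau>) (sysL B) (pi2 \<tau>)"

definition haus :: "('x \<Rightarrow> 'x \<Rightarrow> ennreal) \<Rightarrow> 'x set \<Rightarrow> 'x set \<Rightarrow> ennreal" where
  "haus d X Y = max (SUP x\<in>X. INF y\<in>Y. d x y) (SUP y\<in>Y. INF x\<in>X. d x y)"

definition extent :: "('d::unital_cstar_algebra, 'a::unital_cstar_algebra,
    'b::unital_cstar_algebra, 'g, 'h) tunnel \<Rightarrow> ennreal" where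
  "extent \<tau> = max
     (haus (mk (tunL \<tau>)) states ((\<lambda>\<phi>. \<phi> \<circ> pi1 \<tau>) ` states))
     (haus (mk (tunL \<tau>)) states ((\<lambda>\<phi>. \<phi> \<circ> pi2 \<tau>) ` states))"

definition reach :: "real \<Rightarrow>
    ('a::unital_cstar_algebra, 'g::proper_monoid) system \<Rightarrow>
    ('b::unital_cstar_algebra, 'h::proper_monoid) system \<Rightarrow>
    ('d::unital_cstar_algebra, 'a, 'b, 'g, 'h) tunnel \<Rightarrow> ennreal" where
  "reach \<epsilon> A B \<tau> = max
     (SUP \<phi>\<in>states. INF \<psi>\<in>states. SUP g\<in>cball 1 (1 / \<epsilon>).
        mk (tunL \<tau>) (\<phi> \<circ> act A g \<circ> pi1 \<tau>) (\<psi> \<circ> act B (the (sig1 \<tau> g)) \<circ> pi2 \<tau>))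
     (SUP \<phi>\<in>states. INF \<psi>\<in>states. SUP g\<in>cball 1 (1 / \<epsilon>).
        mk (tunL \<tau>) (\<phi> \<circ> act B g \<circ> pi2 \<tau>) (\<psi> \<circ> act A (the (sig2 \<tau> g)) \<circ> pi1 \<tau>))"

definition magnitude :: "real \<Rightarrow>
    ('a::unital_cstar_algebra, 'g::proper_monoid) system \<Rightarrow>
    ('b::unital_cstar_algebra, 'h::proper_monoid) system \<Rightarrow>
    ('d::unital_cstar_algebra, 'a, 'b, 'g, 'h) tunnel \<Rightarrow> ennreal" where
  "magnitude \<epsilon> A B \<tau> = max (reach \<epsilon> A B \<tau>) (extent \<tau>)"

definition tunnel_comp :: "real \<Rightarrow>
    ('d1::unital_cstar_algebra, 'a, 'b::unital_cstar_algebra, 'g1, 'g2) tunnel \<Rightarrow>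
    ('d2::unital_cstar_algebra, 'b, 'e, 'g2, 'g3) tunnel \<Rightarrow>
    (('d1, 'd2) dsum, 'a, 'e, 'g1, 'g3) tunnel" where
  "tunnel_comp \<epsilon> \<tau>\<^sub>1 \<tau>\<^sub>2 = \<lparr>
     tunL = (\<lambda>d. Max {tunL \<tau>\<^sub>1 (dfst d), tunL \<tau>\<^sub>2 (dsnd d),
       ennreal (1 / \<epsilon> * norm (pi2 \<tau>\<^sub>1 (dfst d) - pi1 \<tau>\<^sub>2 (dsnd d)))}),
     pi1 = (\<lambda>d. pi1 \<tau>\<^sub>1 (dfst d)),
     pi2 = (\<lambda>d. pi2 \<tau>\<^sub>2 (dsnd d)),
     sig1 = sig1 \<tau>\<^sub>2 \<circ>\<^sub>m sig1 \<tau>\<^sub>1,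
     sig2 = sig2 \<tau>\<^sub>1 \<circ>\<^sub>m sig2 \<tau>\<^sub>2\<rparr>"

end

theory Submission
  imports Defs
begin

text \<open>
  The numerical estimate is a triangle inequality through the algebra \<open>B\<close> in the middle. If
  \<open>L d \<le> 1\<close> for the seminorm of the composite, then both components of \<open>d\<close> have seminorm at most
  one and their images in \<open>B\<close> are at distance at most \<open>\<epsilon>\<close>. So every state of \<open>B\<close> is a bridge of
  length \<open>\<epsilon>\<close> between its two pullbacks to the summands (\<open>mk_bridge\<close>), and a state of the first
  summand is close to a state of the second as soon as each of them is close to a pullback of one
  state of \<open>B\<close> (\<open>mk_cross\<close>). For the reach, the state of \<open>B\<close> offered by the first tunnel is fed
  to the second tunnel (\<open>reach_p1_to_p2\<close>). For the extent, a state of the direct sum is a convex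
  combination of a state of each summand; the first is moved to \<open>A\<close> directly, the second through \<open>B\<close>
  (\<open>approximation_by_pullbacks_p1\<close>). On the side of the monoids, the maps of an almost isometry move
  distances to the identity by at most \<open>\<epsilon>\<^sub>1\<close>, and the bound \<open>sqrt 2 / 2\<close> makes the ball of radius
  \<open>1 / (\<epsilon>\<^sub>1 + \<epsilon>\<^sub>2) + \<epsilon>\<^sub>1\<close> fit in the ball of radius \<open>1 / \<epsilon>\<^sub>2\<close>, so that the composites are defined and
  the two defects add up (\<open>UIso_comp\<close>).

  It remains to see that the direct sum is a quantum compact metric space (\<open>qcms_glued\<close>). The delicate
  axiom is that the new metric induces the weak-star topology. Let the states
  \<open>t \<phi>\<^sub>1 + (1 - t) \<phi>\<^sub>2\<close> approach a fixed \<open>s \<psi>\<^sub>1 + (1 - s) \<psi>\<^sub>2\<close>. Then \<open>t\<close> approaches \<open>s\<close>, but \<open>\<phi>\<^sub>1\<close> need not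
  approach \<open>\<psi>\<^sub>1\<close> when \<open>s = 0\<close>. The states \<open>t \<phi>\<^sub>1 + (1 - t) \<psi>\<^sub>1\<close> and \<open>(1 - t) \<phi>\<^sub>2 + t \<psi>\<^sub>2\<close> of the summands,
  however, always approach \<open>\<psi>\<^sub>1\<close> and \<open>\<psi>\<^sub>2\<close>, and the distance to be estimated is at most the sum of
  their distances to \<open>\<psi>\<^sub>1\<close> and \<open>\<psi>\<^sub>2\<close> and of \<open>\<bar>t - s\<bar>\<close> times a constant (\<open>mk_mix_mix_le\<close>). The constant
  is finite by \<open>mk_cross\<close>, which takes one state of \<open>B\<close>.

  Three facts on C*-algebras carry this: star morphisms are contractive, states exist, and states
  are bounded by the norm on self-adjoint elements. They are derived from the C*-identity by means of
  square roots of \<open>1 - x\<close> for self-adjoint \<open>x\<close> in the unit ball, given by the binomial series. The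
  existence of states also rests on the positivity of \<open>adj a * a\<close>.
\<close>


section \<open>Self-adjoint elements and complex linearity\<close>


lemma clinear_iff:
  "clinear f \<longleftrightarrow> (\<forall>x y. f (x + y) = f x + f y) \<and> (\<forall>c x. f (c *\<^sub>C x) = c *\<^sub>C f x)"
  by (auto simp: Vector_Spaces.linear_def module_hom_def module_hom_axioms_def
      vector_space_scaleC module_iff_vector_space)

lemma scaleC_complex [simp]: "c *\<^sub>C (z::complex) = c * z"
  by (simp add: scaleC_complex_def)

lemma scaleC_zero_left [simp]: "0 *\<^sub>C x = (0::'a::unital_cstar_algebra)"
  using scaleR_scaleC[of 0 x] by simp

lemma scaleC_one [simp]: "1 *\<^sub>C x = (x::'a::unital_cstar_algebra)"
  using scaleR_scaleC[of 1 x] by simp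

lemma scaleC_minus_left: "(- c) *\<^sub>C x = - (c *\<^sub>C (x::'a::unital_cstar_algebra))"
  using scaleC_add_left[of c "-c" x] by (simp add: eq_neg_iff_add_eq_0 add.commute)

lemma scaleC_zero_right [simp]: "c *\<^sub>C 0 = (0::'a::unital_cstar_algebra)"
  using scaleC_add_right[of c 0 0] by simp

lemma scaleC_minus_right: "c *\<^sub>C (- x) = - (c *\<^sub>C (x::'a::unital_cstar_algebra))"
  using scaleC_add_right[of c x "-x"] by (simp add: eq_neg_iff_add_eq_0 add.commute)

lemma scaleC_diff_right: "c *\<^sub>C (x - y) = c *\<^sub>C x - c *\<^sub>C (y::'a::unital_cstar_algebra)"
  using scaleC_add_right[of c x "-y"] by (simp add: scaleC_minus_right)

lemma clinear_scaleR: "clinear f \<Longrightarrow> f (r *\<^sub>R x) = r *\<^sub>R f x"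
  by (simp add: clinear_iff scaleR_scaleC)

lemma clinear_add: "clinear f \<Longrightarrow> f (x + y) = f x + f y"
  by (simp add: clinear_iff)

lemma clinear_scaleC: "clinear f \<Longrightarrow> f (c *\<^sub>C x) = c *\<^sub>C f x"
  by (simp add: clinear_iff)

lemma clinear_minus: "clinear f \<Longrightarrow> f (- x) = - f x"
  using clinear_scaleR[of f "-1" x] by simp

lemma clinear_diff: "clinear f \<Longrightarrow> f (x - y) = f x - f y"
  using clinear_add[of f x "-y"] by (simp add: clinear_minus)

lemma clinear_zero: "clinear f \<Longrightarrow> f 0 = 0"
  using clinear_scaleC[of f 0 0] by simp

lemma adj_scaleR: "adj (r *\<^sub>R x) = r *\<^sub>R adj (x::'a::unital_cstar_algebra)"
  by (simp add: scaleR_scaleC adj_scaleC)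

lemma adj_zero [simp]: "adj 0 = (0::'a::unital_cstar_algebra)"
  using adj_scaleC[of 0 0] by simp

lemma adj_minus: "adj (- x) = - adj (x::'a::unital_cstar_algebra)"
  using adj_scaleR[of "-1" x] by simp

lemma adj_diff: "adj (x - y) = adj x - adj (y::'a::unital_cstar_algebra)"
  using adj_add[of x "-y"] by (simp add: adj_minus)

lemma adj_one [simp]: "adj 1 = (1::'a::unital_cstar_algebra)"
  by (metis adj_adj adj_mult mult_1 mult_1_right)

lemma norm_adj [simp]: "norm (adj x) = norm (x::'a::unital_cstar_algebra)"
proof -
  have *: "norm y \<le> norm (adj y)" for y :: 'a
    using norm_mult_ineq[of "adj y" y]
    by (cases "norm y = 0") (auto simp: norm_adj_mult power2_eq_square)
  show ?thesis
    using *[of x] *[of "adj x"] by (simp add: adj_adj)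
qed

lemma bounded_linear_adj: "bounded_linear (adj :: 'a::unital_cstar_algebra \<Rightarrow> 'a)"
  by (rule bounded_linear_intro[where K=1]) (auto simp: adj_add adj_scaleR)

lemma sa_iff: "a \<in> sa \<longleftrightarrow> adj a = a"
  by (simp add: sa_def)

lemma subspace_sa: "subspace (sa :: 'a::unital_cstar_algebra set)"
  by (auto simp: subspace_def sa_iff adj_add adj_scaleR)

lemmas sa_add = subspace_add[OF subspace_sa]
  and sa_diff = subspace_diff[OF subspace_sa]
  and sa_minus = subspace_neg[OF subspace_sa]
  and sa_scaleR = subspace_scale[OF subspace_sa]
  and sa_zero = subspace_0[OF subspace_sa]

lemma sa_one [simp]: "(1::'a::unital_cstar_algebra) \<in> sa"
  by (simp add: sa_iff)

lemma sa_mult: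
  assumes "a \<in> sa" "b \<in> sa" "a * b = b * a"
  shows "a * b \<in> sa"
  using assms by (simp add: sa_iff adj_mult)

lemma sa_adj_mult: "adj a * a \<in> sa"
  by (simp add: sa_iff adj_mult adj_adj)

definition re_part :: "'a::unital_cstar_algebra \<Rightarrow> 'a" where
  "re_part a = (1 / 2) *\<^sub>R (a + adj a)"

definition im_part :: "'a::unital_cstar_algebra \<Rightarrow> 'a" where
  "im_part a = (1 / (2 * \<i>)) *\<^sub>C (a - adj a)"

lemma re_part_sa: "re_part a \<in> sa"
  by (simp add: sa_iff re_part_def adj_scaleR adj_add adj_adj add.commute)

lemma im_part_sa: "im_part a \<in> sa"
proof -
  have "adj (im_part a) = (- (1 / (2 * \<i>))) *\<^sub>C (adj a - a)"
    by (simp add: im_part_def adj_scaleC adj_diff adj_adj)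
  then show ?thesis
    by (simp add: sa_iff im_part_def scaleC_minus_left scaleC_diff_right)
qed

lemma re_im_decomp: "a = re_part a + \<i> *\<^sub>C im_part a"
proof -
  have "\<i> *\<^sub>C im_part a = (1/2) *\<^sub>C (a - adj a)"
    by (simp add: im_part_def scaleC_scaleC)
  moreover have "re_part a = (1/2) *\<^sub>C (a + adj a)"
    by (simp add: re_part_def scaleR_scaleC)
  moreover have "(1/2) *\<^sub>C a + (1/2) *\<^sub>C a = a"
    by (simp add: scaleC_add_left[symmetric])
  ultimately show ?thesis
    by (simp add: scaleC_add_right scaleC_diff_right)
qed

lemma re_im_part_unique:
  assumes "u \<in> sa" "v \<in> sa"
  shows "re_part (u + \<i> *\<^sub>C v) = u" "im_part (u + \<i> *\<^sub>C v) = v"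
proof -
  have adj: "adj (u + \<i> *\<^sub>C v) = u - \<i> *\<^sub>C v"
    using assms by (simp add: adj_add adj_scaleC sa_iff scaleC_minus_left)
  show "re_part (u + \<i> *\<^sub>C v) = u"
    unfolding re_part_def adj by (simp add: scaleR_2[symmetric])
  have "\<i> *\<^sub>C v + \<i> *\<^sub>C v = (2 * \<i>) *\<^sub>C v"
    by (simp flip: scaleC_add_left)
  then show "im_part (u + \<i> *\<^sub>C v) = v"
    unfolding im_part_def adj by (simp add: scaleC_scaleC)
qed

lemma re_part_of_sa: "a \<in> sa \<Longrightarrow> re_part a = a"
  and im_part_of_sa: "a \<in> sa \<Longrightarrow> im_part a = 0"
  using re_im_part_unique[of a 0] by (simp_all add: sa_zero)

lemma re_part_add: "re_part (x + y) = re_part x + re_part y"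
  and im_part_add: "im_part (x + y) = im_part x + im_part y"
proof -
  have "x + y = (re_part x + re_part y) + \<i> *\<^sub>C (im_part x + im_part y)"
    by (subst re_im_decomp[of x], subst re_im_decomp[of y]) (simp add: scaleC_add_right)
  then show "re_part (x + y) = re_part x + re_part y" "im_part (x + y) = im_part x + im_part y"
    by (metis re_im_part_unique re_part_sa im_part_sa sa_add)+
qed

lemma re_part_scaleC: "re_part (c *\<^sub>C x) = Re c *\<^sub>R re_part x - Im c *\<^sub>R im_part x"
  and im_part_scaleC: "im_part (c *\<^sub>C x) = Re c *\<^sub>R im_part x + Im c *\<^sub>R re_part x"
proof -
  define p q where "p = re_part x" and "q = im_part x"
  have pq: "p \<in> sa" "q \<in> sa" by (simp_all add: p_def q_def re_part_sa im_part_sa)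
  have c: "c *\<^sub>C y = Re c *\<^sub>R y + \<i> *\<^sub>C (Im c *\<^sub>R y)" for y :: 'a
    by (simp add: scaleR_scaleC scaleC_scaleC flip: scaleC_add_left complex_eq)
  have "x = p + \<i> *\<^sub>C q" unfolding p_def q_def by (rule re_im_decomp)
  then have "c *\<^sub>C x = c *\<^sub>C p + \<i> *\<^sub>C (c *\<^sub>C q)"
    by (simp add: scaleC_add_right scaleC_scaleC mult.commute)
  also have "\<i> *\<^sub>C (c *\<^sub>C q) = \<i> *\<^sub>C (Re c *\<^sub>R q) - Im c *\<^sub>R q"
    unfolding c[of q] by (simp add: scaleC_add_right scaleC_scaleC scaleC_minus_left)
  also have "c *\<^sub>C p + \<dots> = (Re c *\<^sub>R p - Im c *\<^sub>R q) + \<i> *\<^sub>C (Re c *\<^sub>R q + Im c *\<^sub>R p)"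
    unfolding c[of p] by (simp add: scaleC_add_right)
  finally have "c *\<^sub>C x = (Re c *\<^sub>R p - Im c *\<^sub>R q) + \<i> *\<^sub>C (Re c *\<^sub>R q + Im c *\<^sub>R p)" .
  then show "re_part (c *\<^sub>C x) = Re c *\<^sub>R re_part x - Im c *\<^sub>R im_part x"
    "im_part (c *\<^sub>C x) = Re c *\<^sub>R im_part x + Im c *\<^sub>R re_part x"
    using re_im_part_unique[OF sa_diff[OF sa_scaleR[OF pq(1), of "Re c"] sa_scaleR[OF pq(2), of "Im c"]]
        sa_add[OF sa_scaleR[OF pq(2), of "Re c"] sa_scaleR[OF pq(1), of "Im c"]]]
    by (simp_all add: p_def q_def)
qed


section \<open>Square roots\<close>

definition sqrt_coeff :: "nat \<Rightarrow> real" where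
  "sqrt_coeff n = (1/2 gchoose n) * (- 1) ^ n"

text \<open>
  The coefficients are those of the binomial series of the square root of \<open>1 - x\<close>. Their partial sums
  are the coefficients of the series for the exponent \<open>-1/2\<close>, which are positive and decreasing by
  their recursion.
\<close>

lemma sqrt_coeff_sum_nonneg: "0 \<le> (\<Sum>k\<le>m. sqrt_coeff k)"
  and sqrt_coeff_Suc_nonpos: "sqrt_coeff (Suc m) \<le> 0"
proof -
  define b :: "nat \<Rightarrow> real" where "b m = (- 1) ^ m * ((- (1/2)) gchoose m)" for m
  have sum_b: "(\<Sum>k\<le>m. sqrt_coeff k) = b m" for m
    using gbinomial_sum_lower_neg[of "1/2 :: real" m] by (simp add: sqrt_coeff_def b_def)
  have rec: "b (Suc m) = b m * ((1/2 + real m) / (1 + real m))" for m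
  proof -
    have "(1 + real m) * b (Suc m) = - ((- 1) ^ m) * ((1 + real m) * ((- (1/2)) gchoose Suc m))"
      by (simp add: b_def)
    also have "(1 + real m) * ((- (1/2)) gchoose Suc m) = - (1/2 + real m) * ((- (1/2)) gchoose m)"
      using gbinomial_mult_1[of "-(1/2)::real" m] by (simp add: algebra_simps)
    also have "- ((- 1) ^ m) * (- (1/2 + real m) * ((- (1/2)) gchoose m)) = (1/2 + real m) * b m"
      by (simp add: b_def algebra_simps)
    finally have "(1 + real m) * b (Suc m) = (1/2 + real m) * b m" .
    then show ?thesis by (simp add: field_simps)
  qed
  have b: "0 \<le> b m" for m
  proof (induction m)
    case (Suc m)
    then show ?case by (simp add: rec)
  qed (simp add: b_def)
  show "0 \<le> (\<Sum>k\<le>m. sqrt_coeff k)"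
    using b sum_b by simp
  have "sqrt_coeff (Suc m) = b (Suc m) - b m"
    using sum_b[of m] sum_b[of "Suc m"] by simp
  also have "\<dots> \<le> 0"
    using b[of m] by (simp add: rec divide_le_eq mult_left_mono)
  finally show "sqrt_coeff (Suc m) \<le> 0" .
qed

text \<open>
  All coefficients after the first are nonpositive and the partial sums are nonnegative, so the
  absolute values of these coefficients add up to at most the leading coefficient \<open>1\<close>. The series
  therefore converges on the closed unit ball, not only inside.
\<close>

lemma sqrt_coeff_abs_sums:
  "summable (\<lambda>n. \<bar>sqrt_coeff (Suc n)\<bar>)" "(\<Sum>n. \<bar>sqrt_coeff (Suc n)\<bar>) \<le> 1"
proof -
  have bd: "(\<Sum>n<m. \<bar>sqrt_coeff (Suc n)\<bar>) \<le> 1" for m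
  proof -
    have "(\<Sum>n\<le>m. sqrt_coeff n) = sqrt_coeff 0 + (\<Sum>n<m. sqrt_coeff (Suc n))"
      by (rule sum.atMost_shift)
    moreover have "(\<Sum>n<m. \<bar>sqrt_coeff (Suc n)\<bar>) = - (\<Sum>n<m. sqrt_coeff (Suc n))"
      using sqrt_coeff_Suc_nonpos by (simp add: sum_negf[symmetric] abs_of_nonpos)
    moreover have "sqrt_coeff 0 = 1" by (simp add: sqrt_coeff_def)
    ultimately show ?thesis using sqrt_coeff_sum_nonneg[of m] by simp
  qed
  show s: "summable (\<lambda>n. \<bar>sqrt_coeff (Suc n)\<bar>)"
    by (rule summableI_nonneg_bounded[where x=1]) (use bd in auto)
  show "(\<Sum>n. \<bar>sqrt_coeff (Suc n)\<bar>) \<le> 1"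
    using s bd by (intro suminf_le_const) auto
qed

text \<open>This is the identity of power series saying that the series squares to \<open>1 - x\<close>.\<close>

lemma sqrt_coeff_convolution:
  "(\<Sum>i\<le>k. sqrt_coeff i * sqrt_coeff (k - i)) = (if k = 0 then 1 else if k = 1 then - 1 else 0)"
proof -
  have "(\<Sum>i\<le>k. sqrt_coeff i * sqrt_coeff (k - i))
      = (\<Sum>i\<le>k. (1/2 gchoose i) * (1/2 gchoose (k - i))) * (- 1) ^ k"
    unfolding sum_distrib_right
    by (intro sum.cong) (auto simp: sqrt_coeff_def simp flip: power_add)
  also have "\<dots> = ((1::real) gchoose k) * (- 1) ^ k"
    using gbinomial_Vandermonde[of "1/2 :: real" "1/2" k] by (simp add: atMost_atLeast0)
  also have "(1::real) gchoose k = of_nat (1 choose k)"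
    by (simp only: binomial_gbinomial of_nat_1)
  finally show ?thesis by (cases k) (auto simp: binomial_eq_0)
qed

text \<open>
  The root is a norm-convergent sum of real multiples of powers of \<open>x\<close>; this makes it self-adjoint
  and lets it commute with whatever commutes with \<open>x\<close>. The bound on \<open>1 - y\<close> is the one on the
  coefficients, and it says that \<open>y\<close> is itself positive.
\<close>

theorem square_root_one_minus:
  fixes x :: "'a::unital_cstar_algebra"
  assumes "x \<in> sa" "norm x \<le> 1"
  obtains y where "y \<in> sa" "y * y = 1 - x" "norm (1 - y) \<le> 1"
    "\<And>c. c * x = x * c \<Longrightarrow> c * y = y * c"
proof -
  define f where "f n = sqrt_coeff n *\<^sub>R x ^ n" for n
  have le: "norm (f (Suc n)) \<le> \<bar>sqrt_coeff (Suc n)\<bar>" for n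
  proof -
    have "norm (x ^ Suc n) \<le> 1"
      using norm_power_ineq[of x "Suc n"] assms(2) power_le_one[of "norm x" "Suc n"] by simp
    then show ?thesis by (simp add: f_def mult_left_le)
  qed
  have sumS: "summable (\<lambda>n. norm (f (Suc n)))"
    by (rule summable_comparison_test'[OF sqrt_coeff_abs_sums(1)]) (use le in simp)
  then have sumn: "summable (\<lambda>n. norm (f n))"
    using summable_Suc_iff[of "\<lambda>n. norm (f n)"] by simp
  then have sum: "summable f" by (rule summable_norm_cancel)
  define y where "y = suminf f"
  have "adj y = (\<Sum>n. adj (f n))"
    unfolding y_def by (rule bounded_linear.suminf[OF bounded_linear_adj sum])
  also have "adj (x ^ n) = x ^ n" for n
    using assms(1) by (induction n) (simp_all add: adj_mult sa_iff power_commutes)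
  then have "(\<lambda>n. adj (f n)) = f"
    by (simp add: fun_eq_iff f_def adj_scaleR)
  finally have "y \<in> sa" by (simp add: sa_iff y_def)
  moreover have "y * y = 1 - x"
  proof -
    have "(\<lambda>k. \<Sum>i\<le>k. f i * f (k - i)) sums (y * y)"
      unfolding y_def by (rule Cauchy_product_sums[OF sumn sumn])
    moreover have "(\<Sum>i\<le>k. f i * f (k - i)) = (if k = 0 then 1 else if k = 1 then - x else 0)" for k
    proof -
      have "(\<Sum>i\<le>k. f i * f (k - i)) = (\<Sum>i\<le>k. sqrt_coeff i * sqrt_coeff (k - i)) *\<^sub>R x ^ k"
        unfolding scaleR_sum_left
        by (intro sum.cong) (auto simp: f_def simp flip: power_add)
      then show ?thesis by (simp add: sqrt_coeff_convolution)
    qed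
    moreover have "(\<lambda>k. if k = 0 then 1 else if k = 1 then - x else 0)
        sums (\<Sum>k\<in>{0,1}. if k = 0 then 1 else if k = (1::nat) then - x else 0)"
      by (rule sums_finite) auto
    ultimately show ?thesis by (simp add: sums_unique2)
  qed
  moreover have "norm (1 - y) \<le> 1"
  proof -
    have "1 - y = - (\<Sum>n. f (Suc n))"
      using suminf_split_head[OF sum] by (simp add: y_def f_def sqrt_coeff_def)
    then have "norm (1 - y) = norm (\<Sum>n. f (Suc n))" by simp
    also have "\<dots> \<le> (\<Sum>n. norm (f (Suc n)))" by (rule summable_norm[OF sumS])
    also have "\<dots> \<le> (\<Sum>n. \<bar>sqrt_coeff (Suc n)\<bar>)"
      by (rule suminf_le[OF le sumS sqrt_coeff_abs_sums(1)])
    finally show ?thesis using sqrt_coeff_abs_sums(2) by linarith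
  qed
  moreover have "c * y = y * c" if "c * x = x * c" for c
  proof -
    have "c * x ^ n = x ^ n * c" for n
      using that by (metis power_commuting_commutes)
    then have "(\<lambda>n. c * f n) = (\<lambda>n. f n * c)" by (simp add: f_def)
    then show ?thesis
      using suminf_mult[OF sum, of c] suminf_mult2[OF sum, of c] by (simp add: y_def)
  qed
  ultimately show thesis using that by blast
qed


section \<open>Contractivity of star morphisms\<close>

text \<open>
  For commuting self-adjoint \<open>h\<close> and \<open>k\<close> the sum of squares \<open>h * h + k * k\<close> is \<open>adj u * u\<close>, so that the
  C*-identity applies to it.
\<close>

lemma adj_mult_commuting_parts:
  fixes h k :: "'a::unital_cstar_algebra"
  assumes "h \<in> sa" "k \<in> sa" "h * k = k * h"
  shows "adj (h + \<i> *\<^sub>C k) = h - \<i> *\<^sub>C k"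
    "adj (h + \<i> *\<^sub>C k) * (h + \<i> *\<^sub>C k) = h * h + k * k"
proof -
  show adj: "adj (h + \<i> *\<^sub>C k) = h - \<i> *\<^sub>C k"
    using assms(1,2) by (simp add: adj_add adj_scaleC sa_iff scaleC_minus_left)
  show "adj (h + \<i> *\<^sub>C k) * (h + \<i> *\<^sub>C k) = h * h + k * k"
    unfolding adj
    by (simp add: algebra_simps mult_scaleC_left mult_scaleC_right scaleC_scaleC
        scaleC_minus_left scaleC_diff_right assms(3))
qed

text \<open>Here \<open>u = h + \<i> k\<close> is an isometry, and \<open>h\<close> is the mean of \<open>u\<close> and \<open>adj u\<close>.\<close>

lemma norm_le_one_if_squares_sum_one:
  fixes h k :: "'a::unital_cstar_algebra"
  assumes "h \<in> sa" "k \<in> sa" "h * k = k * h" "h * h + k * k = 1"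
  shows "norm h \<le> 1"
proof -
  define u where "u = h + \<i> *\<^sub>C k"
  note u_eqs = adj_mult_commuting_parts[OF assms(1-3), folded u_def]
  have u: "norm u = 1"
    using norm_adj_mult[of u] assms(4) u_eqs(2) norm_ge_zero[of u] by (auto simp: power2_eq_1_iff)
  have "h = (1/2) *\<^sub>R (u + adj u)"
    unfolding u_eqs(1) by (simp add: u_def scaleR_2[symmetric])
  then show ?thesis
    using norm_triangle_ineq[of u "adj u"] u by simp
qed

lemma unital_star_morphismD:
  assumes "unital_star_morphism f"
  shows "clinear f" "f 1 = 1" "f (x * y) = f x * f y" "f (adj x) = adj (f x)"
  using assms by (auto simp: unital_star_morphism_def)

lemma unital_star_morphism_sa: "unital_star_morphism f \<Longrightarrow> a \<in> sa \<Longrightarrow> f a \<in> sa"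
  by (metis sa_iff unital_star_morphismD(4))

text \<open>
  For self-adjoint \<open>h\<close> in the unit ball, complete \<open>h\<close> to \<open>h * h + k * k = 1\<close>. A morphism preserves
  this equation, and the equation bounds the norm of the image of \<open>h\<close>. The general case follows from
  the C*-identity.
\<close>

theorem unital_star_morphism_contractive:
  assumes f: "unital_star_morphism f"
  shows "norm (f a) \<le> norm a"
proof -
  note fs = unital_star_morphismD[OF f]
  have one: "norm (f h) \<le> 1" if h: "h \<in> sa" "norm h \<le> 1" for h
  proof -
    have "norm (h * h) \<le> 1"
      using norm_mult_ineq[of h h] h(2) mult_le_one[of "norm h" "norm h"] by simp
    then obtain k where k: "k \<in> sa" "k * k = 1 - h * h" "h * k = k * h"
      using square_root_one_minus[of "h * h"] sa_mult[OF h(1) h(1)] by (metis mult.assoc)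
    have "f h * f h + f k * f k = 1"
      using k(2) fs by (metis add_diff_cancel_left' clinear_add diff_add_cancel add.commute)
    moreover have "f h * f k = f k * f h"
      using k(3) fs(3) by metis
    ultimately show ?thesis
      by (intro norm_le_one_if_squares_sum_one[of "f h" "f k"])
        (use h k f in \<open>auto intro: unital_star_morphism_sa\<close>)
  qed
  have sa: "norm (f h) \<le> norm h" if h: "h \<in> sa" for h
  proof (cases "h = 0")
    case True
    then show ?thesis using clinear_zero[OF fs(1)] by simp
  next
    case False
    then have "norm (f ((1 / norm h) *\<^sub>R h)) \<le> 1"
      by (intro one sa_scaleR h) simp
    then show ?thesis
      using False by (simp add: clinear_scaleR[OF fs(1)] divide_le_eq)
  qed
  have "(norm (f a))\<^sup>2 \<le> (norm a)\<^sup>2"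
    using sa[OF sa_adj_mult[of a]] by (simp add: fs norm_adj_mult)
  then show ?thesis by (simp add: power2_le_iff_abs_le)
qed



section \<open>The positive cone\<close>

text \<open>
  For self-adjoint \<open>h\<close> the condition says that the spectrum of \<open>h\<close> lies in \<open>{0..2 * t}\<close>. It is stated
  with the norm, which makes stability under sums immediate; \<open>pos_cone_sqrt\<close> and
  \<open>positive_elements_eq_pos_cone\<close> give the two usual descriptions.
\<close>

definition pos_cone :: "'a::unital_cstar_algebra set" where
  "pos_cone = {h \<in> sa. \<exists>t\<ge>0. norm (t *\<^sub>R 1 - h) \<le> t}"

lemma pos_cone_sa: "h \<in> pos_cone \<Longrightarrow> h \<in> sa"
  by (simp add: pos_cone_def)

lemma pos_coneI: "h \<in> sa \<Longrightarrow> norm (t *\<^sub>R 1 - h) \<le> t \<Longrightarrow> h \<in> pos_cone"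
  unfolding pos_cone_def using norm_ge_zero order_trans by blast

lemma pos_cone_add:
  assumes "h \<in> pos_cone" "k \<in> pos_cone"
  shows "h + k \<in> pos_cone"
proof -
  obtain t s where ts: "norm (t *\<^sub>R 1 - h) \<le> t" "norm (s *\<^sub>R 1 - k) \<le> s"
    using assms by (auto simp: pos_cone_def)
  have "(t + s) *\<^sub>R 1 - (h + k) = (t *\<^sub>R 1 - h) + (s *\<^sub>R 1 - k)"
    by (simp add: algebra_simps)
  then have "norm ((t + s) *\<^sub>R 1 - (h + k)) \<le> t + s"
    using ts by (metis add_mono norm_triangle_ineq order_trans)
  then show ?thesis
    using assms by (intro pos_coneI[of _ "t + s"]) (auto intro: sa_add pos_cone_sa)
qed

lemma pos_cone_scaleR:
  assumes "h \<in> pos_cone" "0 \<le> r"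
  shows "r *\<^sub>R h \<in> pos_cone"
proof -
  obtain t where t: "norm (t *\<^sub>R 1 - h) \<le> t"
    using assms by (auto simp: pos_cone_def)
  have "(r * t) *\<^sub>R 1 - r *\<^sub>R h = r *\<^sub>R (t *\<^sub>R 1 - h)"
    by (simp add: algebra_simps)
  then have "norm ((r * t) *\<^sub>R 1 - r *\<^sub>R h) \<le> r * t"
    using t assms(2) by (simp add: mult_left_mono)
  then show ?thesis
    using assms by (intro pos_coneI[of _ "r * t"]) (auto intro: sa_scaleR pos_cone_sa)
qed

lemma norm_minus_in_pos_cone:
  assumes "h \<in> sa" "norm h \<le> r"
  shows "r *\<^sub>R 1 - h \<in> pos_cone"
  using assms by (intro pos_coneI[of _ r]) (auto intro!: sa_diff sa_scaleR)

lemma zero_in_pos_cone: "0 \<in> pos_cone"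
  by (rule pos_coneI[of _ 0]) (simp_all add: sa_zero)

text \<open>After scaling, \<open>1 - y * y = k * k\<close> with \<open>k\<close> commuting with \<open>y\<close>, and then \<open>k\<close> has norm at most one.\<close>

lemma square_in_pos_cone:
  assumes "y \<in> sa"
  shows "y * y \<in> pos_cone"
proof (cases "y = 0")
  case True
  then show ?thesis by (simp add: zero_in_pos_cone)
next
  case False
  define x where "x = (1 / norm y) *\<^sub>R y"
  have x: "x \<in> sa" "norm x \<le> 1" using assms False by (auto simp: x_def intro: sa_scaleR)
  have xx: "x * x \<in> sa" "norm (x * x) \<le> 1"
    using sa_mult[OF x(1) x(1)] norm_mult_ineq[of x x] x(2)
      mult_le_one[of "norm x" "norm x"] by auto
  then obtain k where k: "k \<in> sa" "k * k = 1 - x * x" "x * k = k * x"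
    using square_root_one_minus[of "x * x"] by (metis mult.assoc)
  have "norm k \<le> 1"
    by (rule norm_le_one_if_squares_sum_one[of k x]) (use k x in auto)
  then have "norm (1 - x * x) \<le> 1"
    using norm_mult_ineq[of k k] mult_le_one[of "norm k" "norm k"] k(2) by simp
  then have "x * x \<in> pos_cone"
    by (intro pos_coneI[of _ 1]) (use xx in auto)
  then have "(norm y * norm y) *\<^sub>R (x * x) \<in> pos_cone"
    by (rule pos_cone_scaleR) simp
  then show ?thesis using False by (simp add: x_def)
qed

lemma pos_cone_sqrt:
  assumes "h \<in> pos_cone"
  obtains y where "y \<in> pos_cone" "y * y = h" "\<And>c. c * h = h * c \<Longrightarrow> c * y = y * c"
proof -
  obtain t where t: "norm (t *\<^sub>R 1 - h) \<le> t" "0 \<le> t"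
    using assms by (auto simp: pos_cone_def)
  show thesis
  proof (cases "t = 0")
    case True
    then have "h = 0" using t by simp
    then show thesis using that[of 0] by (simp add: zero_in_pos_cone)
  next
    case False
    then have "t > 0" using t by simp
    define x where "x = 1 - (1 / t) *\<^sub>R h"
    have "x \<in> sa"
      using pos_cone_sa[OF assms] by (auto simp: x_def intro!: sa_diff sa_scaleR)
    have "x = (1 / t) *\<^sub>R (t *\<^sub>R 1 - h)"
      using \<open>t > 0\<close> by (simp add: x_def algebra_simps)
    then have "norm x \<le> 1" using t \<open>t > 0\<close> by simp
    obtain y where y: "y \<in> sa" "y * y = 1 - x" "norm (1 - y) \<le> 1"
      "\<And>c. c * x = x * c \<Longrightarrow> c * y = y * c"
      by (rule square_root_one_minus[OF \<open>x \<in> sa\<close> \<open>norm x \<le> 1\<close>]) (rule that, assumption+)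
    show thesis
    proof (rule that)
      have "y \<in> pos_cone" by (rule pos_coneI[of _ 1]) (use y(1,3) in auto)
      then show "sqrt t *\<^sub>R y \<in> pos_cone" using t by (intro pos_cone_scaleR) auto
      show "sqrt t *\<^sub>R y * sqrt t *\<^sub>R y = h"
        using t \<open>t > 0\<close> by (simp add: y(2) x_def)
      fix c assume "c * h = h * c"
      then have "c * x = x * c" by (simp add: x_def algebra_simps)
      then show "c * sqrt t *\<^sub>R y = sqrt t *\<^sub>R y * c" using y(4) by simp
    qed
  qed
qed

text \<open>
  The square roots \<open>y\<close> of \<open>h\<close> and \<open>w\<close> of \<open>- h\<close> commute and their squares add up to zero, hence
  \<open>y + \<i> w\<close> vanishes by the C*-identity.
\<close>

lemma pos_cone_antisym:
  assumes "h \<in> pos_cone" "- h \<in> pos_cone"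
  shows "h = 0"
proof -
  obtain y where y: "y \<in> pos_cone" "y * y = h" by (rule pos_cone_sqrt[OF assms(1)])
  obtain w where w: "w \<in> pos_cone" "w * w = - h" "\<And>c. c * (- h) = (- h) * c \<Longrightarrow> c * w = w * c"
    using pos_cone_sqrt[OF assms(2)] by blast
  have "y * w = w * y" by (rule w(3)) (simp add: y(2)[symmetric] mult.assoc)
  define u where "u = y + \<i> *\<^sub>C w"
  note u_eqs = adj_mult_commuting_parts[OF pos_cone_sa[OF y(1)] pos_cone_sa[OF w(1)]
    \<open>y * w = w * y\<close>, folded u_def]
  have "u = 0"
    using norm_adj_mult[of u] u_eqs(2) y(2) w(2) by simp
  moreover have "y = (1/2) *\<^sub>R (u + adj u)"
    unfolding u_eqs(1) by (simp add: u_def scaleR_2[symmetric])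
  ultimately show ?thesis using y(2) by simp
qed

text \<open>With \<open>d = x + \<i> y\<close> the sum is \<open>2 (x * x + y * y)\<close>, the mixed terms cancelling.\<close>

lemma adj_mult_plus_mult_adj_in_pos_cone: "adj d * d + d * adj d \<in> pos_cone"
proof -
  define x y where "x = re_part d" and "y = im_part d"
  have xy: "x \<in> sa" "y \<in> sa"
    by (simp_all add: x_def y_def re_part_sa im_part_sa)
  have d: "d = x + \<i> *\<^sub>C y"
    unfolding x_def y_def by (rule re_im_decomp)
  have ad: "adj d = x - \<i> *\<^sub>C y"
    unfolding d using xy by (simp add: adj_add adj_scaleC sa_iff scaleC_minus_left)
  have "adj d * d = x * x + y * y + \<i> *\<^sub>C (x * y - y * x)"
    unfolding ad unfolding d
    by (simp add: algebra_simps mult_scaleC_left mult_scaleC_right scaleC_scaleC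
        scaleC_minus_left scaleC_diff_right scaleC_add_right)
  moreover have "d * adj d = x * x + y * y - \<i> *\<^sub>C (x * y - y * x)"
    unfolding ad unfolding d
    by (simp add: algebra_simps mult_scaleC_left mult_scaleC_right scaleC_scaleC
        scaleC_minus_left scaleC_diff_right scaleC_add_right)
  ultimately have "adj d * d + d * adj d = 2 *\<^sub>R (x * x + y * y)"
    by (simp add: scaleR_2)
  then show ?thesis
    using pos_cone_scaleR[OF pos_cone_add[OF square_in_pos_cone[OF xy(1)] square_in_pos_cone[OF xy(2)]], of 2]
    by simp
qed

lemma square_eq_zero_sa:
  assumes "w \<in> sa" "w * w = 0"
  shows "w = 0"
  using norm_adj_mult[of w] assms by (simp add: sa_iff)

text \<open>
  No nonzero \<open>adj c * c\<close> is the negative of a square. The element \<open>d = w * adj c\<close> turns the hypothesis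
  on \<open>adj c * c\<close> into negative squares on both sides: \<open>adj d * d = - (k * k)\<close> and
  \<open>d * adj d = - (w * w) * (w * w)\<close>. Their sum is positive by the previous lemma and negative, hence zero.
\<close>

lemma adj_mult_eq_minus_square:
  assumes "w \<in> sa" "adj c * c = - (w * w)"
  shows "c = 0" "w = 0"
proof -
  define d k where "d = w * adj c" and "k = c * adj c"
  have w: "adj w = w" using assms(1) by (simp add: sa_iff)
  have k: "k \<in> sa" by (simp add: k_def sa_iff adj_mult adj_adj)
  have ww: "w * w \<in> sa" by (simp add: sa_iff adj_mult w)
  have "adj d * d = c * (w * w) * adj c"
    by (simp add: d_def adj_mult adj_adj w mult.assoc)
  also have "w * w = - (adj c * c)" by (simp add: assms(2))
  also have "c * - (adj c * c) * adj c = - (k * k)"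
    by (simp add: k_def mult.assoc)
  finally have 1: "adj d * d = - (k * k)" .
  have "d * adj d = w * (adj c * c) * w"
    by (simp add: d_def adj_mult adj_adj w mult.assoc)
  then have 2: "d * adj d = - ((w * w) * (w * w))"
    by (simp add: assms(2) mult.assoc)
  have "- ((w * w) * (w * w)) = (adj d * d + d * adj d) + k * k"
    using 1 2 by simp
  also have "\<dots> \<in> pos_cone"
    by (intro pos_cone_add adj_mult_plus_mult_adj_in_pos_cone square_in_pos_cone k)
  finally have "(w * w) * (w * w) = 0"
    using pos_cone_antisym[OF square_in_pos_cone[OF ww]] by simp
  then show "w = 0" using square_eq_zero_sa ww assms(1) by blast
  then show "c = 0" using assms(2) norm_adj_mult[of c] by simp
qed

text \<open>
  With \<open>h = adj a * a\<close> and \<open>s = \<bar>h\<bar>\<close>, the element \<open>g = s - h\<close> is twice the negative part of \<open>h\<close>, which has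
  to vanish. Since \<open>h\<close> acts as \<open>- s\<close> where \<open>g\<close> lives, compressing \<open>a\<close> by \<open>g\<close> makes \<open>adj c * c\<close> negative,
  and the preceding lemma applies.
\<close>

theorem adj_mult_in_pos_cone: "adj a * a \<in> pos_cone"
proof -
  define h where "h = adj a * a"
  have h: "h \<in> sa" by (simp add: h_def sa_adj_mult)
  obtain s where s: "s \<in> pos_cone" "s * s = h * h" "\<And>c. c * (h * h) = (h * h) * c \<Longrightarrow> c * s = s * c"
    using pos_cone_sqrt[OF square_in_pos_cone[OF h]] by blast
  have hs: "h * s = s * h" by (rule s(3)) (simp add: mult.assoc)
  obtain r where r: "r \<in> pos_cone" "r * r = s" "\<And>c. c * s = s * c \<Longrightarrow> c * r = r * c"
    using pos_cone_sqrt[OF s(1)] by blast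
  define g where "g = s - h"
  have g: "g \<in> sa" using s(1) h by (auto simp: g_def intro: sa_diff pos_cone_sa)
  have hg: "h * g = g * h" by (simp add: g_def algebra_simps hs)
  have sg: "s * g = g * s" by (simp add: g_def algebra_simps hs)
  have gr: "g * r = r * g" using r(3)[of g] sg by simp
  have sg': "s * g = - (h * g)"
    by (simp add: g_def algebra_simps s(2) hs)
  \<comment> \<open>The factor \<open>r\<close>, a root of \<open>s\<close>, turns \<open>g * h * g\<close> into the negative of an exact square.\<close>
  define c where "c = a * g * r"
  have "adj c * c = r * (g * h * g) * r"
    using g pos_cone_sa[OF r(1)] by (simp add: c_def h_def adj_mult sa_iff mult.assoc)
  also have "\<dots> = (r * r) * (g * h * g)"
  proof -
    have hr: "h * r = r * h" by (rule r(3)[OF hs])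
    have "g * (r * z) = r * (g * z)" "h * (r * z) = r * (h * z)" for z
      using gr hr by (simp_all flip: mult.assoc)
    then show ?thesis by (simp add: mult.assoc gr hr)
  qed
  also have "\<dots> = (s * g) * (h * g)" by (simp add: r(2) mult.assoc)
  finally have "adj c * c = - ((h * g) * (h * g))" by (simp add: sg')
  then have "h * g = 0"
    using adj_mult_eq_minus_square(2)[of "h * g" c] sa_mult[OF h g hg] by blast
  then have "g * g = 0"
    using sg' left_diff_distrib[of s h g] by (simp flip: g_def)
  then have "h = s" using square_eq_zero_sa[OF g] by (simp add: g_def)
  then show ?thesis using s(1) by (simp add: h_def)
qed

lemma positive_elements_eq_pos_cone: "positive_elements = (pos_cone :: 'a::unital_cstar_algebra set)"
proof
  show "positive_elements \<subseteq> (pos_cone :: 'a set)"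
    by (auto simp: positive_elements_def adj_mult_in_pos_cone)
  show "(pos_cone :: 'a set) \<subseteq> positive_elements"
  proof
    fix h :: 'a assume "h \<in> pos_cone"
    then obtain y where "y \<in> pos_cone" "y * y = h" by (rule pos_cone_sqrt)
    then have "h = adj y * y" using pos_cone_sa by (metis sa_iff)
    then show "h \<in> positive_elements" by (simp add: positive_elements_def)
  qed
qed

lemma one_in_pos_cone: "1 \<in> pos_cone"
  by (rule pos_coneI[of _ 1]) simp_all

lemma minus_one_notin_pos_cone: "- 1 \<notin> (pos_cone :: 'a::unital_cstar_algebra set)"
  using pos_cone_antisym[OF one_in_pos_cone] by fastforce


section \<open>Existence of states\<close>

text \<open>
  A state restricted to \<open>sa\<close> is determined by the half-space on which it is nonnegative. Such half-spaces
  are the maximal elements among the cones below.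
\<close>

definition proper_cone :: "'a::unital_cstar_algebra set \<Rightarrow> bool" where
  "proper_cone M \<longleftrightarrow> pos_cone \<subseteq> M \<and> M \<subseteq> sa \<and> (\<forall>h\<in>M. \<forall>k\<in>M. h + k \<in> M) \<and>
     (\<forall>h\<in>M. \<forall>r\<ge>0. r *\<^sub>R h \<in> M) \<and> - 1 \<notin> M"

lemma proper_cone_pos_cone: "proper_cone pos_cone"
  by (auto simp: proper_cone_def pos_cone_sa pos_cone_add pos_cone_scaleR minus_one_notin_pos_cone)

text \<open>
  A maximal cone \<open>M\<close> exists by Zorn's lemma. If it contained neither \<open>h\<close> nor \<open>- h\<close>, adjoining either
  would produce \<open>- 1\<close>, that is, \<open>- 1 = m + r h\<close> and \<open>- 1 = m' - r' h\<close>; eliminating \<open>h\<close> writes a negative multiple of \<open>1\<close> as an element of \<open>M\<close>.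
\<close>

lemma total_proper_cone_exists:
  obtains M :: "'a::unital_cstar_algebra set" where
    "proper_cone M" "\<And>h. h \<in> sa \<Longrightarrow> h \<in> M \<or> - h \<in> M"
proof -
  have "\<exists>M\<in>Collect proper_cone. \<forall>X\<in>Collect proper_cone. M \<subseteq> X \<longrightarrow> X = (M :: 'a set)"
  proof (rule subset_Zorn_nonempty)
    show "Collect proper_cone \<noteq> ({} :: 'a set set)"
      using proper_cone_pos_cone by blast
    fix \<C> :: "'a set set"
    assume "\<C> \<noteq> {}" and ch: "subset.chain (Collect proper_cone) \<C>"
    have pc: "proper_cone X" if "X \<in> \<C>" for X
      using ch that by (auto simp: subset_chain_def)
    have "proper_cone (\<Union>\<C>)"
      unfolding proper_cone_def
    proof (intro conjI ballI allI impI)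
      show "pos_cone \<subseteq> \<Union>\<C>" "\<Union>\<C> \<subseteq> sa" "- 1 \<notin> \<Union>\<C>"
        using \<open>\<C> \<noteq> {}\<close> pc unfolding proper_cone_def by blast+
      show "r *\<^sub>R h \<in> \<Union>\<C>" if "h \<in> \<Union>\<C>" "0 \<le> r" for h r
        using that pc unfolding proper_cone_def by blast
      fix h k assume "h \<in> \<Union>\<C>" "k \<in> \<Union>\<C>"
      then obtain X Y where XY: "h \<in> X" "X \<in> \<C>" "k \<in> Y" "Y \<in> \<C>" by blast
      then have "X \<subseteq> Y \<or> Y \<subseteq> X" using ch by (auto simp: subset_chain_def)
      then obtain Z where "Z \<in> \<C>" "h \<in> Z" "k \<in> Z" using XY by blast
      then show "h + k \<in> \<Union>\<C>" using pc unfolding proper_cone_def by blast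
    qed
    then show "\<Union>\<C> \<in> Collect proper_cone" by simp
  qed
  then obtain M :: "'a set" where M: "proper_cone M"
    and max: "\<And>X. proper_cone X \<Longrightarrow> M \<subseteq> X \<Longrightarrow> X = M" by blast
  have zero: "0 \<in> M"
    using M one_in_pos_cone by (metis proper_cone_def order_refl scaleR_zero_left subset_iff)
  have combo: "\<exists>m\<in>M. \<exists>r\<ge>0. m + r *\<^sub>R h = - 1" if h: "h \<in> sa" "h \<notin> M" for h
  proof (rule ccontr)
    assume neg: "\<not> ?thesis"
    define X where "X = {m + r *\<^sub>R h |m r. m \<in> M \<and> 0 \<le> r}"
    have XI: "m + q *\<^sub>R h \<in> X" if "m \<in> M" "0 \<le> q" for m q
      using that by (auto simp: X_def)
    have "M \<subseteq> X"
      by (force simp: X_def intro: exI[of _ "0::real"])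
    have "h \<in> X"
      unfolding X_def using zero by (intro CollectI exI[of _ 0] exI[of _ 1]) auto
    have "proper_cone X"
      unfolding proper_cone_def
    proof (intro conjI ballI allI impI)
      show "pos_cone \<subseteq> X" using M \<open>M \<subseteq> X\<close> by (auto simp: proper_cone_def)
      show "X \<subseteq> sa"
        using M h(1) by (auto simp: X_def proper_cone_def intro!: sa_add sa_scaleR)
      show "- 1 \<notin> X" using neg unfolding X_def by (smt (verit, best) mem_Collect_eq)
      show "r *\<^sub>R x \<in> X" if "x \<in> X" "0 \<le> r" for x r
      proof -
        obtain m q where mq: "x = m + q *\<^sub>R h" "m \<in> M" "0 \<le> q" using \<open>x \<in> X\<close> by (auto simp: X_def)
        then have "r *\<^sub>R x = r *\<^sub>R m + (r * q) *\<^sub>R h" by (simp add: scaleR_add_right)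
        moreover have "r *\<^sub>R m \<in> M" using M mq that by (auto simp: proper_cone_def)
        ultimately show ?thesis using XI[of "r *\<^sub>R m" "r * q"] mq(3) that(2) by simp
      qed
      show "x + y \<in> X" if "x \<in> X" "y \<in> X" for x y
      proof -
        obtain m q where mq: "x = m + q *\<^sub>R h" "m \<in> M" "0 \<le> q" using \<open>x \<in> X\<close> by (auto simp: X_def)
        obtain m' q' where mq': "y = m' + q' *\<^sub>R h" "m' \<in> M" "0 \<le> q'" using \<open>y \<in> X\<close> by (auto simp: X_def)
        have "x + y = (m + m') + (q + q') *\<^sub>R h" using mq mq' by (simp add: algebra_simps)
        moreover have "m + m' \<in> M" using M mq mq' by (auto simp: proper_cone_def)
        ultimately show ?thesis using XI[of "m + m'" "q + q'"] mq(3) mq'(3) by simp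
      qed
    qed
    then show False using max \<open>M \<subseteq> X\<close> \<open>h \<in> X\<close> h(2) by blast
  qed
  have "h \<in> M \<or> - h \<in> M" if h: "h \<in> sa" for h
  proof (rule ccontr)
    assume "\<not> ?thesis"
    then obtain m r m' r' where 1: "m \<in> M" "0 \<le> r" "m + r *\<^sub>R h = - 1"
      and 2: "m' \<in> M" "0 \<le> r'" "m' + r' *\<^sub>R (- h) = - 1"
      using combo[OF h] combo[OF sa_minus[OF h]] by blast
    have "r \<noteq> 0" using 1 M by (auto simp: proper_cone_def)
    then have pos: "r + r' > 0" using 1 2 by simp
    have "r' *\<^sub>R m + r *\<^sub>R m' = r' *\<^sub>R (m + r *\<^sub>R h) + r *\<^sub>R (m' + r' *\<^sub>R (- h))"
      by (simp add: algebra_simps)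
    also have "\<dots> = (r + r') *\<^sub>R (- 1)" unfolding 1(3) 2(3) by (simp add: algebra_simps)
    finally have "(1 / (r + r')) *\<^sub>R (r' *\<^sub>R m + r *\<^sub>R m') = - 1" using pos by simp
    moreover have "(1 / (r + r')) *\<^sub>R (r' *\<^sub>R m + r *\<^sub>R m') \<in> M"
      using 1 2 M pos unfolding proper_cone_def by (meson less_imp_le zero_le_divide_1_iff)
    ultimately show False using M by (simp add: proper_cone_def)
  qed
  then show thesis using that M by blast
qed

text \<open>
  A total cone orders \<open>sa\<close> linearly up to infinitesimals, with \<open>1\<close> as an order unit. Comparing \<open>h\<close> with the
  multiples of \<open>1\<close> gives a Dedekind cut, and the number that it defines is the value of the state.
  The positivity of \<open>adj a * a\<close> ensures that the functional is nonnegative on positive elements.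
\<close>

theorem states_nonempty: "(states :: ('a::unital_cstar_algebra \<Rightarrow> complex) set) \<noteq> {}"
proof -
  obtain M :: "'a set" where M: "proper_cone M" and tot: "\<And>h. h \<in> sa \<Longrightarrow> h \<in> M \<or> - h \<in> M"
    by (rule total_proper_cone_exists) blast
  have Madd: "\<And>h k. h \<in> M \<Longrightarrow> k \<in> M \<Longrightarrow> h + k \<in> M"
    and Mscale: "\<And>h r. h \<in> M \<Longrightarrow> 0 \<le> r \<Longrightarrow> r *\<^sub>R h \<in> M"
    and Mpos: "\<And>h. h \<in> pos_cone \<Longrightarrow> h \<in> M"
    and Msa: "\<And>h. h \<in> M \<Longrightarrow> h \<in> sa"
    using M by (auto simp: proper_cone_def)
  have Mone: "r *\<^sub>R 1 \<in> M \<longleftrightarrow> 0 \<le> r" for r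
  proof
    assume r: "r *\<^sub>R 1 \<in> M"
    show "0 \<le> r"
    proof (rule ccontr)
      assume "\<not> 0 \<le> r"
      then have "(1 / (- r)) *\<^sub>R (r *\<^sub>R 1) \<in> M" by (intro Mscale r) simp
      then show False using M \<open>\<not> 0 \<le> r\<close> by (simp add: proper_cone_def)
    qed
  qed (auto intro: Mscale Mpos one_in_pos_cone)
  define cut where "cut h p \<longleftrightarrow> (\<forall>t>p. t *\<^sub>R 1 - h \<in> M) \<and> (\<forall>t<p. h - t *\<^sub>R 1 \<in> M)" for h p
  have cut_ex: "\<exists>p. cut h p" if h: "h \<in> sa" for h
  proof -
    define T where "T = {t. t *\<^sub>R 1 - h \<in> M}"
    have "norm h \<in> T" using norm_minus_in_pos_cone[OF h order_refl] Mpos by (simp add: T_def)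
    have lb: "- norm h \<le> t" if "t \<in> T" for t
    proof -
      have "(t *\<^sub>R 1 - h) + (norm h *\<^sub>R 1 - (- h)) \<in> M"
        using that Mpos[OF norm_minus_in_pos_cone[OF sa_minus[OF h], of "norm h"]]
        by (intro Madd) (auto simp: T_def)
      then have "(t + norm h) *\<^sub>R 1 \<in> M" by (simp add: algebra_simps)
      then show ?thesis using Mone by simp
    qed
    have bdd: "bdd_below T" using lb by (rule bdd_belowI)
    have "cut h (Inf T)"
      unfolding cut_def
    proof (intro conjI allI impI)
      fix t assume "Inf T < t"
      then obtain t' where t': "t' \<in> T" "t' < t"
        using cInf_less_iff[OF _ bdd] \<open>norm h \<in> T\<close> by blast
      have "(t - t') *\<^sub>R 1 + (t' *\<^sub>R 1 - h) \<in> M"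
        using t' by (intro Madd) (auto simp: T_def Mone)
      then show "t *\<^sub>R 1 - h \<in> M" by (simp add: algebra_simps)
    next
      fix t assume "t < Inf T"
      then have "t \<notin> T" using cInf_lower[OF _ bdd] by force
      then have "- (t *\<^sub>R 1 - h) \<in> M"
        using tot[OF sa_diff[OF sa_scaleR[OF sa_one, of t] h]] by (auto simp: T_def)
      then show "h - t *\<^sub>R 1 \<in> M" by simp
    qed
    then show ?thesis by blast
  qed
  have cut_le: "p \<le> q" if "cut h p" "cut h q" for h p q
  proof (rule ccontr)
    assume "\<not> p \<le> q"
    then obtain s t where st: "q < s" "s < t" "t < p" by (meson dense linorder_not_le)
    then have "(s *\<^sub>R 1 - h) + (h - t *\<^sub>R 1) \<in> M"
      using that by (intro Madd) (auto simp: cut_def)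
    then have "(s - t) *\<^sub>R 1 \<in> M" by (simp add: algebra_simps)
    then show False using Mone st by simp
  qed
  define f where "f h = (THE p. cut h p)" for h
  have f_eq: "f h = p" if "cut h p" for h p
    unfolding f_def using that cut_le by (intro the_equality) (auto intro: antisym)
  have cut_f: "cut h (f h)" if "h \<in> sa" for h
    using cut_ex[OF that] f_eq by metis
  have f_add: "f (h + k) = f h + f k" if hk: "h \<in> sa" "k \<in> sa" for h k
  proof (rule f_eq)
    have "t *\<^sub>R 1 - (h + k) \<in> M" if "f h + f k < t" for t
    proof -
      define e where "e = (t - f h - f k) / 2"
      have "(f h + e) *\<^sub>R 1 - h + ((f k + e) *\<^sub>R 1 - k) \<in> M"
        using cut_f[OF hk(1)] cut_f[OF hk(2)] that by (intro Madd) (auto simp: cut_def e_def)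
      moreover have t: "t = (f h + e) + (f k + e)" by (simp add: e_def)
      ultimately show ?thesis
        unfolding t scaleR_add_left scaleR_diff_left by (simp add: algebra_simps)
    qed
    moreover have "h + k - t *\<^sub>R 1 \<in> M" if "t < f h + f k" for t
    proof -
      define e where "e = (f h + f k - t) / 2"
      have "h - (f h - e) *\<^sub>R 1 + (k - (f k - e) *\<^sub>R 1) \<in> M"
        using cut_f[OF hk(1)] cut_f[OF hk(2)] that by (intro Madd) (auto simp: cut_def e_def)
      moreover have t: "t = (f h - e) + (f k - e)" by (simp add: e_def)
      ultimately show ?thesis
        unfolding t scaleR_add_left scaleR_diff_left by (simp add: algebra_simps)
    qed
    ultimately show "cut (h + k) (f h + f k)" by (simp add: cut_def)
  qed
  have f_pos: "0 \<le> f h" if "h \<in> M" for h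
  proof (rule ccontr)
    assume "\<not> 0 \<le> f h"
    then have "(f h / 2) *\<^sub>R 1 - h + h \<in> M"
      using cut_f[OF Msa[OF that]] that by (intro Madd) (auto simp: cut_def)
    then show False using Mone \<open>\<not> 0 \<le> f h\<close> by simp
  qed
  have f_one: "f (r *\<^sub>R 1) = r" for r
  proof (rule f_eq)
    have "t *\<^sub>R 1 - r *\<^sub>R 1 = (t - r) *\<^sub>R (1::'a)" for t r by (simp add: algebra_simps)
    then show "cut (r *\<^sub>R 1) r" by (simp add: cut_def Mone)
  qed
  have f_zero: "f 0 = 0" using f_one[of 0] by simp
  have f_minus: "f (- h) = - f h" if "h \<in> sa" for h
    using f_add[OF that sa_minus[OF that]] f_zero by simp
  have f_scale_pos: "f (r *\<^sub>R h) = r * f h" if "h \<in> sa" "r > 0" for r h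
  proof (rule f_eq)
    have "r *\<^sub>R ((t / r) *\<^sub>R 1 - h) \<in> M" if "r * f h < t" for t
      using cut_f[OF \<open>h \<in> sa\<close>] \<open>r > 0\<close> that
      by (intro Mscale) (auto simp: cut_def field_simps)
    moreover have "r *\<^sub>R (h - (t / r) *\<^sub>R 1) \<in> M" if "t < r * f h" for t
      using cut_f[OF \<open>h \<in> sa\<close>] \<open>r > 0\<close> that
      by (intro Mscale) (auto simp: cut_def field_simps)
    ultimately show "cut (r *\<^sub>R h) (r * f h)"
      using \<open>r > 0\<close> by (simp add: cut_def algebra_simps)
  qed
  have f_scale: "f (r *\<^sub>R h) = r * f h" if "h \<in> sa" for r h
    using f_scale_pos[OF that, of r] f_scale_pos[OF that, of "-r"] f_minus[OF sa_scaleR[OF that], of r] f_zero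
    by (cases r "0::real" rule: linorder_cases) auto
  define \<phi> where "\<phi> a = complex_of_real (f (re_part a)) + \<i> * complex_of_real (f (im_part a))" for a
  have f_diff: "f (h - k) = f h - f k" if "h \<in> sa" "k \<in> sa" for h k
    using f_add[of h "- k"] f_minus[of k] that sa_minus by auto
  have "clinear \<phi>"
    unfolding clinear_iff
  proof (intro conjI allI)
    show "\<phi> (x + y) = \<phi> x + \<phi> y" for x y
      by (simp add: \<phi>_def re_part_add im_part_add f_add re_part_sa im_part_sa algebra_simps)
    show "\<phi> (c *\<^sub>C x) = c *\<^sub>C \<phi> x" for c x
      by (simp add: \<phi>_def re_part_scaleC im_part_scaleC f_add f_diff f_scale sa_scaleR re_part_sa im_part_sa
          complex_eq_iff)
  qed
  moreover have "\<phi> 1 = 1"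
    using f_one[of 1] f_zero by (simp add: \<phi>_def re_part_of_sa im_part_of_sa)
  moreover have "\<phi> a \<in> nonneg_Reals" if "a \<in> positive_elements" for a
    using that f_pos[OF Mpos] pos_cone_sa[of a] f_zero
    by (simp add: positive_elements_eq_pos_cone \<phi>_def re_part_of_sa im_part_of_sa)
  ultimately have "\<phi> \<in> states" by (simp add: states_def)
  then show ?thesis by blast
qed



section \<open>States and the Monge--Kantorovich metric\<close>

lemma statesD:
  assumes "\<phi> \<in> states"
  shows "clinear \<phi>" "\<phi> 1 = 1" "a \<in> pos_cone \<Longrightarrow> \<phi> a \<in> nonneg_Reals"
  using assms by (auto simp: states_def positive_elements_eq_pos_cone)

lemma states_scaleR: "\<phi> \<in> states \<Longrightarrow> \<phi> (r *\<^sub>R a) = of_real r * \<phi> a"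
  using clinear_scaleR[OF statesD(1)] by (simp add: scaleR_conv_of_real)

text \<open>Both \<open>\<parallel>a\<parallel> - a\<close> and \<open>\<parallel>a\<parallel> + a\<close> are positive.\<close>

lemma state_norm_sa:
  assumes \<phi>: "\<phi> \<in> states" and a: "a \<in> sa"
  shows "cmod (\<phi> a) \<le> norm a"
proof -
  have "\<phi> (norm a *\<^sub>R 1 - a) \<in> nonneg_Reals" "\<phi> (norm a *\<^sub>R 1 - (- a)) \<in> nonneg_Reals"
    by (intro statesD(3)[OF \<phi>] norm_minus_in_pos_cone a sa_minus; simp)+
  then have "norm a - \<phi> a \<in> nonneg_Reals" "norm a + \<phi> a \<in> nonneg_Reals"
    using statesD(1)[OF \<phi>]
    by (simp_all add: clinear_diff clinear_add states_scaleR[OF \<phi>] statesD(2)[OF \<phi>])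
  then have "Im (\<phi> a) = 0" "\<bar>Re (\<phi> a)\<bar> \<le> norm a"
    by (auto simp: complex_nonneg_Reals_iff)
  then show ?thesis by (simp add: cmod_eq_Re)
qed

lemma state_diff_re_im:
  assumes "\<phi> \<in> states" "\<psi> \<in> states"
  shows "cmod (\<phi> a - \<psi> a)
    \<le> cmod (\<phi> (re_part a) - \<psi> (re_part a)) + cmod (\<phi> (im_part a) - \<psi> (im_part a))"
proof -
  have *: "\<omega> a = \<omega> (re_part a) + \<i> * \<omega> (im_part a)" if "\<omega> \<in> states" for \<omega>
    using clinear_add[OF statesD(1)[OF that]] clinear_scaleC[OF statesD(1)[OF that]] re_im_decomp[of a]
    by (metis scaleC_complex)
  have "\<phi> a - \<psi> a = (\<phi> (re_part a) - \<psi> (re_part a)) + \<i> * (\<phi> (im_part a) - \<psi> (im_part a))"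
    unfolding *[OF assms(1)] *[OF assms(2)] by (simp add: algebra_simps)
  then show ?thesis
    using norm_triangle_ineq[of "\<phi> (re_part a) - \<psi> (re_part a)" "\<i> * (\<phi> (im_part a) - \<psi> (im_part a))"]
    by (simp add: norm_mult)
qed

lemma unital_star_morphism_pos_cone:
  assumes f: "unital_star_morphism f" and a: "a \<in> pos_cone"
  shows "f a \<in> pos_cone"
proof -
  obtain b where "a = adj b * b"
    using a by (auto simp: positive_elements_eq_pos_cone[symmetric] positive_elements_def)
  then show ?thesis
    using adj_mult_in_pos_cone unital_star_morphismD[OF f] by metis
qed

lemma states_comp:
  assumes "\<phi> \<in> states" "clinear f" "f 1 = 1" "\<And>a. a \<in> pos_cone \<Longrightarrow> f a \<in> pos_cone"
  shows "\<phi> \<circ> f \<in> states"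
  using assms by (auto simp: states_def positive_elements_eq_pos_cone clinear_iff)

lemma states_comp_morphism:
  assumes "\<phi> \<in> states" "unital_star_morphism f"
  shows "\<phi> \<circ> f \<in> states"
  using assms unital_star_morphism_pos_cone by (intro states_comp) (auto dest: unital_star_morphismD)

lemma states_comp_positive:
  assumes "\<phi> \<in> states" "positive_unital_linear f"
  shows "\<phi> \<circ> f \<in> states"
  using assms
  by (intro states_comp) (auto simp: positive_unital_linear_def positive_elements_eq_pos_cone)

definition mix :: "real \<Rightarrow> ('a \<Rightarrow> complex) \<Rightarrow> ('a \<Rightarrow> complex) \<Rightarrow> 'a \<Rightarrow> complex" where
  "mix t \<phi> \<psi> a = of_real t * \<phi> a + of_real (1 - t) * \<psi> a"

lemma mix_same [simp]: "mix t \<phi> \<phi> = \<phi>"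
  by (simp add: fun_eq_iff mix_def algebra_simps)

lemma mix_swap: "mix t \<phi> \<psi> = mix (1 - t) \<psi> \<phi>"
  by (simp add: fun_eq_iff mix_def)

lemma states_mix:
  assumes "\<phi> \<in> states" "\<psi> \<in> states" "0 \<le> t" "t \<le> 1"
  shows "mix t \<phi> \<psi> \<in> states"
proof -
  have "clinear (mix t \<phi> \<psi>)"
    using statesD(1)[OF assms(1)] statesD(1)[OF assms(2)]
    by (simp add: clinear_iff mix_def algebra_simps)
  moreover have "mix t \<phi> \<psi> a \<in> nonneg_Reals" if "a \<in> pos_cone" for a
    unfolding mix_def
    using statesD(3)[OF assms(1) that] statesD(3)[OF assms(2) that] assms(3,4)
    by (intro nonneg_Reals_add_I nonneg_Reals_mult_I) (auto simp del: of_real_diff)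
  ultimately show ?thesis
    using statesD(2)[OF assms(1)] statesD(2)[OF assms(2)]
    by (simp add: states_def positive_elements_eq_pos_cone mix_def)
qed

text \<open>
  The factor is \<open>f 1\<close>. If it vanishes, positivity forces \<open>f = 0\<close>, and any state will do;
  the existence of states thus covers degenerate convex combinations.
\<close>

lemma positive_functional_multiple_of_state:
  fixes f :: "'a::unital_cstar_algebra \<Rightarrow> complex"
  assumes f: "clinear f" and pos: "\<And>a. a \<in> pos_cone \<Longrightarrow> f a \<in> nonneg_Reals"
  obtains t \<phi> where "0 \<le> t" "\<phi> \<in> states" "\<And>a. f a = of_real t * \<phi> a"
proof -
  obtain t where t: "f 1 = of_real t" "0 \<le> t"
    using pos[OF one_in_pos_cone] by (auto elim: nonneg_Reals_cases)
  show thesis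
  proof (cases "t = 0")
    case True
    have sa: "f a = 0" if a: "a \<in> sa" for a
    proof -
      have "f (norm a *\<^sub>R 1 - a) \<in> nonneg_Reals" "f (norm a *\<^sub>R 1 - (- a)) \<in> nonneg_Reals"
        by (intro pos norm_minus_in_pos_cone a sa_minus; simp)+
      then show ?thesis
        using t True
        by (simp add: clinear_diff[OF f] clinear_add[OF f] clinear_scaleR[OF f] complex_nonneg_Reals_iff
            complex_eq_iff)
    qed
    have "f a = 0" for a
      using clinear_add[OF f, of "re_part a" "\<i> *\<^sub>C im_part a"] sa[OF re_part_sa] sa[OF im_part_sa]
      by (simp add: clinear_scaleC[OF f] flip: re_im_decomp)
    moreover obtain \<phi> where "\<phi> \<in> (states :: ('a \<Rightarrow> complex) set)"
      using states_nonempty by blast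
    ultimately show thesis using that[of 0 \<phi>] by simp
  next
    case False
    define \<phi> where "\<phi> a = of_real (1 / t) * f a" for a
    have "clinear \<phi>"
      using f by (simp add: clinear_iff \<phi>_def algebra_simps)
    moreover have "\<phi> a \<in> nonneg_Reals" if "a \<in> pos_cone" for a
      unfolding \<phi>_def by (intro nonneg_Reals_mult_I pos that) (use t in auto)
    ultimately have "\<phi> \<in> states"
      using t False by (simp add: states_def positive_elements_eq_pos_cone \<phi>_def)
    then show thesis
      using that[of t \<phi>] t False by (simp add: \<phi>_def)
  qed
qed

lemma mk_upper: "a \<in> Ldom L \<Longrightarrow> L a \<le> 1 \<Longrightarrow> ennreal (cmod (\<phi> a - \<psi> a)) \<le> mk L \<phi> \<psi>"
  unfolding mk_def by (rule SUP_upper) simp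

lemma mk_least:
  "(\<And>a. a \<in> Ldom L \<Longrightarrow> L a \<le> 1 \<Longrightarrow> ennreal (cmod (\<phi> a - \<psi> a)) \<le> r) \<Longrightarrow> mk L \<phi> \<psi> \<le> r"
  unfolding mk_def by (rule SUP_least) simp

lemma mk_self [simp]: "mk L \<phi> \<phi> = 0"
  using mk_least[of L \<phi> \<phi> 0] by simp

lemma mk_commute: "mk L \<phi> \<psi> = mk L \<psi> \<phi>"
  by (simp add: mk_def norm_minus_commute)

lemma mk_triangle: "mk L \<phi> \<omega> \<le> mk L \<phi> \<psi> + mk L \<psi> \<omega>"
proof (rule mk_least)
  fix a assume a: "a \<in> Ldom L" "L a \<le> 1"
  have "ennreal (cmod (\<phi> a - \<omega> a)) \<le> ennreal (cmod (\<phi> a - \<psi> a) + cmod (\<psi> a - \<omega> a))"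
    using norm_triangle_ineq[of "\<phi> a - \<psi> a" "\<psi> a - \<omega> a"] by (intro ennreal_leI) simp
  also have "\<dots> = ennreal (cmod (\<phi> a - \<psi> a)) + ennreal (cmod (\<psi> a - \<omega> a))"
    by (rule ennreal_plus) auto
  also have "\<dots> \<le> mk L \<phi> \<psi> + mk L \<psi> \<omega>"
    by (intro add_mono mk_upper a)
  finally show "ennreal (cmod (\<phi> a - \<omega> a)) \<le> mk L \<phi> \<psi> + mk L \<psi> \<omega>" .
qed

text \<open>The metric is convex in the pair of its arguments.\<close>

lemma mk_mix_le:
  assumes "mk L \<phi> \<phi>' \<le> C" "mk L \<psi> \<psi>' \<le> C" "0 \<le> t" "t \<le> 1"
  shows "mk L (mix t \<phi> \<psi>) (mix t \<phi>' \<psi>') \<le> C"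
proof (rule mk_least)
  fix a assume a: "a \<in> Ldom L" "L a \<le> 1"
  let ?x = "cmod (\<phi> a - \<phi>' a)" and ?y = "cmod (\<psi> a - \<psi>' a)"
  have "mix t \<phi> \<psi> a - mix t \<phi>' \<psi>' a = of_real t * (\<phi> a - \<phi>' a) + of_real (1 - t) * (\<psi> a - \<psi>' a)"
    by (simp add: mix_def algebra_simps)
  then have "cmod (mix t \<phi> \<psi> a - mix t \<phi>' \<psi>' a) \<le> t * ?x + (1 - t) * ?y"
    using norm_triangle_ineq[of "of_real t * (\<phi> a - \<phi>' a)" "of_real (1 - t) * (\<psi> a - \<psi>' a)"] assms(3,4)
    by (simp add: norm_mult del: of_real_diff)
  also have "\<dots> \<le> t * max ?x ?y + (1 - t) * max ?x ?y"
    using assms(3,4) by (intro add_mono mult_left_mono) auto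
  also have "\<dots> = max ?x ?y" by (simp add: algebra_simps)
  finally have "ennreal (cmod (mix t \<phi> \<psi> a - mix t \<phi>' \<psi>' a)) \<le> ennreal (max ?x ?y)"
    by (rule ennreal_leI)
  also have "\<dots> \<le> C"
    using order_trans[OF mk_upper[OF a] assms(1)] order_trans[OF mk_upper[OF a] assms(2)]
    by (simp add: max_def)
  finally show "ennreal (cmod (mix t \<phi> \<psi> a - mix t \<phi>' \<psi>' a)) \<le> C" .
qed


section \<open>Metrizing the weak* topology\<close>

text \<open>Pointwise closeness on finite sets of elements is a neighbourhood base of the weak-star topology.\<close>

lemma openin_weak_star_topology:
  "openin weak_star_topology U \<longleftrightarrow> U \<subseteq> states \<and>
    (\<forall>\<phi>\<^sub>0\<in>U. \<exists>S \<delta>. finite S \<and> 0 < \<delta> \<and> {\<phi> \<in> states. \<forall>a\<in>S. cmod (\<phi> a - \<phi>\<^sub>0 a) < \<delta>} \<subseteq> U)"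
  (is "?l \<longleftrightarrow> ?r")
proof
  assume ?l
  then obtain T where T: "openin (product_topology (\<lambda>_. euclidean) UNIV) T" "U = T \<inter> states"
    by (auto simp: weak_star_topology_def openin_subtopology)
  have "\<exists>S \<delta>. finite S \<and> 0 < \<delta> \<and> {\<phi> \<in> states. \<forall>a\<in>S. cmod (\<phi> a - \<phi>\<^sub>0 a) < \<delta>} \<subseteq> U"
    if "\<phi>\<^sub>0 \<in> U" for \<phi>\<^sub>0
  proof -
    have "\<phi>\<^sub>0 \<in> T" using that T(2) by simp
    obtain V where V: "finite {a. V a \<noteq> UNIV}" "\<And>a. open (V a)" "\<phi>\<^sub>0 \<in> Pi\<^sub>E UNIV V" "Pi\<^sub>E UNIV V \<subseteq> T"
      using bspec[OF T(1)[unfolded openin_product_topology_alt] \<open>\<phi>\<^sub>0 \<in> T\<close>] by auto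
    have "\<exists>e>0. ball (\<phi>\<^sub>0 a) e \<subseteq> V a" for a
      using V(2,3) by (auto simp: PiE_def Pi_def open_contains_ball)
    then obtain e where e: "\<And>a. 0 < e a" "\<And>a. ball (\<phi>\<^sub>0 a) (e a) \<subseteq> V a" by metis
    define S where "S = {a. V a \<noteq> UNIV}"
    define \<delta> where "\<delta> = Min (insert 1 (e ` S))"
    have "finite S" using V(1) by (simp add: S_def)
    then have "0 < \<delta>" and \<delta>: "\<And>a. a \<in> S \<Longrightarrow> \<delta> \<le> e a"
      using e(1) by (auto simp: \<delta>_def)
    have "\<phi> \<in> U" if "\<phi> \<in> states" "\<forall>a\<in>S. cmod (\<phi> a - \<phi>\<^sub>0 a) < \<delta>" for \<phi>
    proof -
      have "\<phi> a \<in> V a" for a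
      proof (cases "a \<in> S")
        case True
        then have "\<phi> a \<in> ball (\<phi>\<^sub>0 a) (e a)"
          using that(2) \<delta> by (force simp: dist_norm norm_minus_commute)
        then show ?thesis using e(2) by blast
      qed (simp add: S_def)
      then have "\<phi> \<in> T" using V(4) by auto
      then show ?thesis using T(2) that(1) by simp
    qed
    then show ?thesis using \<open>finite S\<close> \<open>0 < \<delta>\<close> by blast
  qed
  then show ?r using T(2) by blast
next
  assume r: ?r
  define B where "B \<phi>\<^sub>0 S \<delta> = {\<phi>. \<forall>a\<in>S. cmod (\<phi> a - \<phi>\<^sub>0 a) < \<delta>}"
    for \<phi>\<^sub>0 :: "'a \<Rightarrow> complex" and S and \<delta> :: real
  have B: "openin (product_topology (\<lambda>_. euclidean) UNIV) (B \<phi>\<^sub>0 S \<delta>)"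
    if "finite S" for \<phi>\<^sub>0 :: "'a \<Rightarrow> complex" and S \<delta>
  proof -
    have eq: "B \<phi>\<^sub>0 S \<delta> = Pi\<^sub>E UNIV (\<lambda>a. if a \<in> S then ball (\<phi>\<^sub>0 a) \<delta> else UNIV)"
      by (auto simp: B_def dist_norm norm_minus_commute PiE_def Pi_def split: if_splits)
    have "finite {a. (if a \<in> S then ball (\<phi>\<^sub>0 a) \<delta> else UNIV) \<noteq> UNIV}"
      by (rule finite_subset[OF _ that]) auto
    then show ?thesis
      unfolding eq by (intro product_topology_basis) auto
  qed
  define \<B> where "\<B> = {B \<phi>\<^sub>0 S \<delta> |\<phi>\<^sub>0 S \<delta>. finite S \<and> B \<phi>\<^sub>0 S \<delta> \<inter> states \<subseteq> U}"
  have "openin (product_topology (\<lambda>_. euclidean) UNIV) (\<Union>\<B>)"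
    using B by (intro openin_Union) (auto simp: \<B>_def)
  moreover have "U = \<Union>\<B> \<inter> states"
  proof
    show "\<Union>\<B> \<inter> states \<subseteq> U" by (auto simp: \<B>_def)
    show "U \<subseteq> \<Union>\<B> \<inter> states"
    proof
      fix \<phi>\<^sub>0 assume "\<phi>\<^sub>0 \<in> U"
      then obtain S \<delta> where S: "finite S" "0 < \<delta>" "{\<phi> \<in> states. \<forall>a\<in>S. cmod (\<phi> a - \<phi>\<^sub>0 a) < \<delta>} \<subseteq> U"
        using r by blast
      then have "B \<phi>\<^sub>0 S \<delta> \<in> \<B>" unfolding \<B>_def B_def by blast
      moreover have "\<phi>\<^sub>0 \<in> B \<phi>\<^sub>0 S \<delta>" using S(2) by (simp add: B_def)
      ultimately show "\<phi>\<^sub>0 \<in> \<Union>\<B> \<inter> states" using r \<open>\<phi>\<^sub>0 \<in> U\<close> by blast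
    qed
  qed
  ultimately show ?l by (auto simp: weak_star_topology_def openin_subtopology)
qed

lemma metrizes_weak_starD:
  assumes "metrizes_weak_star L" "\<phi>\<^sub>0 \<in> states" "0 < e"
  obtains S \<delta> where "finite S" "0 < \<delta>"
    "\<And>\<phi>. \<phi> \<in> states \<Longrightarrow> (\<And>a. a \<in> S \<Longrightarrow> cmod (\<phi> a - \<phi>\<^sub>0 a) < \<delta>) \<Longrightarrow> mk L \<phi> \<phi>\<^sub>0 < ennreal e"
proof -
  define d where "d = (\<lambda>\<phi> \<psi>. enn2real (mk L \<phi> \<psi>))"
  interpret Metric_space states d
    using assms(1) by (simp add: metrizes_weak_star_def d_def)
  have "openin weak_star_topology (mball \<phi>\<^sub>0 e)"
    using assms(1) openin_mball[of \<phi>\<^sub>0 e] by (simp add: metrizes_weak_star_def d_def)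
  moreover have "\<phi>\<^sub>0 \<in> mball \<phi>\<^sub>0 e" using assms by simp
  ultimately obtain S \<delta> where S: "finite S" "0 < \<delta>"
    "{\<phi> \<in> states. \<forall>a\<in>S. cmod (\<phi> a - \<phi>\<^sub>0 a) < \<delta>} \<subseteq> mball \<phi>\<^sub>0 e"
    unfolding openin_weak_star_topology by blast
  show thesis
  proof (rule that[OF S(1,2)])
    fix \<phi> assume \<phi>: "\<phi> \<in> states" "\<And>a. a \<in> S \<Longrightarrow> cmod (\<phi> a - \<phi>\<^sub>0 a) < \<delta>"
    then have "d \<phi>\<^sub>0 \<phi> < e" using S(3) by auto
    moreover have "mk L \<phi> \<phi>\<^sub>0 < top"
      using assms(1,2) \<phi>(1) by (simp add: metrizes_weak_star_def)
    ultimately show "mk L \<phi> \<phi>\<^sub>0 < ennreal e"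
      by (metis d_def enn2real_less_iff mk_commute)
  qed
qed

text \<open>
  The metric controls the values on the domain of \<open>L\<close> by rescaling to the unit ball of \<open>L\<close>. As states
  are bounded by the norm, density extends this to all self-adjoint elements, and then to all elements
  through their real and imaginary parts.
\<close>

lemma mk_controls_evaluation:
  assumes sub: "subspace (Ldom L)" and dense: "sa \<subseteq> closure (Ldom L)"
    and scale: "\<And>a r. a \<in> Ldom L \<Longrightarrow> L (r *\<^sub>R a) = ennreal \<bar>r\<bar> * L a"
    and "0 < e"
  shows "\<exists>r>0. \<forall>\<phi>\<in>states. \<forall>\<psi>\<in>states. mk L \<phi> \<psi> < ennreal r \<longrightarrow> cmod (\<phi> a - \<psi> a) < e"
proof -
  have sa: "\<exists>r>0. \<forall>\<phi>\<in>states. \<forall>\<psi>\<in>states. mk L \<phi> \<psi> < ennreal r \<longrightarrow> cmod (\<phi> a - \<psi> a) < e"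
    if a: "a \<in> sa" and "0 < e" for a e
  proof -
    have "a \<in> closure (Ldom L)" using dense a by blast
    then obtain b where b: "b \<in> Ldom L" "norm (a - b) < e / 4"
      using \<open>0 < e\<close> by (metis closure_approachable dist_commute dist_norm divide_pos_pos zero_less_numeral)
    have b_sa: "b \<in> sa" "L b < top" using b(1) by (auto simp: Ldom_def)
    \<comment> \<open>The summand \<open>1\<close> keeps \<open>k\<close> positive when \<open>L b = 0\<close>.\<close>
    define k where "k = enn2real (L b) + 1"
    have k: "0 < k" by (simp add: k_def add_nonneg_pos)
    have "L ((1/k) *\<^sub>R b) = ennreal (1/k) * ennreal (enn2real (L b))"
      using scale[OF b(1)] k b_sa(2) by simp
    also have "\<dots> = ennreal (1/k * enn2real (L b))"
      by (rule ennreal_mult[symmetric]) (use k in auto)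
    also have "\<dots> \<le> 1"
      using k by (intro ennreal_le_1[THEN iffD2]) (simp add: k_def)
    finally have Lb: "L ((1/k) *\<^sub>R b) \<le> 1" .
    have bk: "(1/k) *\<^sub>R b \<in> Ldom L" using sub b(1) by (rule subspace_scale)
    have "cmod (\<phi> a - \<psi> a) < e"
      if st: "\<phi> \<in> states" "\<psi> \<in> states" and mk: "mk L \<phi> \<psi> < ennreal (e / (4 * k))" for \<phi> \<psi>
    proof -
      have "ennreal (cmod (\<phi> ((1/k) *\<^sub>R b) - \<psi> ((1/k) *\<^sub>R b))) < ennreal (e / (4 * k))"
        using mk_upper[of _ L \<phi> \<psi>, OF bk Lb] mk by (rule le_less_trans)
      then have "cmod (\<phi> ((1/k) *\<^sub>R b) - \<psi> ((1/k) *\<^sub>R b)) < e / (4 * k)"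
        by (simp add: ennreal_less_iff)
      also have "\<phi> ((1/k) *\<^sub>R b) - \<psi> ((1/k) *\<^sub>R b) = of_real (1/k) * (\<phi> b - \<psi> b)"
        using states_scaleR[OF st(1)] states_scaleR[OF st(2)] by (simp add: algebra_simps)
      finally have 1: "cmod (\<phi> b - \<psi> b) < e / 4"
        using k by (simp add: norm_mult norm_divide field_simps)
      have 2: "cmod (\<omega> a - \<omega> b) < e / 4" if "\<omega> \<in> states" for \<omega>
      proof -
        have "cmod (\<omega> (a - b)) \<le> norm (a - b)"
          using that a b_sa by (intro state_norm_sa sa_diff)
        then show ?thesis using b(2) clinear_diff[OF statesD(1)[OF that]] by simp
      qed
      have "\<phi> a - \<psi> a = (\<phi> a - \<phi> b) + (\<phi> b - \<psi> b) - (\<psi> a - \<psi> b)" by simp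
      also have "cmod \<dots> \<le> cmod (\<phi> a - \<phi> b) + cmod (\<phi> b - \<psi> b) + cmod (\<psi> a - \<psi> b)"
        by (meson add_right_mono norm_triangle_ineq norm_triangle_ineq4 order_trans)
      also have "\<dots> < e" using 1 2[OF st(1)] 2[OF st(2)] \<open>0 < e\<close> by linarith
      finally show ?thesis .
    qed
    then show ?thesis using k \<open>0 < e\<close> by (intro exI[of _ "e / (4 * k)"]) simp
  qed
  obtain r1 where r1: "0 < r1" "\<forall>\<phi>\<in>states. \<forall>\<psi>\<in>states. mk L \<phi> \<psi> < ennreal r1 \<longrightarrow>
      cmod (\<phi> (re_part a) - \<psi> (re_part a)) < e / 2"
    using sa[OF re_part_sa[of a], of "e / 2"] \<open>0 < e\<close> by auto
  obtain r2 where r2: "0 < r2" "\<forall>\<phi>\<in>states. \<forall>\<psi>\<in>states. mk L \<phi> \<psi> < ennreal r2 \<longrightarrow>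
      cmod (\<phi> (im_part a) - \<psi> (im_part a)) < e / 2"
    using sa[OF im_part_sa[of a], of "e / 2"] \<open>0 < e\<close> by auto
  have "cmod (\<phi> a - \<psi> a) < e"
    if st: "\<phi> \<in> states" "\<psi> \<in> states" and "mk L \<phi> \<psi> < ennreal (min r1 r2)" for \<phi> \<psi>
  proof -
    have "mk L \<phi> \<psi> < ennreal r1" "mk L \<phi> \<psi> < ennreal r2"
      by (rule less_le_trans[OF that(3) ennreal_leI]; simp)+
    then show ?thesis
      using state_diff_re_im[OF st, of a] r1(2) r2(2) st by fastforce
  qed
  then show ?thesis using r1(1) r2(1) by (intro exI[of _ "min r1 r2"]) auto
qed

text \<open>
  On a dense domain the metric induces a topology at least as fine as the weak-star topology, by the
  preceding lemma. Hence only finiteness and the converse comparison have to be verified for a concrete \<open>L\<close>.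
\<close>

theorem metrizes_weak_starI:
  fixes L :: "'a::unital_cstar_algebra \<Rightarrow> ennreal"
  assumes sub: "subspace (Ldom L)" and dense: "sa \<subseteq> closure (Ldom L)"
    and scale: "\<And>a r. a \<in> Ldom L \<Longrightarrow> L (r *\<^sub>R a) = ennreal \<bar>r\<bar> * L a"
    and fin: "\<And>\<phi> \<psi>. \<phi> \<in> states \<Longrightarrow> \<psi> \<in> states \<Longrightarrow> mk L \<phi> \<psi> < top"
    and near: "\<And>\<phi>\<^sub>0 e. \<phi>\<^sub>0 \<in> states \<Longrightarrow> 0 < e \<Longrightarrow> \<exists>S \<delta>. finite S \<and> 0 < \<delta> \<and>
      (\<forall>\<phi>\<in>states. (\<forall>a\<in>S. cmod (\<phi> a - \<phi>\<^sub>0 a) < \<delta>) \<longrightarrow> mk L \<phi> \<phi>\<^sub>0 < ennreal e)"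
  shows "metrizes_weak_star L"
proof -
  define d where "d = (\<lambda>\<phi> \<psi>. enn2real (mk L \<phi> \<psi>))"
  have ctrl: "\<exists>r>0. \<forall>\<phi>\<in>states. \<forall>\<psi>\<in>states. mk L \<phi> \<psi> < ennreal r \<longrightarrow> cmod (\<phi> a - \<psi> a) < e"
    if "0 < e" for a e
    by (rule mk_controls_evaluation[OF sub dense scale that])
  have ms: "Metric_space states d"
  proof
    show "0 \<le> d \<phi> \<psi>" "d \<phi> \<psi> = d \<psi> \<phi>" for \<phi> \<psi>
      by (simp_all add: d_def mk_commute)
    show "d \<phi> \<psi> = 0 \<longleftrightarrow> \<phi> = \<psi>" if "\<phi> \<in> states" "\<psi> \<in> states" for \<phi> \<psi>
    proof
      assume "d \<phi> \<psi> = 0"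
      then have "mk L \<phi> \<psi> = 0" using fin[OF that] by (auto simp: d_def enn2real_eq_0_iff)
      show "\<phi> = \<psi>"
      proof (rule ext, rule ccontr)
        fix a assume "\<phi> a \<noteq> \<psi> a"
        then have "0 < cmod (\<phi> a - \<psi> a)" by simp
        from ctrl[OF this, of a] obtain r where "0 < r" and r: "\<forall>\<phi>'\<in>states. \<forall>\<psi>'\<in>states.
            mk L \<phi>' \<psi>' < ennreal r \<longrightarrow> cmod (\<phi>' a - \<psi>' a) < cmod (\<phi> a - \<psi> a)"
          by (elim exE conjE)
        then show False
          using bspec[OF bspec[OF r that(1)] that(2)] \<open>mk L \<phi> \<psi> = 0\<close> by simp
      qed
    qed (simp add: d_def)
    show "d \<phi> \<omega> \<le> d \<phi> \<psi> + d \<psi> \<omega>" if "\<phi> \<in> states" "\<psi> \<in> states" "\<omega> \<in> states" for \<phi> \<psi> \<omega>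
      using enn2real_mono[OF mk_triangle[of L \<phi> \<omega> \<psi>]] fin that
      by (simp add: d_def enn2real_plus)
  qed
  interpret Metric_space states d by (rule ms)
  have mk_less: "mk L \<phi> \<psi> < ennreal e \<longleftrightarrow> d \<phi> \<psi> < e" if "\<phi> \<in> states" "\<psi> \<in> states" "0 < e" for \<phi> \<psi> e
    using fin[OF that(1,2)] that(3) by (simp add: d_def enn2real_less_iff)
  have "openin mtopology U \<longleftrightarrow> openin weak_star_topology U" for U
  proof
    assume U: "openin mtopology U"
    have "\<exists>S \<delta>. finite S \<and> 0 < \<delta> \<and> {\<phi> \<in> states. \<forall>a\<in>S. cmod (\<phi> a - \<phi>\<^sub>0 a) < \<delta>} \<subseteq> U"
      if mem: "\<phi>\<^sub>0 \<in> U" for \<phi>\<^sub>0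
    proof -
      obtain r where r: "0 < r" "mball \<phi>\<^sub>0 r \<subseteq> U" and st: "\<phi>\<^sub>0 \<in> states"
        using U mem unfolding openin_mtopology by blast
      obtain S \<delta> where S: "finite S" "0 < \<delta>"
        "\<forall>\<phi>\<in>states. (\<forall>a\<in>S. cmod (\<phi> a - \<phi>\<^sub>0 a) < \<delta>) \<longrightarrow> mk L \<phi> \<phi>\<^sub>0 < ennreal r"
        using near[OF st r(1)] by blast
      have "\<phi> \<in> mball \<phi>\<^sub>0 r" if "\<phi> \<in> states" "\<forall>a\<in>S. cmod (\<phi> a - \<phi>\<^sub>0 a) < \<delta>" for \<phi>
        using S(3) that mk_less[OF that(1) st r(1)] st by (simp add: commute)
      then show ?thesis using S(1,2) r(2) by blast
    qed
    then show "openin weak_star_topology U"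
      using U unfolding openin_weak_star_topology openin_mtopology by blast
  next
    assume U: "openin weak_star_topology U"
    have "\<exists>r>0. mball \<phi>\<^sub>0 r \<subseteq> U" if mem: "\<phi>\<^sub>0 \<in> U" for \<phi>\<^sub>0
    proof -
      have st: "\<phi>\<^sub>0 \<in> states" using U mem unfolding openin_weak_star_topology by blast
      obtain S \<delta> where S: "finite S" "0 < \<delta>" "{\<phi> \<in> states. \<forall>a\<in>S. cmod (\<phi> a - \<phi>\<^sub>0 a) < \<delta>} \<subseteq> U"
        using U mem unfolding openin_weak_star_topology by blast
      have "\<exists>r>0. \<forall>\<phi>\<in>states. d \<phi> \<phi>\<^sub>0 < r \<longrightarrow> (\<forall>a\<in>S. cmod (\<phi> a - \<phi>\<^sub>0 a) < \<delta>)"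
        using S(1)
      proof (induction S rule: finite_induct)
        case empty
        show ?case by (auto intro: exI[of _ 1])
      next
        case (insert a S)
        then obtain r where r: "0 < r" "\<forall>\<phi>\<in>states. d \<phi> \<phi>\<^sub>0 < r \<longrightarrow> (\<forall>a\<in>S. cmod (\<phi> a - \<phi>\<^sub>0 a) < \<delta>)"
          by blast
        from ctrl[OF S(2), of a] obtain s where s: "0 < s" and s': "\<forall>\<phi>\<in>states. \<forall>\<psi>\<in>states.
            mk L \<phi> \<psi> < ennreal s \<longrightarrow> cmod (\<phi> a - \<psi> a) < \<delta>"
          by (elim exE conjE)
        have "cmod (\<phi> a - \<phi>\<^sub>0 a) < \<delta>" if "\<phi> \<in> states" "d \<phi> \<phi>\<^sub>0 < s" for \<phi>
          using bspec[OF bspec[OF s' that(1)] st] mk_less[OF that(1) st s] that(2) by blast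
        then show ?case
          using r s by (intro exI[of _ "min r s"]) auto
      qed
      then obtain r where "0 < r" "\<forall>\<phi>\<in>states. d \<phi> \<phi>\<^sub>0 < r \<longrightarrow> (\<forall>a\<in>S. cmod (\<phi> a - \<phi>\<^sub>0 a) < \<delta>)" by blast
      then show ?thesis using S(3) by (intro exI[of _ r]) (auto simp: commute)
    qed
    then show "openin mtopology U"
      using U unfolding openin_weak_star_topology openin_mtopology by blast
  qed
  then have "mtopology = weak_star_topology" by (simp add: topology_eq)
  then show ?thesis
    using ms fin by (simp add: metrizes_weak_star_def d_def)
qed



section \<open>Gluing along a common quotient\<close>

lemma quantum_isometryD:
  assumes "quantum_isometry LA LB \<pi>"
  shows "unital_star_morphism \<pi>" "surj \<pi>" "b \<in> sa \<Longrightarrow> LB b = (INF a\<in>{a \<in> sa. \<pi> a = b}. LA a)"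
  using assms by (auto simp: quantum_isometry_def)

lemma unital_star_morphism_comp:
  assumes "unital_star_morphism f" "unital_star_morphism g"
  shows "unital_star_morphism (f \<circ> g)"
  using assms by (simp add: unital_star_morphism_def clinear_iff)

lemma ennreal_INF_approx:
  fixes f :: "'x \<Rightarrow> ennreal"
  assumes "(INF x\<in>A. f x) \<le> r" "r < top" "0 < e"
  obtains x where "x \<in> A" "f x \<le> r + ennreal e"
proof -
  have "r < r + ennreal e"
    using assms(2,3) by (cases r) (auto simp: ennreal_less_iff simp flip: ennreal_plus)
  then have "(INF x\<in>A. f x) < r + ennreal e"
    using assms(1) by (rule order_le_less_trans[rotated])
  then show thesis using that by (auto simp: INF_less_iff intro: less_imp_le)
qed

text \<open>
  The direct sum enters the distance estimates only through its two projections \<open>p1\<close> and \<open>p2\<close>. Stating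
  its properties in terms of them makes the situation symmetric: interchanging the indices gives an
  instance of the same locale (\<open>flip\<close>), so each estimate is proved for one direction of the tunnel only.
  The equivalence \<open>L_le_iff\<close> says that \<open>L\<close> is the maximum of three terms.
\<close>

locale glued =
  fixes L :: "'d::unital_cstar_algebra \<Rightarrow> ennreal"
    and L1 :: "'d1::unital_cstar_algebra \<Rightarrow> ennreal"
    and L2 :: "'d2::unital_cstar_algebra \<Rightarrow> ennreal"
    and LB :: "'b::unital_cstar_algebra \<Rightarrow> ennreal"
    and p1 :: "'d \<Rightarrow> 'd1" and p2 :: "'d \<Rightarrow> 'd2" and \<rho> :: "'d1 \<Rightarrow> 'b" and \<pi> :: "'d2 \<Rightarrow> 'b"
    and \<epsilon> :: real
  assumes p1: "unital_star_morphism p1" "surj p1" and p2: "unital_star_morphism p2" "surj p2"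
    and pair: "\<And>d1 d2. d1 \<in> sa \<Longrightarrow> d2 \<in> sa \<Longrightarrow> \<exists>d\<in>sa. p1 d = d1 \<and> p2 d = d2"
    and L_le_iff: "\<And>d c. L d \<le> c \<longleftrightarrow> L1 (p1 d) \<le> c \<and> L2 (p2 d) \<le> c \<and>
        ennreal (1 / \<epsilon> * norm (\<rho> (p1 d) - \<pi> (p2 d))) \<le> c"
    and states_decomp: "\<And>\<phi>. \<phi> \<in> states \<Longrightarrow> \<exists>t \<phi>\<^sub>1 \<phi>\<^sub>2. 0 \<le> t \<and> t \<le> 1 \<and>
        \<phi>\<^sub>1 \<in> states \<and> \<phi>\<^sub>2 \<in> states \<and> \<phi> = mix t (\<phi>\<^sub>1 \<circ> p1) (\<phi>\<^sub>2 \<circ> p2)"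
    and \<rho>: "quantum_isometry L1 LB \<rho>" and \<pi>: "quantum_isometry L2 LB \<pi>"
    and \<epsilon>: "0 < \<epsilon>"
begin

lemma flip: "glued L L2 L1 LB p2 p1 \<pi> \<rho> \<epsilon>"
proof
  show "\<exists>d\<in>sa. p2 d = d2 \<and> p1 d = d1" if "d2 \<in> sa" "d1 \<in> sa" for d1 d2
    using pair[OF that(2,1)] by blast
  show "L d \<le> c \<longleftrightarrow> L2 (p2 d) \<le> c \<and> L1 (p1 d) \<le> c \<and> ennreal (1 / \<epsilon> * norm (\<pi> (p2 d) - \<rho> (p1 d))) \<le> c"
    for d c unfolding L_le_iff norm_minus_commute[of "\<pi> (p2 d)"] by blast
  show "\<exists>t \<phi>\<^sub>1 \<phi>\<^sub>2. 0 \<le> t \<and> t \<le> 1 \<and> \<phi>\<^sub>1 \<in> states \<and> \<phi>\<^sub>2 \<in> states \<and> \<phi> = mix t (\<phi>\<^sub>1 \<circ> p2) (\<phi>\<^sub>2 \<circ> p1)"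
    if \<phi>: "\<phi> \<in> states" for \<phi>
  proof -
    obtain t \<phi>\<^sub>1 \<phi>\<^sub>2 where "0 \<le> t" "t \<le> 1" "\<phi>\<^sub>1 \<in> states" "\<phi>\<^sub>2 \<in> states" "\<phi> = mix t (\<phi>\<^sub>1 \<circ> p1) (\<phi>\<^sub>2 \<circ> p2)"
      using states_decomp[OF \<phi>] by blast
    then show ?thesis
      by (intro exI[of _ "1 - t"] exI[of _ \<phi>\<^sub>2] exI[of _ \<phi>\<^sub>1]) (simp add: mix_swap[of t])
  qed
qed (fact p1 p2 \<rho> \<pi> \<epsilon>)+

lemma unit_ball_components:
  assumes "d \<in> Ldom L" "L d \<le> 1"
  shows "p1 d \<in> Ldom L1" "L1 (p1 d) \<le> 1" "p2 d \<in> Ldom L2" "L2 (p2 d) \<le> 1"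
    "norm (\<rho> (p1 d) - \<pi> (p2 d)) \<le> \<epsilon>"
proof -
  have le: "L1 (p1 d) \<le> 1" "L2 (p2 d) \<le> 1" "ennreal (1 / \<epsilon> * norm (\<rho> (p1 d) - \<pi> (p2 d))) \<le> 1"
    using assms(2) unfolding L_le_iff by auto
  show "norm (\<rho> (p1 d) - \<pi> (p2 d)) \<le> \<epsilon>"
    using le(3) \<epsilon> by (simp add: ennreal_le_1 divide_le_eq)
  show "p1 d \<in> Ldom L1" "p2 d \<in> Ldom L2"
    using assms(1) le(1,2) unital_star_morphism_sa[OF p1(1)] unital_star_morphism_sa[OF p2(1)]
    by (auto simp: Ldom_def less_top[symmetric] top_unique)
  show "L1 (p1 d) \<le> 1" "L2 (p2 d) \<le> 1" by (fact le(1,2))+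
qed

lemma mk_p1_le: "mk L (\<phi> \<circ> p1) (\<psi> \<circ> p1) \<le> mk L1 \<phi> \<psi>"
  by (rule mk_least) (simp add: mk_upper unit_ball_components)

lemma mk_p2_le: "mk L (\<phi> \<circ> p2) (\<psi> \<circ> p2) \<le> mk L2 \<phi> \<psi>"
  by (rule mk_least) (simp add: mk_upper unit_ball_components)

text \<open>
  A state of \<open>B\<close> separates the images of \<open>p1 d\<close> and \<open>p2 d\<close> by at most their distance, because it is
  contractive on self-adjoint elements.
\<close>

lemma mk_bridge:
  assumes \<omega>: "\<omega> \<in> states"
  shows "mk L (\<omega> \<circ> \<rho> \<circ> p1) (\<omega> \<circ> \<pi> \<circ> p2) \<le> ennreal \<epsilon>"
proof (rule mk_least)
  fix d assume d: "d \<in> Ldom L" "L d \<le> 1"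
  have sa: "\<rho> (p1 d) \<in> sa" "\<pi> (p2 d) \<in> sa"
    using unit_ball_components(1,3)[OF d] unital_star_morphism_sa
      quantum_isometryD(1)[OF \<rho>] quantum_isometryD(1)[OF \<pi>] by (auto simp: Ldom_def)
  have "cmod (\<omega> (\<rho> (p1 d)) - \<omega> (\<pi> (p2 d))) = cmod (\<omega> (\<rho> (p1 d) - \<pi> (p2 d)))"
    by (simp add: clinear_diff[OF statesD(1)[OF \<omega>]])
  also have "\<dots> \<le> norm (\<rho> (p1 d) - \<pi> (p2 d))"
    using sa by (intro state_norm_sa[OF \<omega>] sa_diff)
  also have "\<dots> \<le> \<epsilon>" by (rule unit_ball_components(5)[OF d])
  finally show "ennreal (cmod ((\<omega> \<circ> \<rho> \<circ> p1) d - (\<omega> \<circ> \<pi> \<circ> p2) d)) \<le> ennreal \<epsilon>"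
    by (simp add: ennreal_leI)
qed

lemma mk_cross:
  assumes "\<omega> \<in> states"
  shows "mk L (\<phi> \<circ> p1) (\<psi> \<circ> p2) \<le> mk L1 \<phi> (\<omega> \<circ> \<rho>) + mk L2 (\<omega> \<circ> \<pi>) \<psi> + ennreal \<epsilon>"
proof -
  have "mk L (\<phi> \<circ> p1) (\<psi> \<circ> p2) \<le> mk L (\<phi> \<circ> p1) (\<omega> \<circ> \<rho> \<circ> p1) +
      (mk L (\<omega> \<circ> \<rho> \<circ> p1) (\<omega> \<circ> \<pi> \<circ> p2) + mk L (\<omega> \<circ> \<pi> \<circ> p2) (\<psi> \<circ> p2))"
    by (meson add_left_mono mk_triangle order_trans)
  also have "\<dots> \<le> mk L1 \<phi> (\<omega> \<circ> \<rho>) + (ennreal \<epsilon> + mk L2 (\<omega> \<circ> \<pi>) \<psi>)"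
    by (intro add_mono mk_p1_le mk_p2_le mk_bridge assms)
  finally show ?thesis by (simp add: ac_simps)
qed

text \<open>
  A lift \<open>d1\<close> of \<open>a\<close> is completed to an element of the direct sum by lifting \<open>\<rho> d1\<close> through \<open>\<pi>\<close> with nearly
  the same seminorm; the third term of \<open>L\<close> then vanishes.
\<close>

lemma quantum_isometry_p1:
  fixes LA :: "'a::unital_cstar_algebra \<Rightarrow> ennreal"
  assumes \<pi>\<^sub>1: "quantum_isometry L1 LA \<pi>\<^sub>1"
  shows "quantum_isometry L LA (\<lambda>d. \<pi>\<^sub>1 (p1 d))"
  unfolding quantum_isometry_def
proof (intro conjI ballI)
  show "unital_star_morphism (\<lambda>d. \<pi>\<^sub>1 (p1 d))"
    using unital_star_morphism_comp[OF quantum_isometryD(1)[OF \<pi>\<^sub>1] p1(1)] by (simp add: o_def)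
  show "surj (\<lambda>d. \<pi>\<^sub>1 (p1 d))"
    using comp_surj[OF p1(2) quantum_isometryD(2)[OF \<pi>\<^sub>1]] by (simp add: o_def)
  fix a :: 'a assume a: "a \<in> sa"
  note LA = quantum_isometryD(3)[OF \<pi>\<^sub>1 a]
  show "LA a = (INF d\<in>{d \<in> sa. \<pi>\<^sub>1 (p1 d) = a}. L d)"
  proof (rule antisym)
    show "LA a \<le> (INF d\<in>{d \<in> sa. \<pi>\<^sub>1 (p1 d) = a}. L d)"
    proof (rule INF_greatest)
      fix d assume d: "d \<in> {d \<in> sa. \<pi>\<^sub>1 (p1 d) = a}"
      then have "LA a \<le> L1 (p1 d)"
        unfolding LA using unital_star_morphism_sa[OF p1(1)] by (intro INF_lower) auto
      also have "\<dots> \<le> L d" using L_le_iff by blast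
      finally show "LA a \<le> L d" .
    qed
    show "(INF d\<in>{d \<in> sa. \<pi>\<^sub>1 (p1 d) = a}. L d) \<le> LA a"
      unfolding LA
    proof (rule INF_greatest, rule ccontr)
      fix d1 assume d1: "d1 \<in> {d \<in> sa. \<pi>\<^sub>1 d = a}"
        and "\<not> (INF d\<in>{d \<in> sa. \<pi>\<^sub>1 (p1 d) = a}. L d) \<le> L1 d1"
      then obtain c where c: "L1 d1 < c" "c < (INF d\<in>{d \<in> sa. \<pi>\<^sub>1 (p1 d) = a}. L d)"
        using dense by (auto simp: not_le)
      have \<rho>d: "\<rho> d1 \<in> sa"
        using d1 unital_star_morphism_sa[OF quantum_isometryD(1)[OF \<rho>]] by simp
      have "LB (\<rho> d1) \<le> L1 d1"
        unfolding quantum_isometryD(3)[OF \<rho> \<rho>d] using d1 by (intro INF_lower) simp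
      then have "(INF d2\<in>{d2 \<in> sa. \<pi> d2 = \<rho> d1}. L2 d2) < c"
        using c(1) quantum_isometryD(3)[OF \<pi> \<rho>d] by simp
      then obtain d2 where d2: "d2 \<in> sa" "\<pi> d2 = \<rho> d1" "L2 d2 < c"
        by (auto simp: INF_less_iff)
      obtain d where d: "d \<in> sa" "p1 d = d1" "p2 d = d2"
        using pair[of d1 d2] d1 d2(1) by auto
      have "L d \<le> c" unfolding L_le_iff using c(1) d d2 by (simp add: less_imp_le)
      moreover have "(INF d\<in>{d \<in> sa. \<pi>\<^sub>1 (p1 d) = a}. L d) \<le> L d"
        using d d1 by (intro INF_lower) simp
      ultimately show False using c(2) by simp
    qed
  qed
qed

lemma quantum_isometry_p2: "quantum_isometry L2 LE \<rho>\<^sub>2 \<Longrightarrow> quantum_isometry L LE (\<lambda>d. \<rho>\<^sub>2 (p2 d))"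
  by (rule glued.quantum_isometry_p1[OF flip])

text \<open>
  In a convex combination \<open>t \<phi>\<^sub>1 + (1 - t) \<phi>\<^sub>2\<close> the part \<open>\<phi>\<^sub>1\<close> is within \<open>m1\<close> of a pullback along \<open>\<pi>\<^sub>1\<close>, while
  \<open>\<phi>\<^sub>2\<close> goes to a state of \<open>B\<close> at cost \<open>m2\<close>, crosses the bridge at cost \<open>\<epsilon>\<close> and continues at cost \<open>m1\<close>.
  The same combination of the two targets approximates \<open>\<phi>\<close>.
\<close>

lemma approximation_by_pullbacks_p1:
  assumes m1: "\<And>\<phi>. \<phi> \<in> states \<Longrightarrow> (INF \<theta>\<in>states. mk L1 \<phi> (\<theta> \<circ> \<pi>\<^sub>1)) \<le> m1"
    and m2: "\<And>\<phi>. \<phi> \<in> states \<Longrightarrow> (INF \<psi>\<in>states. mk L2 \<phi> (\<psi> \<circ> \<pi>)) \<le> m2"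
    and \<phi>: "\<phi> \<in> states"
  shows "(INF \<theta>\<in>states. mk L \<phi> (\<theta> \<circ> (\<lambda>d. \<pi>\<^sub>1 (p1 d)))) \<le> m1 + m2 + ennreal \<epsilon>"
proof (rule ennreal_le_epsilon)
  fix e :: real
  assume "m1 + m2 + ennreal \<epsilon> < top" and e: "0 < e"
  then have fin: "m1 < top" "m2 < top" by (auto simp: less_top[symmetric])
  obtain t \<phi>\<^sub>1 \<phi>\<^sub>2 where t: "0 \<le> t" "t \<le> 1" and st: "\<phi>\<^sub>1 \<in> states" "\<phi>\<^sub>2 \<in> states"
    and \<phi>_eq: "\<phi> = mix t (\<phi>\<^sub>1 \<circ> p1) (\<phi>\<^sub>2 \<circ> p2)"
    using states_decomp[OF \<phi>] by blast
  have e2: "0 < e / 2" using e by simp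
  obtain \<theta>\<^sub>1 where \<theta>\<^sub>1: "\<theta>\<^sub>1 \<in> states" "mk L1 \<phi>\<^sub>1 (\<theta>\<^sub>1 \<circ> \<pi>\<^sub>1) \<le> m1 + ennreal (e / 2)"
    by (rule ennreal_INF_approx[OF m1[OF st(1)] fin(1) e2])
  obtain \<psi> where \<psi>: "\<psi> \<in> states" "mk L2 \<phi>\<^sub>2 (\<psi> \<circ> \<pi>) \<le> m2 + ennreal (e / 2)"
    by (rule ennreal_INF_approx[OF m2[OF st(2)] fin(2) e2])
  have \<psi>\<rho>: "\<psi> \<circ> \<rho> \<in> states"
    by (rule states_comp_morphism[OF \<psi>(1) quantum_isometryD(1)[OF \<rho>]])
  obtain \<theta>\<^sub>2 where \<theta>\<^sub>2: "\<theta>\<^sub>2 \<in> states" "mk L1 (\<psi> \<circ> \<rho>) (\<theta>\<^sub>2 \<circ> \<pi>\<^sub>1) \<le> m1 + ennreal (e / 2)"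
    by (rule ennreal_INF_approx[OF m1[OF \<psi>\<rho>] fin(1) e2])
  define C where "C = m1 + m2 + ennreal \<epsilon> + ennreal e"
  have half: "ennreal e = ennreal (e / 2) + ennreal (e / 2)"
    using e by (simp flip: ennreal_plus)
  have 1: "mk L (\<phi>\<^sub>1 \<circ> p1) (\<theta>\<^sub>1 \<circ> \<pi>\<^sub>1 \<circ> p1) \<le> C"
  proof -
    have "mk L (\<phi>\<^sub>1 \<circ> p1) (\<theta>\<^sub>1 \<circ> \<pi>\<^sub>1 \<circ> p1) \<le> m1 + ennreal (e / 2)"
      by (rule order_trans[OF mk_p1_le \<theta>\<^sub>1(2)])
    also have "\<dots> \<le> (m1 + ennreal (e / 2)) + (m2 + ennreal \<epsilon> + ennreal (e / 2))" by simp
    also have "\<dots> = C" unfolding C_def half by (simp add: ac_simps)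
    finally show ?thesis .
  qed
  have 2: "mk L (\<phi>\<^sub>2 \<circ> p2) (\<theta>\<^sub>2 \<circ> \<pi>\<^sub>1 \<circ> p1) \<le> C"
  proof -
    have "mk L (\<theta>\<^sub>2 \<circ> \<pi>\<^sub>1 \<circ> p1) (\<phi>\<^sub>2 \<circ> p2)
        \<le> mk L1 (\<theta>\<^sub>2 \<circ> \<pi>\<^sub>1) (\<psi> \<circ> \<rho>) + mk L2 (\<psi> \<circ> \<pi>) \<phi>\<^sub>2 + ennreal \<epsilon>"
      by (rule mk_cross[OF \<psi>(1)])
    also have "\<dots> \<le> (m1 + ennreal (e / 2)) + (m2 + ennreal (e / 2)) + ennreal \<epsilon>"
      using \<theta>\<^sub>2(2) \<psi>(2) by (intro add_mono order_refl) (simp_all add: mk_commute)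
    also have "\<dots> = C" unfolding C_def half by (simp add: ac_simps)
    finally show ?thesis by (simp add: mk_commute)
  qed
  have "(INF \<theta>\<in>states. mk L \<phi> (\<theta> \<circ> (\<lambda>d. \<pi>\<^sub>1 (p1 d)))) \<le> mk L \<phi> (mix t \<theta>\<^sub>1 \<theta>\<^sub>2 \<circ> (\<lambda>d. \<pi>\<^sub>1 (p1 d)))"
    using \<theta>\<^sub>1 \<theta>\<^sub>2 t by (intro INF_lower states_mix)
  also have "mix t \<theta>\<^sub>1 \<theta>\<^sub>2 \<circ> (\<lambda>d. \<pi>\<^sub>1 (p1 d)) = mix t (\<theta>\<^sub>1 \<circ> \<pi>\<^sub>1 \<circ> p1) (\<theta>\<^sub>2 \<circ> \<pi>\<^sub>1 \<circ> p1)"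
    by (simp add: fun_eq_iff mix_def)
  also have "mk L \<phi> \<dots> \<le> C"
    unfolding \<phi>_eq by (rule mk_mix_le[OF 1 2 t])
  finally show "(INF \<theta>\<in>states. mk L \<phi> (\<theta> \<circ> (\<lambda>d. \<pi>\<^sub>1 (p1 d)))) \<le> m1 + m2 + ennreal \<epsilon> + ennreal e"
    unfolding C_def .
qed

text \<open>
  For a given \<open>\<phi>\<close> choose \<open>\<psi>\<close> for the first tunnel, uniformly in \<open>g\<close>, and then \<open>\<theta>\<close> for \<open>\<psi>\<close> in the second.
  For each \<open>g\<close> the state \<open>\<psi> \<circ> \<beta> (\<sigma> g)\<close> of \<open>B\<close> is the bridge; it is a state since \<open>\<beta> (\<sigma> g)\<close> is
  positive and unital.
\<close>

lemma reach_p1_to_p2: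
  fixes \<pi>\<^sub>1 :: "'d1 \<Rightarrow> 'a::unital_cstar_algebra" and \<rho>\<^sub>2 :: "'d2 \<Rightarrow> 'e::unital_cstar_algebra"
    and \<alpha> :: "'g \<Rightarrow> 'a \<Rightarrow> 'a" and \<gamma> :: "'k \<Rightarrow> 'e \<Rightarrow> 'e"
  assumes m1: "(SUP \<phi>\<in>states. INF \<psi>\<in>states. SUP g\<in>X. mk L1 (\<phi> \<circ> \<alpha> g \<circ> \<pi>\<^sub>1) (\<psi> \<circ> \<beta> (\<sigma> g) \<circ> \<rho>)) \<le> m1"
    and m2: "(SUP \<psi>\<in>states. INF \<theta>\<in>states. SUP h\<in>Y. mk L2 (\<psi> \<circ> \<beta> h \<circ> \<pi>) (\<theta> \<circ> \<gamma> (\<sigma>' h) \<circ> \<rho>\<^sub>2)) \<le> m2"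
    and Z: "Z \<subseteq> X" "\<And>g. g \<in> Z \<Longrightarrow> \<sigma> g \<in> Y" "\<And>g. g \<in> Z \<Longrightarrow> s g = \<sigma>' (\<sigma> g)"
    and \<beta>: "\<And>h. positive_unital_linear (\<beta> h)"
  shows "(SUP \<phi>\<in>states. INF \<theta>\<in>states. SUP g\<in>Z.
      mk L (\<phi> \<circ> \<alpha> g \<circ> (\<lambda>d. \<pi>\<^sub>1 (p1 d))) (\<theta> \<circ> \<gamma> (s g) \<circ> (\<lambda>d. \<rho>\<^sub>2 (p2 d)))) \<le> m1 + m2 + ennreal \<epsilon>"
proof (rule SUP_least, rule ennreal_le_epsilon)
  fix \<phi> :: "'a \<Rightarrow> complex" and e :: real
  assume \<phi>: "\<phi> \<in> states" and "m1 + m2 + ennreal \<epsilon> < top" and e: "0 < e"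
  then have fin: "m1 < top" "m2 < top" by (auto simp: less_top[symmetric])
  have e2: "0 < e / 2" using e by simp
  have half: "ennreal e = ennreal (e / 2) + ennreal (e / 2)"
    using e by (simp flip: ennreal_plus)
  have "(INF \<psi>\<in>states. SUP g\<in>X. mk L1 (\<phi> \<circ> \<alpha> g \<circ> \<pi>\<^sub>1) (\<psi> \<circ> \<beta> (\<sigma> g) \<circ> \<rho>)) \<le> m1"
    using m1 \<phi> by (simp add: SUP_le_iff)
  then obtain \<psi> where \<psi>: "\<psi> \<in> states"
    "(SUP g\<in>X. mk L1 (\<phi> \<circ> \<alpha> g \<circ> \<pi>\<^sub>1) (\<psi> \<circ> \<beta> (\<sigma> g) \<circ> \<rho>)) \<le> m1 + ennreal (e / 2)"
    by (rule ennreal_INF_approx[OF _ fin(1) e2])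
  have "(INF \<theta>\<in>states. SUP h\<in>Y. mk L2 (\<psi> \<circ> \<beta> h \<circ> \<pi>) (\<theta> \<circ> \<gamma> (\<sigma>' h) \<circ> \<rho>\<^sub>2)) \<le> m2"
    using m2 \<psi>(1) by (simp add: SUP_le_iff)
  then obtain \<theta> where \<theta>: "\<theta> \<in> states"
    "(SUP h\<in>Y. mk L2 (\<psi> \<circ> \<beta> h \<circ> \<pi>) (\<theta> \<circ> \<gamma> (\<sigma>' h) \<circ> \<rho>\<^sub>2)) \<le> m2 + ennreal (e / 2)"
    by (rule ennreal_INF_approx[OF _ fin(2) e2])
  have "mk L (\<phi> \<circ> \<alpha> g \<circ> \<pi>\<^sub>1 \<circ> p1) (\<theta> \<circ> \<gamma> (s g) \<circ> \<rho>\<^sub>2 \<circ> p2) \<le> m1 + m2 + ennreal \<epsilon> + ennreal e"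
    if g: "g \<in> Z" for g
  proof -
    have "mk L (\<phi> \<circ> \<alpha> g \<circ> \<pi>\<^sub>1 \<circ> p1) (\<theta> \<circ> \<gamma> (s g) \<circ> \<rho>\<^sub>2 \<circ> p2)
        \<le> mk L1 (\<phi> \<circ> \<alpha> g \<circ> \<pi>\<^sub>1) (\<psi> \<circ> \<beta> (\<sigma> g) \<circ> \<rho>) +
          mk L2 (\<psi> \<circ> \<beta> (\<sigma> g) \<circ> \<pi>) (\<theta> \<circ> \<gamma> (s g) \<circ> \<rho>\<^sub>2) + ennreal \<epsilon>"
      by (rule mk_cross[OF states_comp_positive[OF \<psi>(1) \<beta>]])
    also have "\<dots> \<le> (m1 + ennreal (e / 2)) + (m2 + ennreal (e / 2)) + ennreal \<epsilon>"
      using \<psi>(2) \<theta>(2) Z g by (intro add_mono order_refl) (auto simp: SUP_le_iff)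
    also have "\<dots> = m1 + m2 + ennreal \<epsilon> + ennreal e"
      unfolding half by (simp add: ac_simps)
    finally show ?thesis .
  qed
  then have "(SUP g\<in>Z. mk L (\<phi> \<circ> \<alpha> g \<circ> (\<lambda>d. \<pi>\<^sub>1 (p1 d))) (\<theta> \<circ> \<gamma> (s g) \<circ> (\<lambda>d. \<rho>\<^sub>2 (p2 d))))
      \<le> m1 + m2 + ennreal \<epsilon> + ennreal e"
    by (intro SUP_least) (simp add: o_def)
  then show "(INF \<theta>\<in>states. SUP g\<in>Z. mk L (\<phi> \<circ> \<alpha> g \<circ> (\<lambda>d. \<pi>\<^sub>1 (p1 d)))
      (\<theta> \<circ> \<gamma> (s g) \<circ> (\<lambda>d. \<rho>\<^sub>2 (p2 d)))) \<le> m1 + m2 + ennreal \<epsilon> + ennreal e"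
    using \<theta>(1) by (rule INF_lower2[rotated])
qed

text \<open>All states are at finite distance from the pullback of one fixed state of \<open>B\<close>.\<close>

lemma mk_finite:
  assumes fin1: "\<And>\<phi> \<psi>. \<phi> \<in> states \<Longrightarrow> \<psi> \<in> states \<Longrightarrow> mk L1 \<phi> \<psi> < top"
    and fin2: "\<And>\<phi> \<psi>. \<phi> \<in> states \<Longrightarrow> \<psi> \<in> states \<Longrightarrow> mk L2 \<phi> \<psi> < top"
    and \<phi>: "\<phi> \<in> states" and \<psi>: "\<psi> \<in> states"
  shows "mk L \<phi> \<psi> < top"
proof -
  obtain \<omega> :: "'b \<Rightarrow> complex" where \<omega>: "\<omega> \<in> states" using states_nonempty by blast
  have \<omega>\<rho>: "\<omega> \<circ> \<rho> \<in> states" and \<omega>\<pi>: "\<omega> \<circ> \<pi> \<in> states"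
    by (intro states_comp_morphism \<omega> quantum_isometryD(1)[OF \<rho>] quantum_isometryD(1)[OF \<pi>])+
  have pivot: "mk L \<phi> (\<omega> \<circ> \<rho> \<circ> p1) < top" if \<phi>: "\<phi> \<in> states" for \<phi>
  proof -
    obtain t \<phi>\<^sub>1 \<phi>\<^sub>2 where t: "0 \<le> t" "t \<le> 1" and st: "\<phi>\<^sub>1 \<in> states" "\<phi>\<^sub>2 \<in> states"
      and \<phi>_eq: "\<phi> = mix t (\<phi>\<^sub>1 \<circ> p1) (\<phi>\<^sub>2 \<circ> p2)"
      using states_decomp[OF \<phi>] by blast
    let ?C = "mk L1 \<phi>\<^sub>1 (\<omega> \<circ> \<rho>) + mk L2 (\<omega> \<circ> \<pi>) \<phi>\<^sub>2 + ennreal \<epsilon>"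
    have 1: "mk L (\<phi>\<^sub>1 \<circ> p1) (\<omega> \<circ> \<rho> \<circ> p1) \<le> ?C"
      by (rule order_trans[OF mk_p1_le]) (simp add: add.assoc)
    have "mk L (\<omega> \<circ> \<rho> \<circ> p1) (\<phi>\<^sub>2 \<circ> p2) \<le> mk L1 (\<omega> \<circ> \<rho>) (\<omega> \<circ> \<rho>) + mk L2 (\<omega> \<circ> \<pi>) \<phi>\<^sub>2 + ennreal \<epsilon>"
      by (rule mk_cross[OF \<omega>])
    also have "\<dots> \<le> ?C" by (intro add_mono order_refl) simp
    finally have 2: "mk L (\<phi>\<^sub>2 \<circ> p2) (\<omega> \<circ> \<rho> \<circ> p1) \<le> ?C" by (simp add: mk_commute)
    have "mk L \<phi> (\<omega> \<circ> \<rho> \<circ> p1) \<le> ?C"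
      using mk_mix_le[OF 1 2 t] by (simp add: \<phi>_eq)
    also have "?C < top" using fin1[OF st(1) \<omega>\<rho>] fin2[OF \<omega>\<pi> st(2)] by simp
    finally show ?thesis .
  qed
  have "mk L \<phi> \<psi> \<le> mk L \<phi> (\<omega> \<circ> \<rho> \<circ> p1) + mk L \<psi> (\<omega> \<circ> \<rho> \<circ> p1)"
    using mk_triangle[of L \<phi> \<psi> "\<omega> \<circ> \<rho> \<circ> p1"] by (simp add: mk_commute)
  also have "\<dots> < top" using pivot[OF \<phi>] pivot[OF \<psi>] by simp
  finally show ?thesis .
qed

text \<open>
  The difference of the two mixtures splits as
  \<open>t (\<phi>\<^sub>1 - \<psi>\<^sub>1) + (1 - t) (\<phi>\<^sub>2 - \<psi>\<^sub>2) + (t - s) (\<psi>\<^sub>1 - \<psi>\<^sub>2)\<close>. The weight \<open>t\<close> stays inside the distance, as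
  \<open>t (\<phi>\<^sub>1 - \<psi>\<^sub>1)\<close> is the difference of the states \<open>mix t \<phi>\<^sub>1 \<psi>\<^sub>1\<close> and \<open>\<psi>\<^sub>1\<close>; so the bound is useful even
  if \<open>t\<close> is close to zero and \<open>\<phi>\<^sub>1\<close> is far from \<open>\<psi>\<^sub>1\<close>.
\<close>

lemma mk_mix_mix_le:
  assumes "0 \<le> t" "t \<le> 1"
  shows "mk L (mix t (\<phi>\<^sub>1 \<circ> p1) (\<phi>\<^sub>2 \<circ> p2)) (mix s (\<psi>\<^sub>1 \<circ> p1) (\<psi>\<^sub>2 \<circ> p2))
    \<le> mk L1 (mix t \<phi>\<^sub>1 \<psi>\<^sub>1) \<psi>\<^sub>1 + mk L2 (mix (1 - t) \<phi>\<^sub>2 \<psi>\<^sub>2) \<psi>\<^sub>2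
      + ennreal \<bar>t - s\<bar> * mk L (\<psi>\<^sub>1 \<circ> p1) (\<psi>\<^sub>2 \<circ> p2)"
proof (rule mk_least)
  fix d assume d: "d \<in> Ldom L" "L d \<le> 1"
  note c = unit_ball_components[OF d]
  let ?x = "mix t \<phi>\<^sub>1 \<psi>\<^sub>1 (p1 d) - \<psi>\<^sub>1 (p1 d)" and ?y = "mix (1 - t) \<phi>\<^sub>2 \<psi>\<^sub>2 (p2 d) - \<psi>\<^sub>2 (p2 d)"
    and ?z = "(\<psi>\<^sub>1 \<circ> p1) d - (\<psi>\<^sub>2 \<circ> p2) d"
  have "mix t (\<phi>\<^sub>1 \<circ> p1) (\<phi>\<^sub>2 \<circ> p2) d - mix s (\<psi>\<^sub>1 \<circ> p1) (\<psi>\<^sub>2 \<circ> p2) d = ?x + ?y + of_real (t - s) * ?z"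
    by (simp add: mix_def algebra_simps)
  then have "cmod (mix t (\<phi>\<^sub>1 \<circ> p1) (\<phi>\<^sub>2 \<circ> p2) d - mix s (\<psi>\<^sub>1 \<circ> p1) (\<psi>\<^sub>2 \<circ> p2) d)
      \<le> cmod ?x + cmod ?y + cmod (of_real (t - s) * ?z)"
    by (metis (no_types) add_right_mono norm_triangle_ineq order_trans)
  also have "cmod (of_real (t - s) * ?z) = \<bar>t - s\<bar> * cmod ?z"
    by (simp only: norm_mult norm_of_real)
  finally have "ennreal (cmod (mix t (\<phi>\<^sub>1 \<circ> p1) (\<phi>\<^sub>2 \<circ> p2) d - mix s (\<psi>\<^sub>1 \<circ> p1) (\<psi>\<^sub>2 \<circ> p2) d))
      \<le> ennreal (cmod ?x + cmod ?y + \<bar>t - s\<bar> * cmod ?z)"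
    by (rule ennreal_leI)
  also have "\<dots> = ennreal (cmod ?x) + ennreal (cmod ?y) + ennreal \<bar>t - s\<bar> * ennreal (cmod ?z)"
    by (simp add: ennreal_plus ennreal_mult)
  also have "\<dots> \<le> mk L1 (mix t \<phi>\<^sub>1 \<psi>\<^sub>1) \<psi>\<^sub>1 + mk L2 (mix (1 - t) \<phi>\<^sub>2 \<psi>\<^sub>2) \<psi>\<^sub>2
      + ennreal \<bar>t - s\<bar> * mk L (\<psi>\<^sub>1 \<circ> p1) (\<psi>\<^sub>2 \<circ> p2)"
    by (intro add_mono mult_left_mono mk_upper c d) simp
  finally show "ennreal (cmod (mix t (\<phi>\<^sub>1 \<circ> p1) (\<phi>\<^sub>2 \<circ> p2) d - mix s (\<psi>\<^sub>1 \<circ> p1) (\<psi>\<^sub>2 \<circ> p2) d))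
      \<le> mk L1 (mix t \<phi>\<^sub>1 \<psi>\<^sub>1) \<psi>\<^sub>1 + mk L2 (mix (1 - t) \<phi>\<^sub>2 \<psi>\<^sub>2) \<psi>\<^sub>2
      + ennreal \<bar>t - s\<bar> * mk L (\<psi>\<^sub>1 \<circ> p1) (\<psi>\<^sub>2 \<circ> p2)" .
qed

end



section \<open>The direct sum as a quantum compact metric space\<close>

lemma sa_dsum_iff: "d \<in> sa \<longleftrightarrow> dfst d \<in> sa \<and> dsnd d \<in> sa"
  by (cases d) (simp add: sa_iff adj_dsum_def)

lemma unital_star_morphism_dfst: "unital_star_morphism dfst"
  and unital_star_morphism_dsnd: "unital_star_morphism dsnd"
  by (auto simp: unital_star_morphism_def clinear_iff dsum_defs)

lemma surj_dfst: "surj dfst" and surj_dsnd: "surj dsnd"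
  by (metis dsum.sel surj_def)+

lemma DSum_in_pos_cone:
  assumes "a \<in> pos_cone" "b \<in> pos_cone"
  shows "DSum a b \<in> pos_cone"
proof -
  obtain x y where "a = adj x * x" "b = adj y * y"
    using assms by (auto simp: positive_elements_eq_pos_cone[symmetric] positive_elements_def)
  then have "DSum a b = adj (DSum x y) * DSum x y"
    by (simp add: adj_dsum_def times_dsum_def)
  then show ?thesis using adj_mult_in_pos_cone by metis
qed

text \<open>
  The restriction of a state to each summand is a positive functional, hence a multiple of a state,
  and the two factors add up to the value \<open>1\<close> at the unit.
\<close>

lemma states_dsum_decomp:
  fixes \<phi> :: "('a::unital_cstar_algebra, 'b::unital_cstar_algebra) dsum \<Rightarrow> complex"
  assumes \<phi>: "\<phi> \<in> states"
  shows "\<exists>t \<phi>\<^sub>1 \<phi>\<^sub>2. 0 \<le> t \<and> t \<le> 1 \<and> \<phi>\<^sub>1 \<in> states \<and> \<phi>\<^sub>2 \<in> states \<and>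
    \<phi> = mix t (\<phi>\<^sub>1 \<circ> dfst) (\<phi>\<^sub>2 \<circ> dsnd)"
proof -
  note lin = statesD(1)[OF \<phi>]
  have DSum_add: "DSum a 0 + DSum b 0 = DSum (a + b) (0::'b)"
      "DSum 0 c + DSum 0 e = DSum (0::'a) (c + e)" "DSum a 0 + DSum 0 c = DSum a c"
      "k *\<^sub>C DSum a 0 = DSum (k *\<^sub>C a) (0::'b)" "k *\<^sub>C DSum 0 c = DSum (0::'a) (k *\<^sub>C c)" for a b c e k
    by (simp_all add: plus_dsum_def scaleC_dsum_def)
  have lin1: "clinear (\<lambda>a. \<phi> (DSum a 0))"
    unfolding clinear_iff
    by (simp add: DSum_add(1,4)[symmetric] clinear_add[OF lin] clinear_scaleC[OF lin] del: scaleC_complex)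
  have pos1: "\<phi> (DSum a 0) \<in> nonneg_Reals" if "a \<in> pos_cone" for a
    by (intro statesD(3)[OF \<phi>] DSum_in_pos_cone that zero_in_pos_cone)
  obtain t \<phi>\<^sub>1 where 1: "0 \<le> t" "\<phi>\<^sub>1 \<in> states" "\<And>a. \<phi> (DSum a 0) = of_real t * \<phi>\<^sub>1 a"
    by (rule positive_functional_multiple_of_state[OF lin1 pos1]) ((assumption | rule that)+)
  have lin2: "clinear (\<lambda>a. \<phi> (DSum 0 a))"
    unfolding clinear_iff
    by (simp add: DSum_add(2,5)[symmetric] clinear_add[OF lin] clinear_scaleC[OF lin] del: scaleC_complex)
  have pos2: "\<phi> (DSum 0 a) \<in> nonneg_Reals" if "a \<in> pos_cone" for a
    by (intro statesD(3)[OF \<phi>] DSum_in_pos_cone that zero_in_pos_cone)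
  obtain s \<phi>\<^sub>2 where 2: "0 \<le> s" "\<phi>\<^sub>2 \<in> states" "\<And>a. \<phi> (DSum 0 a) = of_real s * \<phi>\<^sub>2 a"
    by (rule positive_functional_multiple_of_state[OF lin2 pos2]) ((assumption | rule that)+)
  have sum: "\<phi> (DSum a b) = of_real t * \<phi>\<^sub>1 a + of_real s * \<phi>\<^sub>2 b" for a b
    using clinear_add[OF lin, of "DSum a 0" "DSum 0 b"] by (simp add: DSum_add(3) 1(3) 2(3))
  have "of_real t + of_real s = (1::complex)"
    using sum[of 1 1] statesD(2)[OF \<phi>] statesD(2)[OF 1(2)] statesD(2)[OF 2(2)]
    by (simp add: one_dsum_def)
  then have s: "s = 1 - t" by (simp add: complex_eq_iff)
  have "\<phi> d = mix t (\<phi>\<^sub>1 \<circ> dfst) (\<phi>\<^sub>2 \<circ> dsnd) d" for d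
    using sum[of "dfst d" "dsnd d"] by (simp add: mix_def s)
  then show ?thesis using 1(1,2) 2(1,2) s by (intro exI[of _ t] exI[of _ \<phi>\<^sub>1] exI[of _ \<phi>\<^sub>2]) auto
qed

lemma ennreal_add3_less:
  fixes a b c :: ennreal
  assumes "a < ennreal x" "b < ennreal x" "c \<le> ennreal x" "0 < x"
  shows "a + b + c < ennreal (3 * x)"
  using assms
  by (cases a; cases b; cases c) (auto simp: ennreal_less_iff top_unique simp flip: ennreal_plus)

definition glued_seminorm :: "real \<Rightarrow> ('a::unital_cstar_algebra \<Rightarrow> ennreal) \<Rightarrow>
    ('b::unital_cstar_algebra \<Rightarrow> ennreal) \<Rightarrow> ('a \<Rightarrow> 'c::unital_cstar_algebra) \<Rightarrow> ('b \<Rightarrow> 'c) \<Rightarrow>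
    ('a, 'b) dsum \<Rightarrow> ennreal" where
  "glued_seminorm \<epsilon> L1 L2 \<rho> \<pi> = (\<lambda>d. Max {L1 (dfst d), L2 (dsnd d),
     ennreal (1 / \<epsilon> * norm (\<rho> (dfst d) - \<pi> (dsnd d)))})"

lemma glued_glued_seminorm:
  fixes L1 :: "'a::unital_cstar_algebra \<Rightarrow> ennreal" and L2 :: "'b::unital_cstar_algebra \<Rightarrow> ennreal"
  assumes "quantum_isometry L1 LB \<rho>" "quantum_isometry L2 LB \<pi>" "0 < \<epsilon>"
  shows "glued (glued_seminorm \<epsilon> L1 L2 \<rho> \<pi>) L1 L2 LB dfst dsnd \<rho> \<pi> \<epsilon>"
proof
  show "\<exists>d\<in>sa. dfst d = d1 \<and> dsnd d = d2" if "d1 \<in> sa" "d2 \<in> sa" for d1 d2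
    using that by (intro bexI[of _ "DSum d1 d2"]) (simp_all add: sa_dsum_iff)
  show "\<exists>t \<phi>\<^sub>1 \<phi>\<^sub>2. 0 \<le> t \<and> t \<le> 1 \<and> \<phi>\<^sub>1 \<in> states \<and> \<phi>\<^sub>2 \<in> states \<and> \<phi> = mix t (\<phi>\<^sub>1 \<circ> dfst) (\<phi>\<^sub>2 \<circ> dsnd)"
    if "\<phi> \<in> states" for \<phi> :: "('a, 'b) dsum \<Rightarrow> complex"
    using that by (rule states_dsum_decomp)
qed (use assms in \<open>simp_all add: glued_seminorm_def unital_star_morphism_dfst unital_star_morphism_dsnd
      surj_dfst surj_dsnd\<close>)

lemma morphism_jordan: "unital_star_morphism f \<Longrightarrow> f (jordan a b) = jordan (f a) (f b)"
  by (simp add: unital_star_morphism_def clinear_iff jordan_def)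

lemma morphism_lie: "unital_star_morphism f \<Longrightarrow> f (lie a b) = lie (f a) (f b)"
  using clinear_diff[of f "a * b" "b * a"]
  by (simp add: unital_star_morphism_def clinear_iff lie_def)

text \<open>
  The two terms of each product are compared by \<open>u v - u' v' = u (v - v') + (u - u') v'\<close> and its mirror image.
  The mixed norms \<open>\<parallel>u\<parallel>\<close> and \<open>\<parallel>v'\<parallel>\<close> on the right are chosen so that one factor comes from each side of the
  gluing.
\<close>

lemma norm_jordan_lie_diff_le:
  fixes u v u' v' :: "'a::unital_cstar_algebra"
  shows "norm (jordan u v - jordan u' v') \<le> norm u * norm (v - v') + norm v' * norm (u - u')"
    and "norm (lie u v - lie u' v') \<le> norm u * norm (v - v') + norm v' * norm (u - u')"
proof -
  have 1: "norm (u * v - u' * v') \<le> norm u * norm (v - v') + norm v' * norm (u - u')"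
  proof -
    have "u * v - u' * v' = u * (v - v') + (u - u') * v'" by (simp add: algebra_simps)
    also have "norm \<dots> \<le> norm u * norm (v - v') + norm (u - u') * norm v'"
      by (rule order_trans[OF norm_triangle_ineq add_mono[OF norm_mult_ineq norm_mult_ineq]])
    finally show ?thesis by (simp add: mult.commute)
  qed
  have 2: "norm (v * u - v' * u') \<le> norm u * norm (v - v') + norm v' * norm (u - u')"
  proof -
    have "v * u - v' * u' = (v - v') * u + v' * (u - u')" by (simp add: algebra_simps)
    also have "norm \<dots> \<le> norm (v - v') * norm u + norm v' * norm (u - u')"
      by (rule order_trans[OF norm_triangle_ineq add_mono[OF norm_mult_ineq norm_mult_ineq]])
    finally show ?thesis by (simp add: mult.commute)
  qed
  have "jordan u v - jordan u' v' = (1/2) *\<^sub>C ((u * v - u' * v') + (v * u - v' * u'))"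
    by (simp add: jordan_def add_diff_add flip: scaleC_diff_right)
  then show "norm (jordan u v - jordan u' v') \<le> norm u * norm (v - v') + norm v' * norm (u - u')"
    using norm_triangle_ineq[of "u * v - u' * v'" "v * u - v' * u'"] 1 2
    by (simp add: norm_scaleC norm_divide)
  have "lie u v - lie u' v' = (1/(2*\<i>)) *\<^sub>C ((u * v - u' * v') - (v * u - v' * u'))"
    by (simp add: lie_def diff_diff_eq2 algebra_simps flip: scaleC_diff_right)
  then show "norm (lie u v - lie u' v') \<le> norm u * norm (v - v') + norm v' * norm (u - u')"
    using norm_triangle_ineq4[of "u * v - u' * v'" "v * u - v' * u'"] 1 2
    by (simp add: norm_scaleC norm_divide norm_mult)
qed

lemma qcmsD:
  assumes "qcms F L"
  shows "subspace (Ldom L)" "sa \<subseteq> closure (Ldom L)"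
    "a \<in> Ldom L \<Longrightarrow> b \<in> Ldom L \<Longrightarrow> L (a + b) \<le> L a + L b"
    "a \<in> Ldom L \<Longrightarrow> L (r *\<^sub>R a) = ennreal \<bar>r\<bar> * L a"
    "a \<in> Ldom L \<Longrightarrow> b \<in> Ldom L \<Longrightarrow> jordan a b \<in> Ldom L"
    "a \<in> Ldom L \<Longrightarrow> b \<in> Ldom L \<Longrightarrow> lie a b \<in> Ldom L"
    "a \<in> sa \<Longrightarrow> L a = 0 \<longleftrightarrow> (\<exists>r. a = r *\<^sub>R 1)"
    "metrizes_weak_star L"
    "a \<in> Ldom L \<Longrightarrow> b \<in> Ldom L \<Longrightarrow>
      L (jordan a b) \<le> ennreal (F (norm a) (norm b) (enn2real (L a)) (enn2real (L b)))"
    "a \<in> Ldom L \<Longrightarrow> b \<in> Ldom L \<Longrightarrow>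
      L (lie a b) \<le> ennreal (F (norm a) (norm b) (enn2real (L a)) (enn2real (L b)))"
    "a \<in> sa \<Longrightarrow> c < L a \<Longrightarrow> \<forall>\<^sub>F x in at a within sa. c < L x"
  using assms by (simp_all add: qcms_def)

lemma bounded_linear_morphism:
  assumes "unital_star_morphism f"
  shows "bounded_linear f"
  using unital_star_morphismD(1)[OF assms] unital_star_morphism_contractive[OF assms]
  by (intro bounded_linear_intro[where K=1]) (auto intro: clinear_add clinear_scaleR)

context
  fixes F and L1 :: "'a::unital_cstar_algebra \<Rightarrow> ennreal" and L2 :: "'b::unital_cstar_algebra \<Rightarrow> ennreal"
    and LB :: "'c::unital_cstar_algebra \<Rightarrow> ennreal" and \<rho> \<pi> and \<epsilon> :: real
    and L :: "('a, 'b) dsum \<Rightarrow> ennreal"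
  assumes q1: "qcms F L1" and q2: "qcms F L2"
    and \<rho>: "quantum_isometry L1 LB \<rho>" and \<pi>: "quantum_isometry L2 LB \<pi>" and \<epsilon>: "0 < \<epsilon>"
  defines "L \<equiv> glued_seminorm \<epsilon> L1 L2 \<rho> \<pi>"
begin

interpretation glued L L1 L2 LB dfst dsnd \<rho> \<pi> \<epsilon>
  unfolding L_def by (rule glued_glued_seminorm[OF \<rho> \<pi> \<epsilon>])

lemmas \<rho>m = quantum_isometryD(1)[OF \<rho>] and \<pi>m = quantum_isometryD(1)[OF \<pi>]
lemmas \<rho>lin = unital_star_morphismD(1)[OF \<rho>m] and \<pi>lin = unital_star_morphismD(1)[OF \<pi>m]

lemma L_ge: "L1 (dfst d) \<le> L d" "L2 (dsnd d) \<le> L d"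
  "ennreal (1 / \<epsilon> * norm (\<rho> (dfst d) - \<pi> (dsnd d))) \<le> L d"
  using L_le_iff[of d "L d"] by auto

lemma less_L_iff: "c < L d \<longleftrightarrow> c < L1 (dfst d) \<or> c < L2 (dsnd d) \<or>
    c < ennreal (1 / \<epsilon> * norm (\<rho> (dfst d) - \<pi> (dsnd d)))"
  using L_le_iff[of d c] by (meson linorder_not_le)

lemma Ldom_iff: "d \<in> Ldom L \<longleftrightarrow> dfst d \<in> Ldom L1 \<and> dsnd d \<in> Ldom L2"
  by (auto simp: Ldom_def sa_dsum_iff L_def glued_seminorm_def)

lemma subspace_Ldom_glued: "subspace (Ldom L)"
  using qcmsD(1)[OF q1] qcmsD(1)[OF q2]
  by (simp add: subspace_def Ldom_iff dsum_vector_defs)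

lemma dense_Ldom_glued: "sa \<subseteq> closure (Ldom L)"
proof
  fix d :: "('a, 'b) dsum" assume d: "d \<in> sa"
  show "d \<in> closure (Ldom L)"
    unfolding closure_approachable
  proof (intro allI impI)
    fix e :: real assume e: "0 < e"
    have "dfst d \<in> closure (Ldom L1)" "dsnd d \<in> closure (Ldom L2)"
      using d qcmsD(2)[OF q1] qcmsD(2)[OF q2] by (auto simp: sa_dsum_iff)
    then obtain x y where "x \<in> Ldom L1" "dist x (dfst d) < e" "y \<in> Ldom L2" "dist y (dsnd d) < e"
      using e unfolding closure_approachable by blast
    then show "\<exists>y\<in>Ldom L. dist y d < e"
      by (intro bexI[of _ "DSum x y"]) (simp_all add: Ldom_iff dist_norm minus_dsum_def norm_dsum_def)
  qed
qed

lemma glued_scale: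
  assumes "d \<in> Ldom L"
  shows "L (r *\<^sub>R d) = ennreal \<bar>r\<bar> * L d"
proof -
  have "norm (\<rho> (r *\<^sub>R dfst d) - \<pi> (r *\<^sub>R dsnd d)) = \<bar>r\<bar> * norm (\<rho> (dfst d) - \<pi> (dsnd d))"
    by (simp add: clinear_scaleR[OF \<rho>lin] clinear_scaleR[OF \<pi>lin] flip: scaleR_diff_right)
  then have "ennreal (1 / \<epsilon> * norm (\<rho> (r *\<^sub>R dfst d) - \<pi> (r *\<^sub>R dsnd d)))
      = ennreal \<bar>r\<bar> * ennreal (1 / \<epsilon> * norm (\<rho> (dfst d) - \<pi> (dsnd d)))"
    using \<epsilon> by (simp add: ennreal_mult[symmetric] mult.left_commute)
  moreover have "max (c * x) (c * y) = c * max x y" for c x y :: ennreal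
    using max_of_mono[of "(*) c" x y] by (simp add: mono_def mult_left_mono)
  ultimately show ?thesis
    using qcmsD(4)[OF q1 conjunct1] qcmsD(4)[OF q2 conjunct2] assms[unfolded Ldom_iff]
    by (simp add: L_def glued_seminorm_def scaleR_dsum_def)
qed

lemma glued_triangle:
  assumes "d \<in> Ldom L" "e \<in> Ldom L"
  shows "L (d + e) \<le> L d + L e"
proof -
  have dom: "dfst d \<in> Ldom L1" "dsnd d \<in> Ldom L2" "dfst e \<in> Ldom L1" "dsnd e \<in> Ldom L2"
    using assms by (auto simp: Ldom_iff)
  let ?n = "\<lambda>d. norm (\<rho> (dfst d) - \<pi> (dsnd d))"
  have "L1 (dfst d + dfst e) \<le> L d + L e"
    using qcmsD(3)[OF q1 dom(1,3)] add_mono[OF L_ge(1) L_ge(1)] by (rule order_trans)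
  moreover have "L2 (dsnd d + dsnd e) \<le> L d + L e"
    using qcmsD(3)[OF q2 dom(2,4)] add_mono[OF L_ge(2) L_ge(2)] by (rule order_trans)
  moreover have "ennreal (1 / \<epsilon> * ?n (d + e)) \<le> L d + L e"
  proof -
    have "\<rho> (dfst d + dfst e) - \<pi> (dsnd d + dsnd e) = (\<rho> (dfst d) - \<pi> (dsnd d)) + (\<rho> (dfst e) - \<pi> (dsnd e))"
      by (simp add: clinear_add[OF \<rho>lin] clinear_add[OF \<pi>lin])
    then have "?n (d + e) \<le> ?n d + ?n e"
      by (simp add: plus_dsum_def norm_triangle_ineq)
    then have "1 / \<epsilon> * ?n (d + e) \<le> 1 / \<epsilon> * ?n d + 1 / \<epsilon> * ?n e"
      using \<epsilon> by (simp add: divide_right_mono flip: add_divide_distrib)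
    then have "ennreal (1 / \<epsilon> * ?n (d + e)) \<le> ennreal (1 / \<epsilon> * ?n d + 1 / \<epsilon> * ?n e)"
      by (rule ennreal_leI)
    also have "\<dots> = ennreal (1 / \<epsilon> * ?n d) + ennreal (1 / \<epsilon> * ?n e)"
      using \<epsilon> by (intro ennreal_plus) auto
    also have "\<dots> \<le> L d + L e" by (intro add_mono L_ge)
    finally show ?thesis .
  qed
  ultimately show ?thesis unfolding L_le_iff by (simp add: plus_dsum_def)
qed

lemma glued_kernel:
  assumes "d \<in> sa"
  shows "L d = 0 \<longleftrightarrow> (\<exists>r. d = r *\<^sub>R 1)"
proof
  assume "L d = 0"
  then have "L d \<le> 0" by simp
  then have 0: "L1 (dfst d) = 0" "L2 (dsnd d) = 0" "\<rho> (dfst d) = \<pi> (dsnd d)"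
    unfolding L_le_iff using \<epsilon> by (auto simp: divide_le_0_iff)
  obtain r s where rs: "dfst d = r *\<^sub>R 1" "dsnd d = s *\<^sub>R 1"
    using 0 assms qcmsD(7)[OF q1] qcmsD(7)[OF q2] by (auto simp: sa_dsum_iff)
  have "r *\<^sub>R (1 :: 'c) = s *\<^sub>R 1"
    using 0(3) unital_star_morphismD(2)[OF \<rho>m] unital_star_morphismD(2)[OF \<pi>m]
    by (simp add: rs clinear_scaleR[OF \<rho>lin] clinear_scaleR[OF \<pi>lin])
  then have "r = s" by simp
  then have "d = r *\<^sub>R 1"
    using rs by (cases d) (simp add: scaleR_dsum_def one_dsum_def)
  then show "\<exists>r. d = r *\<^sub>R 1" ..
next
  assume "\<exists>r. d = r *\<^sub>R 1"
  then obtain r where d: "dfst d = r *\<^sub>R 1" "dsnd d = r *\<^sub>R 1"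
    by (auto simp: scaleR_dsum_def one_dsum_def)
  then have "L1 (dfst d) = 0" "L2 (dsnd d) = 0"
    using assms qcmsD(7)[OF q1] qcmsD(7)[OF q2] by (auto simp: sa_dsum_iff)
  moreover have "\<rho> (dfst d) = \<pi> (dsnd d)"
    unfolding d using unital_star_morphismD(2)[OF \<rho>m] unital_star_morphismD(2)[OF \<pi>m]
    by (simp add: clinear_scaleR[OF \<rho>lin] clinear_scaleR[OF \<pi>lin])
  ultimately have "L d \<le> 0" unfolding L_le_iff by simp
  then show "L d = 0" by simp
qed

text \<open>
  A maximum of lower semicontinuous functions is lower semicontinuous; the third one is continuous
  because morphisms are contractive.
\<close>

lemma glued_lower_semicontinuous:
  assumes d: "d \<in> sa" and c: "c < L d"
  shows "\<forall>\<^sub>F x in at d within sa. c < L x"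
proof -
  let ?g = "\<lambda>d. 1 / \<epsilon> * norm (\<rho> (dfst d) - \<pi> (dsnd d))"
  have dist: "dist (dfst x) (dfst y) \<le> dist x y" "dist (dsnd x) (dsnd y) \<le> dist x y"
    for x y :: "('a, 'b) dsum"
    by (simp_all add: dist_norm minus_dsum_def norm_dsum_def)
  consider "c < L1 (dfst d)" | "c < L2 (dsnd d)" | "c < ennreal (?g d)"
    using c unfolding less_L_iff by blast
  then show ?thesis
  proof cases
    case 1
    then obtain \<delta> where \<delta>: "0 < \<delta>" "\<And>x. x \<in> sa \<Longrightarrow> x \<noteq> dfst d \<Longrightarrow> dist x (dfst d) < \<delta> \<Longrightarrow> c < L1 x"
      using qcmsD(11)[OF q1, of "dfst d" c] d by (auto simp: eventually_at sa_dsum_iff)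
    have "c < L x" if "x \<in> sa" "dist x d < \<delta>" for x
      using \<delta>(2)[of "dfst x"] 1 that dist(1)[of x d] unfolding less_L_iff
      by (cases "dfst x = dfst d") (auto simp: sa_dsum_iff)
    then show ?thesis using \<delta>(1) by (auto simp: eventually_at)
  next
    case 2
    then obtain \<delta> where \<delta>: "0 < \<delta>" "\<And>x. x \<in> sa \<Longrightarrow> x \<noteq> dsnd d \<Longrightarrow> dist x (dsnd d) < \<delta> \<Longrightarrow> c < L2 x"
      using qcmsD(11)[OF q2, of "dsnd d" c] d by (auto simp: eventually_at sa_dsum_iff)
    have "c < L x" if "x \<in> sa" "dist x d < \<delta>" for x
      using \<delta>(2)[of "dsnd x"] 2 that dist(2)[of x d] unfolding less_L_iff
      by (cases "dsnd x = dsnd d") (auto simp: sa_dsum_iff)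
    then show ?thesis using \<delta>(1) by (auto simp: eventually_at)
  next
    case 3
    have bl: "bounded_linear (\<lambda>d :: ('a, 'b) dsum. \<rho> (dfst d))" "bounded_linear (\<lambda>d :: ('a, 'b) dsum. \<pi> (dsnd d))"
      by (rule bounded_linear_morphism[OF unital_star_morphism_comp[OF \<rho>m unital_star_morphism_dfst], unfolded o_def]
          bounded_linear_morphism[OF unital_star_morphism_comp[OF \<pi>m unital_star_morphism_dsnd], unfolded o_def])+
    have "((\<lambda>x. ennreal (?g x)) \<longlongrightarrow> ennreal (?g d)) (at d within sa)"
      by (intro tendsto_ennrealI tendsto_intros bounded_linear.tendsto[OF bl(1)]
          bounded_linear.tendsto[OF bl(2)])
    then have "\<forall>\<^sub>F x in at d within sa. c < ennreal (?g x)"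
      using 3 by (rule order_tendstoD(1))
    then show ?thesis
      by (rule eventually_mono) (auto simp: less_L_iff)
  qed
qed

text \<open>
  The first two terms of \<open>L\<close> are handled by monotonicity of \<open>F\<close>. For the third, the distance of the images
  in \<open>B\<close> is at most \<open>\<epsilon> L\<close>, so the Leibniz rule in \<open>B\<close> gives \<open>x m + y l\<close>, which permissibility bounds
  by \<open>F x y l m\<close>.
\<close>

lemma glued_leibniz:
  assumes F: "permissible F" and dom: "d \<in> Ldom L" "e \<in> Ldom L"
  shows "L (jordan d e) \<le> ennreal (F (norm d) (norm e) (enn2real (L d)) (enn2real (L e)))"
    and "L (lie d e) \<le> ennreal (F (norm d) (norm e) (enn2real (L d)) (enn2real (L e)))"
proof -
  define x y l m where "x = norm d" and "y = norm e" and "l = enn2real (L d)" and "m = enn2real (L e)"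
  have nn: "0 \<le> x" "0 \<le> y" "0 \<le> l" "0 \<le> m" by (simp_all add: x_def y_def l_def m_def)
  have fin: "L d < top" "L e < top" using dom by (auto simp: Ldom_def)
  have dom': "dfst d \<in> Ldom L1" "dsnd d \<in> Ldom L2" "dfst e \<in> Ldom L1" "dsnd e \<in> Ldom L2"
    using dom by (auto simp: Ldom_iff)
  have norms: "norm (dfst d) \<le> x" "norm (dsnd d) \<le> x" "norm (dfst e) \<le> y" "norm (dsnd e) \<le> y"
    by (simp_all add: x_def y_def norm_dsum_def)
  have Ls: "enn2real (L1 (dfst d)) \<le> l" "enn2real (L2 (dsnd d)) \<le> l"
    "enn2real (L1 (dfst e)) \<le> m" "enn2real (L2 (dsnd e)) \<le> m"
    unfolding l_def m_def by (intro enn2real_mono L_ge fin)+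
  have gap: "norm (\<rho> (dfst z) - \<pi> (dsnd z)) \<le> \<epsilon> * enn2real (L z)" if "L z < top" for z
  proof -
    have "enn2real (ennreal (1 / \<epsilon> * norm (\<rho> (dfst z) - \<pi> (dsnd z)))) \<le> enn2real (L z)"
      by (intro enn2real_mono L_ge that)
    then show ?thesis using \<epsilon> by (simp add: divide_le_eq mult.commute)
  qed
  have F_mono: "F a b c f \<le> F a' b' c' f'"
    if "0 \<le> a" "0 \<le> b" "0 \<le> c" "0 \<le> f" "a \<le> a'" "b \<le> b'" "c \<le> c'" "f \<le> f'" for a b c f a' b' c' f'
    using F that by (simp add: permissible_def)
  have first: "ennreal (F (norm (dfst d)) (norm (dfst e)) (enn2real (L1 (dfst d))) (enn2real (L1 (dfst e))))
      \<le> ennreal (F x y l m)"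
    by (intro ennreal_leI F_mono norms Ls) simp_all
  have second: "ennreal (F (norm (dsnd d)) (norm (dsnd e)) (enn2real (L2 (dsnd d))) (enn2real (L2 (dsnd e))))
      \<le> ennreal (F x y l m)"
    by (intro ennreal_leI F_mono norms Ls) simp_all
  have third: "ennreal (1 / \<epsilon> * n) \<le> ennreal (F x y l m)"
    if n: "n \<le> norm (\<rho> (dfst d)) * norm (\<rho> (dfst e) - \<pi> (dsnd e)) +
        norm (\<pi> (dsnd e)) * norm (\<rho> (dfst d) - \<pi> (dsnd d))" for n
  proof -
    have "norm (\<rho> (dfst d)) \<le> x" "norm (\<pi> (dsnd e)) \<le> y"
      using unital_star_morphism_contractive[OF \<rho>m] unital_star_morphism_contractive[OF \<pi>m]
        norms order_trans by blast+
    then have "n \<le> x * (\<epsilon> * m) + y * (\<epsilon> * l)"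
      using n gap[OF fin(1)] gap[OF fin(2)] nn \<epsilon>
      by (intro order_trans[OF n] add_mono mult_mono) (auto simp: l_def m_def)
    then have "1 / \<epsilon> * n \<le> x * m + y * l"
      using \<epsilon> by (simp add: divide_le_eq algebra_simps)
    also have "\<dots> \<le> F x y l m" using F nn by (simp add: permissible_def)
    finally show ?thesis by (rule ennreal_leI)
  qed
  have comps: "dfst (jordan d e) = jordan (dfst d) (dfst e)" "dsnd (jordan d e) = jordan (dsnd d) (dsnd e)"
    "dfst (lie d e) = lie (dfst d) (dfst e)" "dsnd (lie d e) = lie (dsnd d) (dsnd e)"
    by (simp_all add: morphism_jordan morphism_lie unital_star_morphism_dfst unital_star_morphism_dsnd)
  show "L (jordan d e) \<le> ennreal (F (norm d) (norm e) (enn2real (L d)) (enn2real (L e)))"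
    unfolding L_le_iff comps morphism_jordan[OF \<rho>m] morphism_jordan[OF \<pi>m]
      x_def[symmetric] y_def[symmetric] l_def[symmetric] m_def[symmetric]
    using order_trans[OF qcmsD(9)[OF q1 dom'(1,3)] first] order_trans[OF qcmsD(9)[OF q2 dom'(2,4)] second]
      third[OF norm_jordan_lie_diff_le(1)] by blast
  show "L (lie d e) \<le> ennreal (F (norm d) (norm e) (enn2real (L d)) (enn2real (L e)))"
    unfolding L_le_iff comps morphism_lie[OF \<rho>m] morphism_lie[OF \<pi>m]
      x_def[symmetric] y_def[symmetric] l_def[symmetric] m_def[symmetric]
    using order_trans[OF qcmsD(10)[OF q1 dom'(1,3)] first] order_trans[OF qcmsD(10)[OF q2 dom'(2,4)] second]
      third[OF norm_jordan_lie_diff_le(2)] by blast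
qed

text \<open>
  The value of \<open>\<phi>\<close> at \<open>DSum 1 0\<close> is the weight \<open>t\<close>, and
  \<open>mix t \<phi>\<^sub>1 \<psi>\<^sub>1 a - \<psi>\<^sub>1 a\<close> equals the change of \<open>\<phi>\<close> at \<open>DSum a 0\<close> corrected by \<open>(t - s) \<psi>\<^sub>1 a\<close>. So closeness
  on finitely many elements of the direct sum makes \<open>mix t \<phi>\<^sub>1 \<psi>\<^sub>1\<close> close to \<open>\<psi>\<^sub>1\<close> on a given finite set,
  likewise in the second summand, and the metrics of the summands turn this into small distances.
\<close>

lemma glued_metrizes: "metrizes_weak_star L"
proof (rule metrizes_weak_starI)
  have m1: "metrizes_weak_star L1" and m2: "metrizes_weak_star L2"
    using qcmsD(8)[OF q1] qcmsD(8)[OF q2] .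
  show fin: "mk L \<phi> \<psi> < top" if "\<phi> \<in> states" "\<psi> \<in> states" for \<phi> \<psi>
    using m1 m2 that by (intro mk_finite) (auto simp: metrizes_weak_star_def)
  fix \<phi>\<^sub>0 :: "('a, 'b) dsum \<Rightarrow> complex" and e :: real
  assume \<phi>\<^sub>0: "\<phi>\<^sub>0 \<in> states" and e: "0 < e"
  obtain s \<psi>\<^sub>1 \<psi>\<^sub>2 where s: "0 \<le> s" "s \<le> 1" and \<psi>: "\<psi>\<^sub>1 \<in> states" "\<psi>\<^sub>2 \<in> states"
    and \<phi>\<^sub>0_eq: "\<phi>\<^sub>0 = mix s (\<psi>\<^sub>1 \<circ> dfst) (\<psi>\<^sub>2 \<circ> dsnd)"
    using states_decomp[OF \<phi>\<^sub>0] by blast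
  have e3: "0 < e / 3" using e by simp
  obtain S1 \<delta>1 where S1: "finite S1" "0 < \<delta>1" "\<And>\<phi>. \<phi> \<in> states \<Longrightarrow>
      (\<And>a. a \<in> S1 \<Longrightarrow> cmod (\<phi> a - \<psi>\<^sub>1 a) < \<delta>1) \<Longrightarrow> mk L1 \<phi> \<psi>\<^sub>1 < ennreal (e / 3)"
    using metrizes_weak_starD[OF m1 \<psi>(1) e3] by blast
  obtain S2 \<delta>2 where S2: "finite S2" "0 < \<delta>2" "\<And>\<phi>. \<phi> \<in> states \<Longrightarrow>
      (\<And>a. a \<in> S2 \<Longrightarrow> cmod (\<phi> a - \<psi>\<^sub>2 a) < \<delta>2) \<Longrightarrow> mk L2 \<phi> \<psi>\<^sub>2 < ennreal (e / 3)"
    using metrizes_weak_starD[OF m2 \<psi>(2) e3] by blast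
  have "mk L (\<psi>\<^sub>1 \<circ> dfst) (\<psi>\<^sub>2 \<circ> dsnd) < top"
    by (intro fin states_comp_morphism \<psi> unital_star_morphism_dfst unital_star_morphism_dsnd)
  then obtain K where K: "mk L (\<psi>\<^sub>1 \<circ> dfst) (\<psi>\<^sub>2 \<circ> dsnd) = ennreal K" "0 \<le> K"
    by (cases "mk L (\<psi>\<^sub>1 \<circ> dfst) (\<psi>\<^sub>2 \<circ> dsnd)") auto
  \<comment> \<open>\<open>M\<close> absorbs the correction term \<open>(t - s) \<psi>\<^sub>i a\<close>, and \<open>K\<close> the term with \<open>\<bar>t - s\<bar>\<close>.\<close>
  define M where "M = 1 + (\<Sum>a\<in>S1. cmod (\<psi>\<^sub>1 a)) + (\<Sum>a\<in>S2. cmod (\<psi>\<^sub>2 a))"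
  have M1: "1 + cmod (\<psi>\<^sub>1 a) \<le> M" if "a \<in> S1" for a
    unfolding M_def using member_le_sum[OF that, of "\<lambda>a. cmod (\<psi>\<^sub>1 a)"] S1(1)
    by (simp add: sum_nonneg add_increasing2)
  have M2: "1 + cmod (\<psi>\<^sub>2 a) \<le> M" if "a \<in> S2" for a
    unfolding M_def using member_le_sum[OF that, of "\<lambda>a. cmod (\<psi>\<^sub>2 a)"] S2(1)
      sum_nonneg[of S1 "\<lambda>a. cmod (\<psi>\<^sub>1 a)"] by simp
  have M: "0 < M" unfolding M_def by (intro add_pos_nonneg sum_nonneg) auto
  define \<delta> where "\<delta> = min (min (\<delta>1 / M) (\<delta>2 / M)) (e / (3 * (K + 1)))"
  have \<delta>: "0 < \<delta>" "\<delta> * M \<le> \<delta>1" "\<delta> * M \<le> \<delta>2" "\<delta> * (K + 1) \<le> e / 3"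
  proof -
    show "0 < \<delta>" using S1(2) S2(2) M K(2) e by (simp add: \<delta>_def)
    have "\<delta> \<le> \<delta>1 / M" "\<delta> \<le> \<delta>2 / M" "\<delta> \<le> e / (3 * (K + 1))" by (simp_all add: \<delta>_def)
    then show "\<delta> * M \<le> \<delta>1" "\<delta> * M \<le> \<delta>2" "\<delta> * (K + 1) \<le> e / 3"
      using M K(2) by (simp_all add: le_divide_eq algebra_simps)
  qed
  define S where "S = insert (DSum 1 0) ((\<lambda>a. DSum a 0) ` S1 \<union> (\<lambda>a. DSum 0 a) ` S2)"
  have "mk L \<phi> \<phi>\<^sub>0 < ennreal e" if \<phi>: "\<phi> \<in> states" and near: "\<forall>a\<in>S. cmod (\<phi> a - \<phi>\<^sub>0 a) < \<delta>" for \<phi>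
  proof -
    obtain t \<phi>\<^sub>1 \<phi>\<^sub>2 where t: "0 \<le> t" "t \<le> 1" and st: "\<phi>\<^sub>1 \<in> states" "\<phi>\<^sub>2 \<in> states"
      and \<phi>_eq: "\<phi> = mix t (\<phi>\<^sub>1 \<circ> dfst) (\<phi>\<^sub>2 \<circ> dsnd)"
      using states_decomp[OF \<phi>] by blast
    have ts: "\<bar>t - s\<bar> < \<delta>"
    proof -
      have "\<phi> (DSum 1 0) - \<phi>\<^sub>0 (DSum 1 0) = of_real (t - s)"
        by (simp add: \<phi>_eq \<phi>\<^sub>0_eq mix_def clinear_zero[OF statesD(1)] st \<psi> statesD(2))
      then have "cmod (of_real (t - s)) < \<delta>" using near by (auto simp: S_def)
      then show ?thesis by (simp only: norm_of_real)
    qed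
    have "mk L1 (mix t \<phi>\<^sub>1 \<psi>\<^sub>1) \<psi>\<^sub>1 < ennreal (e / 3)"
    proof (rule S1(3)[OF states_mix[OF st(1) \<psi>(1) t]])
      fix a assume a: "a \<in> S1"
      have "mix t \<phi>\<^sub>1 \<psi>\<^sub>1 a - \<psi>\<^sub>1 a = (\<phi> (DSum a 0) - \<phi>\<^sub>0 (DSum a 0)) - of_real (t - s) * \<psi>\<^sub>1 a"
        by (simp add: \<phi>_eq \<phi>\<^sub>0_eq mix_def clinear_zero[OF statesD(1)] st \<psi> algebra_simps)
      then have "cmod (mix t \<phi>\<^sub>1 \<psi>\<^sub>1 a - \<psi>\<^sub>1 a) \<le> cmod (\<phi> (DSum a 0) - \<phi>\<^sub>0 (DSum a 0)) + \<bar>t - s\<bar> * cmod (\<psi>\<^sub>1 a)"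
        by (metis norm_triangle_ineq4 norm_mult norm_of_real)
      also have "\<dots> < \<delta> + \<delta> * cmod (\<psi>\<^sub>1 a)"
        using near a ts by (intro add_less_le_mono mult_right_mono) (auto simp: S_def)
      also have "\<dots> = \<delta> * (1 + cmod (\<psi>\<^sub>1 a))" by (simp add: algebra_simps)
      also have "\<dots> \<le> \<delta> * M" using M1[OF a] \<delta>(1) by (intro mult_left_mono) auto
      also have "\<dots> \<le> \<delta>1" by (rule \<delta>(2))
      finally show "cmod (mix t \<phi>\<^sub>1 \<psi>\<^sub>1 a - \<psi>\<^sub>1 a) < \<delta>1" .
    qed
    moreover have "mk L2 (mix (1 - t) \<phi>\<^sub>2 \<psi>\<^sub>2) \<psi>\<^sub>2 < ennreal (e / 3)"
    proof (rule S2(3)[OF states_mix[OF st(2) \<psi>(2)]])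
      fix a assume a: "a \<in> S2"
      have "mix (1 - t) \<phi>\<^sub>2 \<psi>\<^sub>2 a - \<psi>\<^sub>2 a = (\<phi> (DSum 0 a) - \<phi>\<^sub>0 (DSum 0 a)) + of_real (t - s) * \<psi>\<^sub>2 a"
        by (simp add: \<phi>_eq \<phi>\<^sub>0_eq mix_def clinear_zero[OF statesD(1)] st \<psi> algebra_simps)
      then have "cmod (mix (1 - t) \<phi>\<^sub>2 \<psi>\<^sub>2 a - \<psi>\<^sub>2 a) \<le> cmod (\<phi> (DSum 0 a) - \<phi>\<^sub>0 (DSum 0 a)) + \<bar>t - s\<bar> * cmod (\<psi>\<^sub>2 a)"
        by (metis norm_triangle_ineq norm_mult norm_of_real)
      also have "\<dots> < \<delta> + \<delta> * cmod (\<psi>\<^sub>2 a)"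
        using near a ts by (intro add_less_le_mono mult_right_mono) (auto simp: S_def)
      also have "\<dots> = \<delta> * (1 + cmod (\<psi>\<^sub>2 a))" by (simp add: algebra_simps)
      also have "\<dots> \<le> \<delta> * M" using M2[OF a] \<delta>(1) by (intro mult_left_mono) auto
      also have "\<dots> \<le> \<delta>2" by (rule \<delta>(3))
      finally show "cmod (mix (1 - t) \<phi>\<^sub>2 \<psi>\<^sub>2 a - \<psi>\<^sub>2 a) < \<delta>2" .
    qed (use t in auto)
    moreover have "ennreal \<bar>t - s\<bar> * mk L (\<psi>\<^sub>1 \<circ> dfst) (\<psi>\<^sub>2 \<circ> dsnd) \<le> ennreal (e / 3)"
    proof -
      have "\<bar>t - s\<bar> * K \<le> \<delta> * (K + 1)" using ts K(2) \<delta>(1) by (intro mult_mono) auto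
      then have "\<bar>t - s\<bar> * K \<le> e / 3" using \<delta>(4) by linarith
      then show ?thesis using K by (simp add: ennreal_mult[symmetric] ennreal_leI)
    qed
    ultimately have "mk L1 (mix t \<phi>\<^sub>1 \<psi>\<^sub>1) \<psi>\<^sub>1 + mk L2 (mix (1 - t) \<phi>\<^sub>2 \<psi>\<^sub>2) \<psi>\<^sub>2
        + ennreal \<bar>t - s\<bar> * mk L (\<psi>\<^sub>1 \<circ> dfst) (\<psi>\<^sub>2 \<circ> dsnd)
        < ennreal (3 * (e / 3))"
      by (intro ennreal_add3_less e3)
    also have "3 * (e / 3) = e" by simp
    finally show ?thesis
      using mk_mix_mix_le[OF t, of \<phi>\<^sub>1 \<phi>\<^sub>2 s \<psi>\<^sub>1 \<psi>\<^sub>2] unfolding \<phi>_eq \<phi>\<^sub>0_eq by (rule order_le_less_trans[rotated])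
  qed
  moreover have "finite S" using S1(1) S2(1) by (simp add: S_def)
  ultimately show "\<exists>S \<delta>. finite S \<and> 0 < \<delta> \<and>
      (\<forall>\<phi>\<in>states. (\<forall>a\<in>S. cmod (\<phi> a - \<phi>\<^sub>0 a) < \<delta>) \<longrightarrow> mk L \<phi> \<phi>\<^sub>0 < ennreal e)"
    using \<delta>(1) by (intro exI[of _ S] exI[of _ \<delta>]) auto
qed (use subspace_Ldom_glued dense_Ldom_glued glued_scale in auto)

theorem qcms_glued:
  assumes "permissible F"
  shows "qcms F L"
proof -
  have "jordan d e \<in> Ldom L \<and> lie d e \<in> Ldom L" if "d \<in> Ldom L" "e \<in> Ldom L" for d e
    using that qcmsD(5,6)[OF q1] qcmsD(5,6)[OF q2]
    by (simp add: Ldom_iff morphism_jordan morphism_lie unital_star_morphism_dfst unital_star_morphism_dsnd)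
  then show ?thesis
    unfolding qcms_def
    using subspace_Ldom_glued dense_Ldom_glued glued_triangle glued_scale glued_kernel glued_metrizes
      glued_leibniz[OF assms] glued_lower_semicontinuous
    by (simp add: max.boundedI)
qed

end



section \<open>Composing almost isometries of monoids\<close>

lemma UIso_swap: "(s, k) \<in> UIso \<epsilon> r \<Longrightarrow> (k, s) \<in> UIso \<epsilon> r"
  by (auto simp: UIso_def)

lemma UIsoD:
  assumes "(s, k) \<in> UIso \<epsilon> r"
  shows "cball 1 r \<subseteq> dom s" "s 1 = Some 1" "k 1 = Some 1"
    "g \<in> cball 1 r \<Longrightarrow> g' \<in> cball 1 r \<Longrightarrow> h \<in> cball 1 r \<Longrightarrow>
      \<bar>dist (the (s g) * the (s g')) h - dist (g * g') (the (k h))\<bar> \<le> \<epsilon>"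
  using assms by (auto simp: UIso_def)

text \<open>Take \<open>g' = h = 1\<close> in the defining inequality.\<close>

lemma UIso_moves_ball:
  assumes sk: "(s, k) \<in> UIso \<epsilon> r" and "0 \<le> r" and g: "g \<in> cball 1 r"
  shows "dist 1 (the (s g)) \<le> dist 1 g + \<epsilon>"
proof -
  have "1 \<in> cball 1 r" using \<open>0 \<le> r\<close> by simp
  then have "\<bar>dist (the (s g)) 1 - dist g 1\<bar> \<le> \<epsilon>"
    using UIsoD(4)[OF sk g, of 1 1] UIsoD(2,3)[OF sk] by simp
  then show ?thesis by (simp add: dist_commute abs_le_iff)
qed

text \<open>
  Clearing denominators, the second inequality is \<open>e2 * (e1 + e2) \<le> 1\<close>, which is where the bound
  \<open>sqrt 2 / 2\<close> comes from.
\<close>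

lemma radius_slack:
  fixes e1 e2 :: real
  assumes "0 < e1" "e1 < sqrt 2 / 2" "0 < e2" "e2 < sqrt 2 / 2"
  shows "1 / (e1 + e2) \<le> 1 / e1" "1 / (e1 + e2) + e1 \<le> 1 / e2"
proof -
  show "1 / (e1 + e2) \<le> 1 / e1"
    using assms by (intro divide_left_mono) auto
  have sq: "(sqrt 2 / 2) * (sqrt 2 / 2) = 1 / 2" by simp
  have "e2 * (e1 + e2) \<le> (sqrt 2 / 2) * (sqrt 2 / 2 + sqrt 2 / 2)"
    using assms by (intro mult_mono add_mono) auto
  also have "\<dots> = 1" using sq by (simp add: distrib_left)
  finally have "e2 * (e1 + e2) \<le> 1" .
  then have "e1 * (e2 * (e1 + e2)) \<le> e1" using assms(1) by (simp add: mult_left_le)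
  then have "e2 * (1 + e1 * (e1 + e2)) \<le> e1 + e2" by (simp add: algebra_simps)
  then have "(1 + e1 * (e1 + e2)) / (e1 + e2) \<le> 1 / e2"
    using assms by (simp add: field_simps)
  also have "(1 + e1 * (e1 + e2)) / (e1 + e2) = 1 / (e1 + e2) + e1"
    using assms by (simp add: add_divide_distrib)
  finally show "1 / (e1 + e2) + e1 \<le> 1 / e2" .
qed

lemma UIso_image_in_ball:
  assumes sk: "(s, k) \<in> UIso e1 (1 / e1)"
    and e: "0 < e1" "e1 < sqrt 2 / 2" "0 < e2" "e2 < sqrt 2 / 2"
    and g: "g \<in> cball 1 (1 / (e1 + e2))"
  shows "g \<in> cball 1 (1 / e1)" "\<exists>g'. s g = Some g'" "the (s g) \<in> cball 1 (1 / e2)"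
proof -
  show g': "g \<in> cball 1 (1 / e1)" using g radius_slack(1)[OF e] by simp
  then show "\<exists>g'. s g = Some g'" using UIsoD(1)[OF sk] by blast
  have "dist 1 (the (s g)) \<le> 1 / (e1 + e2) + e1"
    using UIso_moves_ball[OF sk _ g'] e(1) g by simp
  then show "the (s g) \<in> cball 1 (1 / e2)" using radius_slack(2)[OF e] by simp
qed

text \<open>
  The points \<open>s1 g\<close>, \<open>s1 g'\<close> and \<open>k2 h\<close> lie in the balls where the estimates for the other pair hold, so the
  intermediate quantity \<open>dist (s1 g * s1 g') (k2 h)\<close> is within \<open>e2\<close> of one end and within \<open>e1\<close> of the other.
\<close>

lemma UIso_comp_estimate:
  assumes sk1: "(s1, k1) \<in> UIso e1 (1 / e1)" and sk2: "(s2, k2) \<in> UIso e2 (1 / e2)"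
    and e: "0 < e1" "e1 < sqrt 2 / 2" "0 < e2" "e2 < sqrt 2 / 2"
    and g: "g \<in> cball 1 (1 / (e1 + e2))" "g' \<in> cball 1 (1 / (e1 + e2))"
    and h: "h \<in> cball 1 (1 / (e1 + e2))"
  shows "\<bar>dist (the ((s2 \<circ>\<^sub>m s1) g) * the ((s2 \<circ>\<^sub>m s1) g')) h - dist (g * g') (the ((k1 \<circ>\<^sub>m k2) h))\<bar>
    \<le> e1 + e2"
proof -
  have e': "0 < e2" "e2 < sqrt 2 / 2" "0 < e1" "e1 < sqrt 2 / 2" using e by auto
  have h': "h \<in> cball 1 (1 / (e2 + e1))" using h by (simp add: add.commute)
  note G = UIso_image_in_ball[OF sk1 e g(1)] and G' = UIso_image_in_ball[OF sk1 e g(2)]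
    and H = UIso_image_in_ball[OF UIso_swap[OF sk2] e' h']
  have comp: "(s2 \<circ>\<^sub>m s1) g = s2 (the (s1 g))" "(s2 \<circ>\<^sub>m s1) g' = s2 (the (s1 g'))"
    "(k1 \<circ>\<^sub>m k2) h = k1 (the (k2 h))"
    using G(2) G'(2) H(2) by auto
  show ?thesis
    using UIsoD(4)[OF sk2 G(3) G'(3) H(1)] UIsoD(4)[OF sk1 G(1) G'(1) H(3)]
    unfolding comp by linarith
qed

theorem UIso_comp:
  fixes s1 :: "'g::proper_monoid \<rightharpoonup> 'h::proper_monoid" and s2 :: "'h \<rightharpoonup> 'k::proper_monoid"
  assumes sk1: "(s1, k1) \<in> UIso e1 (1 / e1)" and sk2: "(s2, k2) \<in> UIso e2 (1 / e2)"
    and e: "0 < e1" "e1 < sqrt 2 / 2" "0 < e2" "e2 < sqrt 2 / 2"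
  shows "(s2 \<circ>\<^sub>m s1, k1 \<circ>\<^sub>m k2) \<in> UIso (e1 + e2) (1 / (e1 + e2))"
proof -
  have e': "0 < e2" "e2 < sqrt 2 / 2" "0 < e1" "e1 < sqrt 2 / 2" using e by auto
  have dom: "cball 1 (1 / (e1 + e2)) \<subseteq> dom (s2 \<circ>\<^sub>m s1)"
  proof
    fix g :: 'g assume "g \<in> cball 1 (1 / (e1 + e2))"
    note G = UIso_image_in_ball[OF sk1 e this]
    have "the (s1 g) \<in> dom s2" using G(3) UIsoD(1)[OF sk2] by blast
    then show "g \<in> dom (s2 \<circ>\<^sub>m s1)" using G(2) by auto
  qed
  have dom': "cball 1 (1 / (e1 + e2)) \<subseteq> dom (k1 \<circ>\<^sub>m k2)"
  proof
    fix h :: 'k assume "h \<in> cball 1 (1 / (e1 + e2))"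
    then have "h \<in> cball 1 (1 / (e2 + e1))" by (simp add: add.commute)
    note H = UIso_image_in_ball[OF UIso_swap[OF sk2] e' this]
    have "the (k2 h) \<in> dom k1" using H(3) UIsoD(1)[OF UIso_swap[OF sk1]] by blast
    then show "h \<in> dom (k1 \<circ>\<^sub>m k2)" using H(2) by auto
  qed
  have est': "\<bar>dist (the ((k1 \<circ>\<^sub>m k2) h) * the ((k1 \<circ>\<^sub>m k2) h')) g - dist (h * h') (the ((s2 \<circ>\<^sub>m s1) g))\<bar>
      \<le> e1 + e2"
    if "h \<in> cball 1 (1 / (e1 + e2))" "h' \<in> cball 1 (1 / (e1 + e2))" "g \<in> cball 1 (1 / (e1 + e2))" for g h h'
    using UIso_comp_estimate[OF UIso_swap[OF sk2] UIso_swap[OF sk1] e'] that by (simp add: add.commute)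
  show ?thesis
    unfolding UIso_def
    using dom dom' UIsoD(2,3)[OF sk1] UIsoD(2,3)[OF sk2] UIso_comp_estimate[OF sk1 sk2 e] est'
    by simp
qed


section \<open>Composition of covariant tunnels\<close>

text \<open>
  Pullbacks of states are states, so one of the two halves of the Hausdorff distance is zero.
\<close>

lemma haus_states_pullback:
  assumes "unital_star_morphism p"
  shows "haus (mk L) states ((\<lambda>\<phi>. \<phi> \<circ> p) ` states) = (SUP \<phi>\<in>states. INF \<theta>\<in>states. mk L \<phi> (\<theta> \<circ> p))"
proof -
  have "(INF \<phi>\<in>states. mk L \<phi> (\<theta> \<circ> p)) \<le> 0" if "\<theta> \<in> states" for \<theta>
    using INF_lower[of "\<theta> \<circ> p" states "\<lambda>\<phi>. mk L \<phi> (\<theta> \<circ> p)"] states_comp_morphism[OF that assms] by simp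
  then have "(SUP \<psi>\<in>(\<lambda>\<phi>. \<phi> \<circ> p) ` states. INF \<phi>\<in>states. mk L \<phi> \<psi>) \<le> 0"
    by (intro SUP_least) auto
  then show ?thesis
    by (simp add: haus_def image_image max_absorb1)
qed

theorem theorem3p14:
  fixes F :: "real \<Rightarrow> real \<Rightarrow> real \<Rightarrow> real \<Rightarrow> real"
    and A :: "('a::unital_cstar_algebra, 'g1::proper_monoid) system"
    and B :: "('b::unital_cstar_algebra, 'g2::proper_monoid) system"
    and E :: "('e::unital_cstar_algebra, 'g3::proper_monoid) system"
    and \<tau>\<^sub>1 :: "('d1::unital_cstar_algebra, 'a, 'b, 'g1, 'g2) tunnel"
    and \<tau>\<^sub>2 :: "('d2::unital_cstar_algebra, 'b, 'e, 'g2, 'g3) tunnel"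
    and \<epsilon>\<^sub>1 \<epsilon>\<^sub>2 \<epsilon> :: real
  assumes "permissible F"
    and "lipschitz_dynamical_system F A"
    and "lipschitz_dynamical_system F B"
    and "lipschitz_dynamical_system F E"
    and "0 < \<epsilon>\<^sub>1" "\<epsilon>\<^sub>1 < sqrt 2 / 2"
    and "0 < \<epsilon>\<^sub>2" "\<epsilon>\<^sub>2 < sqrt 2 / 2"
    and "covariant_tunnel F \<epsilon>\<^sub>1 A B \<tau>\<^sub>1"
    and "covariant_tunnel F \<epsilon>\<^sub>2 B E \<tau>\<^sub>2"
    and "0 < \<epsilon>"
  shows "covariant_tunnel F (\<epsilon>\<^sub>1 + \<epsilon>\<^sub>2) A E (tunnel_comp \<epsilon> \<tau>\<^sub>1 \<tau>\<^sub>2) \<and>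
    magnitude (\<epsilon>\<^sub>1 + \<epsilon>\<^sub>2) A E (tunnel_comp \<epsilon> \<tau>\<^sub>1 \<tau>\<^sub>2)
      \<le> magnitude \<epsilon>\<^sub>1 A B \<tau>\<^sub>1 + magnitude \<epsilon>\<^sub>2 B E \<tau>\<^sub>2 + ennreal \<epsilon>"
proof -
  let ?\<tau> = "tunnel_comp \<epsilon> \<tau>\<^sub>1 \<tau>\<^sub>2"
  define L where "L = glued_seminorm \<epsilon> (tunL \<tau>\<^sub>1) (tunL \<tau>\<^sub>2) (pi2 \<tau>\<^sub>1) (pi1 \<tau>\<^sub>2)"
  note t1 = assms(9)[unfolded covariant_tunnel_def] and t2 = assms(10)[unfolded covariant_tunnel_def]
  have sk1: "(sig1 \<tau>\<^sub>1, sig2 \<tau>\<^sub>1) \<in> UIso \<epsilon>\<^sub>1 (1 / \<epsilon>\<^sub>1)" and q1: "qcms F (tunL \<tau>\<^sub>1)"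
    and iA: "quantum_isometry (tunL \<tau>\<^sub>1) (sysL A) (pi1 \<tau>\<^sub>1)"
    and i1: "quantum_isometry (tunL \<tau>\<^sub>1) (sysL B) (pi2 \<tau>\<^sub>1)"
    using t1 by auto
  have sk2: "(sig1 \<tau>\<^sub>2, sig2 \<tau>\<^sub>2) \<in> UIso \<epsilon>\<^sub>2 (1 / \<epsilon>\<^sub>2)" and q2: "qcms F (tunL \<tau>\<^sub>2)"
    and i2: "quantum_isometry (tunL \<tau>\<^sub>2) (sysL B) (pi1 \<tau>\<^sub>2)"
    and iE: "quantum_isometry (tunL \<tau>\<^sub>2) (sysL E) (pi2 \<tau>\<^sub>2)"
    using t2 by auto
  have e: "0 < \<epsilon>\<^sub>1" "\<epsilon>\<^sub>1 < sqrt 2 / 2" "0 < \<epsilon>\<^sub>2" "\<epsilon>\<^sub>2 < sqrt 2 / 2"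
    and e': "0 < \<epsilon>\<^sub>2" "\<epsilon>\<^sub>2 < sqrt 2 / 2" "0 < \<epsilon>\<^sub>1" "\<epsilon>\<^sub>1 < sqrt 2 / 2"
    using assms by auto
  have \<beta>: "positive_unital_linear (act B h)" for h
    using assms(3) by (simp add: lipschitz_dynamical_system_def)
  have sel: "tunL ?\<tau> = L" "pi1 ?\<tau> = (\<lambda>d. pi1 \<tau>\<^sub>1 (dfst d))" "pi2 ?\<tau> = (\<lambda>d. pi2 \<tau>\<^sub>2 (dsnd d))"
    "sig1 ?\<tau> = sig1 \<tau>\<^sub>2 \<circ>\<^sub>m sig1 \<tau>\<^sub>1" "sig2 ?\<tau> = sig2 \<tau>\<^sub>1 \<circ>\<^sub>m sig2 \<tau>\<^sub>2"
    by (simp_all add: tunnel_comp_def L_def glued_seminorm_def)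
  interpret fwd: glued L "tunL \<tau>\<^sub>1" "tunL \<tau>\<^sub>2" "sysL B" dfst dsnd "pi2 \<tau>\<^sub>1" "pi1 \<tau>\<^sub>2" \<epsilon>
    unfolding L_def by (rule glued_glued_seminorm[OF i1 i2 assms(11)])
  interpret bwd: glued L "tunL \<tau>\<^sub>2" "tunL \<tau>\<^sub>1" "sysL B" dsnd dfst "pi1 \<tau>\<^sub>2" "pi2 \<tau>\<^sub>1" \<epsilon>
    by (rule fwd.flip)
  note isoA = fwd.quantum_isometry_p1[OF iA] and isoE = fwd.quantum_isometry_p2[OF iE]
  have "covariant_tunnel F (\<epsilon>\<^sub>1 + \<epsilon>\<^sub>2) A E ?\<tau>"
    unfolding covariant_tunnel_def sel
    using e UIso_comp[OF sk1 sk2 e] qcms_glued[OF q1 q2 i1 i2 assms(11,1)] isoA isoE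
    by (simp add: L_def)
  moreover
  define m1 m2 where "m1 = magnitude \<epsilon>\<^sub>1 A B \<tau>\<^sub>1" and "m2 = magnitude \<epsilon>\<^sub>2 B E \<tau>\<^sub>2"
  have ext: "(INF \<theta>\<in>states. mk (tunL \<tau>\<^sub>1) \<phi> (\<theta> \<circ> pi1 \<tau>\<^sub>1)) \<le> m1"
    "(INF \<theta>\<in>states. mk (tunL \<tau>\<^sub>1) \<phi> (\<theta> \<circ> pi2 \<tau>\<^sub>1)) \<le> m1" if "\<phi> \<in> states" for \<phi>
    using that unfolding m1_def magnitude_def extent_def
      haus_states_pullback[OF quantum_isometryD(1)[OF iA]] haus_states_pullback[OF quantum_isometryD(1)[OF i1]]
    by (auto simp: le_max_iff_disj intro: SUP_upper2)
  have ext': "(INF \<theta>\<in>states. mk (tunL \<tau>\<^sub>2) \<phi> (\<theta> \<circ> pi1 \<tau>\<^sub>2)) \<le> m2"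
    "(INF \<theta>\<in>states. mk (tunL \<tau>\<^sub>2) \<phi> (\<theta> \<circ> pi2 \<tau>\<^sub>2)) \<le> m2" if "\<phi> \<in> states" for \<phi>
    using that unfolding m2_def magnitude_def extent_def
      haus_states_pullback[OF quantum_isometryD(1)[OF i2]] haus_states_pullback[OF quantum_isometryD(1)[OF iE]]
    by (auto simp: le_max_iff_disj intro: SUP_upper2)
  have flip_sum: "m2 + m1 + ennreal \<epsilon> = m1 + m2 + ennreal \<epsilon>" by (simp add: add.commute)
  have "extent ?\<tau> \<le> m1 + m2 + ennreal \<epsilon>"
    unfolding extent_def sel haus_states_pullback[OF quantum_isometryD(1)[OF isoA]]
      haus_states_pullback[OF quantum_isometryD(1)[OF isoE]]
    using fwd.approximation_by_pullbacks_p1[OF ext(1) ext'(1)]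
      bwd.approximation_by_pullbacks_p1[OF ext'(2) ext(2)]
    by (intro max.boundedI SUP_least) (simp_all add: flip_sum)
  moreover have "reach (\<epsilon>\<^sub>1 + \<epsilon>\<^sub>2) A E ?\<tau> \<le> m1 + m2 + ennreal \<epsilon>"
    unfolding reach_def sel
  proof (rule max.boundedI)
    have r1: "(SUP \<phi>\<in>states. INF \<psi>\<in>states. SUP g\<in>cball 1 (1 / \<epsilon>\<^sub>1). mk (tunL \<tau>\<^sub>1)
        (\<phi> \<circ> act A g \<circ> pi1 \<tau>\<^sub>1) (\<psi> \<circ> act B (the (sig1 \<tau>\<^sub>1 g)) \<circ> pi2 \<tau>\<^sub>1)) \<le> m1"
      and r1': "(SUP \<phi>\<in>states. INF \<psi>\<in>states. SUP g\<in>cball 1 (1 / \<epsilon>\<^sub>1). mk (tunL \<tau>\<^sub>1)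
        (\<phi> \<circ> act B g \<circ> pi2 \<tau>\<^sub>1) (\<psi> \<circ> act A (the (sig2 \<tau>\<^sub>1 g)) \<circ> pi1 \<tau>\<^sub>1)) \<le> m1"
      by (simp_all add: m1_def magnitude_def reach_def le_max_iff_disj)
    have r2: "(SUP \<phi>\<in>states. INF \<psi>\<in>states. SUP g\<in>cball 1 (1 / \<epsilon>\<^sub>2). mk (tunL \<tau>\<^sub>2)
        (\<phi> \<circ> act B g \<circ> pi1 \<tau>\<^sub>2) (\<psi> \<circ> act E (the (sig1 \<tau>\<^sub>2 g)) \<circ> pi2 \<tau>\<^sub>2)) \<le> m2"
      and r2': "(SUP \<phi>\<in>states. INF \<psi>\<in>states. SUP g\<in>cball 1 (1 / \<epsilon>\<^sub>2). mk (tunL \<tau>\<^sub>2)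
        (\<phi> \<circ> act E g \<circ> pi2 \<tau>\<^sub>2) (\<psi> \<circ> act B (the (sig2 \<tau>\<^sub>2 g)) \<circ> pi1 \<tau>\<^sub>2)) \<le> m2"
      by (simp_all add: m2_def magnitude_def reach_def le_max_iff_disj)
    note G = UIso_image_in_ball[OF sk1 e] and H = UIso_image_in_ball[OF UIso_swap[OF sk2] e']
    show "(SUP \<phi>\<in>states. INF \<psi>\<in>states. SUP g\<in>cball 1 (1 / (\<epsilon>\<^sub>1 + \<epsilon>\<^sub>2)). mk L
        (\<phi> \<circ> act A g \<circ> (\<lambda>d. pi1 \<tau>\<^sub>1 (dfst d)))
        (\<psi> \<circ> act E (the ((sig1 \<tau>\<^sub>2 \<circ>\<^sub>m sig1 \<tau>\<^sub>1) g)) \<circ> (\<lambda>d. pi2 \<tau>\<^sub>2 (dsnd d)))) \<le> m1 + m2 + ennreal \<epsilon>"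
    proof (rule fwd.reach_p1_to_p2[where \<beta> = "act B" and \<sigma> = "\<lambda>g. the (sig1 \<tau>\<^sub>1 g)"
          and \<sigma>' = "\<lambda>h. the (sig1 \<tau>\<^sub>2 h)", OF r1 r2 _ _ _ \<beta>])
      show "the ((sig1 \<tau>\<^sub>2 \<circ>\<^sub>m sig1 \<tau>\<^sub>1) g) = the (sig1 \<tau>\<^sub>2 (the (sig1 \<tau>\<^sub>1 g)))"
        if "g \<in> cball 1 (1 / (\<epsilon>\<^sub>1 + \<epsilon>\<^sub>2))" for g
        using G(2)[OF that] by auto
    qed (use G(1,3) in blast)+
    show "(SUP \<phi>\<in>states. INF \<psi>\<in>states. SUP g\<in>cball 1 (1 / (\<epsilon>\<^sub>1 + \<epsilon>\<^sub>2)). mk L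
        (\<phi> \<circ> act E g \<circ> (\<lambda>d. pi2 \<tau>\<^sub>2 (dsnd d)))
        (\<psi> \<circ> act A (the ((sig2 \<tau>\<^sub>1 \<circ>\<^sub>m sig2 \<tau>\<^sub>2) g)) \<circ> (\<lambda>d. pi1 \<tau>\<^sub>1 (dfst d)))) \<le> m1 + m2 + ennreal \<epsilon>"
      unfolding flip_sum[symmetric] add.commute[of \<epsilon>\<^sub>1]
    proof (rule bwd.reach_p1_to_p2[where \<beta> = "act B" and \<sigma> = "\<lambda>h. the (sig2 \<tau>\<^sub>2 h)"
          and \<sigma>' = "\<lambda>g. the (sig2 \<tau>\<^sub>1 g)", OF r2' r1' _ _ _ \<beta>])
      show "the ((sig2 \<tau>\<^sub>1 \<circ>\<^sub>m sig2 \<tau>\<^sub>2) g) = the (sig2 \<tau>\<^sub>1 (the (sig2 \<tau>\<^sub>2 g)))"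
        if "g \<in> cball 1 (1 / (\<epsilon>\<^sub>2 + \<epsilon>\<^sub>1))" for g
        using H(2)[OF that] by auto
    qed (use H(1,3) in blast)+
  qed
  ultimately show ?thesis
    by (simp add: magnitude_def[of "\<epsilon>\<^sub>1 + \<epsilon>\<^sub>2"] m1_def m2_def)
qed

end
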